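(* Let $f,g,h,R$ satisfy the data assumption stated in the context. Let $\Omega_{-1}\subset\mathbb{R}^N$ be a bounded domain, let $u_0\in C^\infty(\Omega_{-1},\mathbb{R}^M)$, and suppose that $(u_0,\Omega_{-1})$ is an admissible controller--domain pair. Then the sequence $\{(u_s,\Omega_{s-1})\}_{s}$ generated by the domain-aware policy iteration described in the context satisfies, for every $s\in\mathbb{N}_0$: 1. $\Omega_{s-1}\subset\mathbb{R}^N$ is non-empty; 2. $u_s\in C^\infty(\Omega_{s-1},\mathbb{R}^M)$; 3. $(u_s,\Omega_{s-1})$ is an admissible controller--domain pair. Consequently the iterations of the domain-aware policy iteration are well-defined (each step (i)--(iii) of the recursion in the context can be carried out for every $s\in\mathbb{N}_0$).
   Context: A domain is a non-empty, open and connected subset of $\mathbb{R}^N$; $\|\cdot\|$ is the Euclidean norm; $\operatorname{cl}$ denotes closure; $B_\varepsilon(0)$ is the open ball of radius $\varepsilon$ about $0$. Data assumption: $f\in C^\infty(\mathbb{R}^N,\mathbb{R}^N)$, $g\in C^\infty(\mathbb{R}^N,\mathbb{R}^{N\times M})$, $h\in C^\infty(\mathbb{R}^N,\mathbb{R})$, $R\in\mathbb{R}^{M\times M}$ is symmetric positive-definite, $f(0)=0$, and $h$ is a positive-definite function, i.e. $h(0)=0$ and $h(x)>0$ for $x\ne0$. For a feedback controller $u:\Omega\to\mathbb{R}^M$, $\mathbf{x}_u(t;x)$ denotes the solution of the closed-loop system $\dot{\mathbf{x}}_u(t;x)=f(\mathbf{x}_u(t;x))+g(\mathbf{x}_u(t;x))u(\mathbf{x}_u(t;x))$,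 $\mathbf{x}_u(0;x)=x$. Admissible controller--domain pair: for a domain $\Omega\subset\mathbb{R}^N$ and $u\in C^0(\Omega,\mathbb{R}^M)$, the pair $(u,\Omega)$ is admissible if (1) $0\in\Omega$; (2) $u(0)=0$; (3) for every $x\in\Omega$, $\mathbf{x}_u(t;x)\in\Omega$ for all $t\ge0$; (4) $\lim_{t\to\infty}\|\mathbf{x}_u(t;x)\|=0$ for all $x\in\Omega$; (5) there exist constants $\varepsilon,C,\nu>0$ with $B_\varepsilon(0)\subset\Omega$ such that $\|\mathbf{x}_u(t;x)\|\le Ce^{-\nu t}\|x\|$ for all $x\in B_\varepsilon(0)$ and $t\ge0$. Domain-aware policy iteration (considered for all $s\in\mathbb{N}_0$, i.e. disregarding the stopping tolerance). Starting from $(u_0,\Omega_{-1})$, for $s=0,1,2,\dots$: (i) let $v_s\in C^1(\Omega_{s-1},\mathbb{R})$ be the solution of $$\langle f(x)+g(x)u_s(x),\nabla v_s(x)\rangle+h(x)+\langle u_s(x),R\,u_s(x)\rangle=0\ \text{ for all }x\in\Omega_{s-1},\qquad v_s(0)=0;$$ (ii) set $u_{s+1}(x):=-\tfrac12R^{-1}g(x)^\top\nabla v_s(x)$; (iii) for $\nu\in(0,1)$ put $$c_s^{(\nu)}:=\nu\cdot\sup\Bigl\{c\in\bigl(0,(1-\nu)^{-1}\bigr]\ \Big|\ \operatorname{cl}\bigl(\{x\in\Omega_{s-1}\mid v_s(x)<c\}\bigr)\subset\Omega_{s-1}\Bigr\},$$ $$\Omega_s^{(\nu)}:=\{x\in\Omega_{s-1}\mid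 v_s(x)<c_s^{(\nu)}\},\qquad \Omega_s:=\bigcup_{\nu\in(0,1)}\Omega_s^{(\nu)}.$$ The controller $u_{s+1}$ is then used on $\Omega_s\subset\Omega_{s-1}$ (restriction). *)

theory Defs
  imports "HOL-Analysis.Analysis"
begin

text \<open>To be used on open sets only: derivatives are taken at \<open>x\<close>, not within \<open>S\<close>.\<close>

primrec Ck_on :: "nat \<Rightarrow> ('a::real_normed_vector \<Rightarrow> 'b::real_normed_vector) \<Rightarrow> 'a set \<Rightarrow> bool"
  where
    "Ck_on 0 F S \<longleftrightarrow> continuous_on S F"
  | "Ck_on (Suc k) F S \<longleftrightarrow>
       (\<forall>x\<in>S. F differentiable (at x)) \<and>
       (\<forall>d. Ck_on k (\<lambda>x. frechet_derivative F (at x) d) S)"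

definition smooth_on :: "('a::real_normed_vector \<Rightarrow> 'b::real_normed_vector) \<Rightarrow> 'a set \<Rightarrow> bool"
  where "smooth_on F S \<longleftrightarrow> (\<forall>k. Ck_on k F S)"

definition grad :: "(real^'n \<Rightarrow> real) \<Rightarrow> real^'n \<Rightarrow> real^'n"
  where "grad v x = (THE d. GDERIV v x :> d)"

definition is_domain :: "(real^'n) set \<Rightarrow> bool"
  where "is_domain \<Omega> \<longleftrightarrow> \<Omega> \<noteq> {} \<and> open \<Omega> \<and> connected \<Omega>"

definition sym_pos_def :: "real^'m^'m \<Rightarrow> bool"
  where "sym_pos_def R \<longleftrightarrow> transpose R = R \<and> (\<forall>y. y \<noteq> 0 \<longrightarrow> 0 < y \<bullet> (R *v y))"

definition data_assumption ::
  "(real^'n \<Rightarrow> real^'n) \<Rightarrow> (real^'n \<Rightarrow> real^'m^'n) \<Rightarrow> (real^'n \<Rightarrow> real) \<Rightarrow> real^'m^'m \<Rightarrow> bool"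
  where "data_assumption f g h R \<longleftrightarrow>
    smooth_on f UNIV \<and> smooth_on g UNIV \<and> smooth_on h UNIV \<and> sym_pos_def R \<and>
    f 0 = 0 \<and> h 0 = 0 \<and> (\<forall>x. x \<noteq> 0 \<longrightarrow> 0 < h x)"

definition solves_closed_loop ::
  "(real^'n \<Rightarrow> real^'n) \<Rightarrow> (real^'n \<Rightarrow> real^'m^'n) \<Rightarrow> (real^'n \<Rightarrow> real^'m) \<Rightarrow> (real^'n) set
    \<Rightarrow> real set \<Rightarrow> real^'n \<Rightarrow> (real \<Rightarrow> real^'n) \<Rightarrow> bool"
  where "solves_closed_loop f g u \<Omega> J x \<phi> \<longleftrightarrow>
    \<phi> 0 = x \<and>
    (\<forall>t\<in>J. \<phi> t \<in> \<Omega> \<and>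
      (\<phi> has_vector_derivative (f (\<phi> t) + g (\<phi> t) *v u (\<phi> t))) (at t within J))"

text \<open>
  \<open>X x t\<close> is the state at time \<open>t\<close> started from \<open>x\<close>. A controller is only given on
  \<open>\<Omega>\<close>, so a solution is by definition a curve in \<open>\<Omega>\<close>; that the trajectory from \<open>x\<close>
  stays in \<open>\<Omega>\<close> for all nonnegative times means that it exists as a solution on
  \<open>{0..}\<close>. Since a merely continuous controller does not force uniqueness, the second
  conjunct is what makes \<open>X x\<close> \<^emph>\<open>the\<close> solution.
\<close>

definition is_closed_loop_flow ::
  "(real^'n \<Rightarrow> real^'n) \<Rightarrow> (real^'n \<Rightarrow> real^'m^'n) \<Rightarrow> (real^'n \<Rightarrow> real^'m) \<Rightarrow> (real^'n) set
    \<Rightarrow> (real^'n \<Rightarrow> real \<Rightarrow> real^'n) \<Rightarrow> bool"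
  where "is_closed_loop_flow f g u \<Omega> X \<longleftrightarrow>
    (\<forall>x\<in>\<Omega>. solves_closed_loop f g u \<Omega> {0..} x (X x) \<and>
      (\<forall>T>0. \<forall>\<phi>. solves_closed_loop f g u \<Omega> {0..<T} x \<phi> \<longrightarrow> (\<forall>t\<in>{0..<T}. \<phi> t = X x t)))"

definition admissible ::
  "(real^'n \<Rightarrow> real^'n) \<Rightarrow> (real^'n \<Rightarrow> real^'m^'n) \<Rightarrow> (real^'n \<Rightarrow> real^'m) \<Rightarrow> (real^'n) set \<Rightarrow> bool"
  where "admissible f g u \<Omega> \<longleftrightarrow>
    is_domain \<Omega> \<and> continuous_on \<Omega> u \<and>
    0 \<in> \<Omega> \<and> u 0 = 0 \<and>
    (\<exists>X. is_closed_loop_flow f g u \<Omega> X \<and>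
      (\<forall>x\<in>\<Omega>. ((\<lambda>t. norm (X x t)) \<longlongrightarrow> 0) at_top) \<and>
      (\<exists>\<epsilon>>0. \<exists>C>0. \<exists>\<nu>>0. ball 0 \<epsilon> \<subseteq> \<Omega> \<and>
        (\<forall>x\<in>ball 0 \<epsilon>. \<forall>t\<ge>0. norm (X x t) \<le> C * exp (- \<nu> * t) * norm x)))"

text \<open>
  Controllers and value functions are total functions whose values outside the current
  domain are irrelevant; uniqueness of the solution \<open>v\<close> below is uniqueness on \<open>\<Omega>\<close>.
\<close>

definition solves_policy_equation ::
  "(real^'n \<Rightarrow> real^'n) \<Rightarrow> (real^'n \<Rightarrow> real^'m^'n) \<Rightarrow> (real^'n \<Rightarrow> real) \<Rightarrow> real^'m^'m
    \<Rightarrow> (real^'n \<Rightarrow> real^'m) \<Rightarrow> (real^'n) set \<Rightarrow> (real^'n \<Rightarrow> real) \<Rightarrow> bool"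
  where "solves_policy_equation f g h R u \<Omega> v \<longleftrightarrow>
    Ck_on 1 v \<Omega> \<and>
    (\<forall>x\<in>\<Omega>. (f x + g x *v u x) \<bullet> grad v x + h x + u x \<bullet> (R *v u x) = 0) \<and>
    v 0 = 0"

definition admissible_levels :: "(real^'n) set \<Rightarrow> (real^'n \<Rightarrow> real) \<Rightarrow> real \<Rightarrow> real set"
  where "admissible_levels \<Omega> v \<nu> =
    {c. 0 < c \<and> c \<le> inverse (1 - \<nu>) \<and> closure {x\<in>\<Omega>. v x < c} \<subseteq> \<Omega>}"

definition critical_level :: "(real^'n) set \<Rightarrow> (real^'n \<Rightarrow> real) \<Rightarrow> real \<Rightarrow> real"
  where "critical_level \<Omega> v \<nu> = \<nu> * Sup (admissible_levels \<Omega> v \<nu>)"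

definition next_domain :: "(real^'n) set \<Rightarrow> (real^'n \<Rightarrow> real) \<Rightarrow> (real^'n) set"
  where "next_domain \<Omega> v = (\<Union>\<nu>\<in>{0<..<1}. {x\<in>\<Omega>. v x < critical_level \<Omega> v \<nu>})"

definition policy_step ::
  "(real^'n \<Rightarrow> real^'n) \<Rightarrow> (real^'n \<Rightarrow> real^'m^'n) \<Rightarrow> (real^'n \<Rightarrow> real) \<Rightarrow> real^'m^'m
    \<Rightarrow> (real^'n \<Rightarrow> real^'m) \<Rightarrow> (real^'n) set \<Rightarrow> (real^'n \<Rightarrow> real)
    \<Rightarrow> (real^'n \<Rightarrow> real^'m) \<Rightarrow> (real^'n) set \<Rightarrow> bool"
  where "policy_step f g h R u \<Omega> v u' \<Omega>' \<longleftrightarrow>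
    solves_policy_equation f g h R u \<Omega> v \<and>
    (\<forall>x\<in>\<Omega>. u' x = - (1 / 2) *\<^sub>R (matrix_inv R *v (transpose (g x) *v grad v x))) \<and>
    \<Omega>' = next_domain \<Omega> v"

text \<open>
  Domains are indexed with a shift: \<open>D s\<close> is $\Omega_{s-1}$, the domain of \<open>u s\<close> and
  \<open>v s\<close>, so \<open>\<Omega>\<close> is the initial $\Omega_{-1}$. The predicate says that the first \<open>n\<close>
  steps follow the recursion; it constrains \<open>u\<close> and \<open>D\<close> up to index \<open>n\<close> and \<open>v\<close> below \<open>n\<close>.
\<close>

definition policy_iteration ::
  "(real^'n \<Rightarrow> real^'n) \<Rightarrow> (real^'n \<Rightarrow> real^'m^'n) \<Rightarrow> (real^'n \<Rightarrow> real) \<Rightarrow> real^'m^'m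
    \<Rightarrow> (real^'n \<Rightarrow> real^'m) \<Rightarrow> (real^'n) set \<Rightarrow> nat
    \<Rightarrow> (nat \<Rightarrow> real^'n \<Rightarrow> real^'m) \<Rightarrow> (nat \<Rightarrow> (real^'n) set) \<Rightarrow> (nat \<Rightarrow> real^'n \<Rightarrow> real) \<Rightarrow> bool"
  where "policy_iteration f g h R u\<^sub>0 \<Omega> n u D v \<longleftrightarrow>
    u 0 = u\<^sub>0 \<and> D 0 = \<Omega> \<and>
    (\<forall>s<n. policy_step f g h R (u s) (D s) (v s) (u (Suc s)) (D (Suc s)))"

text \<open>
  Every object named in a step exists and is determined by \<open>(u, \<Omega>)\<close>. The conditions on
  \<open>admissible_levels\<close> guarantee that the \<open>Sup\<close> in \<open>critical_level\<close> is a genuine supremum.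
\<close>

definition policy_step_well_defined ::
  "(real^'n \<Rightarrow> real^'n) \<Rightarrow> (real^'n \<Rightarrow> real^'m^'n) \<Rightarrow> (real^'n \<Rightarrow> real) \<Rightarrow> real^'m^'m
    \<Rightarrow> (real^'n \<Rightarrow> real^'m) \<Rightarrow> (real^'n) set \<Rightarrow> bool"
  where "policy_step_well_defined f g h R u \<Omega> \<longleftrightarrow>
    invertible R \<and>
    (\<exists>v. solves_policy_equation f g h R u \<Omega> v) \<and>
    (\<forall>v w. solves_policy_equation f g h R u \<Omega> v \<longrightarrow> solves_policy_equation f g h R u \<Omega> w
        \<longrightarrow> (\<forall>x\<in>\<Omega>. v x = w x)) \<and>
    (\<forall>v. solves_policy_equation f g h R u \<Omega> v \<longrightarrow>
        (\<forall>\<nu>\<in>{0<..<1}. admissible_levels \<Omega> v \<nu> \<noteq> {} \<and> bdd_above (admissible_levels \<Omega> v \<nu>)))"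

end

theory Submission
  imports Defs
begin

text \<open>
  Write \<open>F = f + g u\<close> for the closed loop. Exponential stability makes the linearization of \<open>F\<close> at
  \<open>0\<close> stable, so near \<open>0\<close> the flow of \<open>F\<close> contracts in a quadratic norm \<open>B\<close>; hence trajectories
  from neighbouring points converge to each other exponentially and locally uniformly.

  The value function is the integral of the running cost along trajectories. Its smoothness is
  obtained without differentiating the flow: it solves a linear transport equation along \<open>F\<close>, and the
  candidate for its derivative solves another one. Following the linearization error from time
  infinity back to time 0 shows that the candidate is the derivative, and this can be iterated.

  For the improved controller \<open>u'\<close> and the value \<open>v\<close>, completing the square gives
  \<open>dv (f + g u') = - h - |u'|\<^sup>2 - |u - u'|\<^sup>2\<close> in the norm of \<open>R\<close>. Thus \<open>v\<close> is a Lyapunov function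
  whose sublevel sets with closure in the domain trap trajectories. As \<open>h\<close> may vanish to high order
  at \<open>0\<close>, exponential stability comes from \<open>B + \<kappa> v\<close>: the first term decays under \<open>u\<close>, and the
  \<open>|u - u'|\<^sup>2\<close> in the decay of \<open>v\<close> pays for replacing \<open>u\<close> by \<open>u'\<close>. The new domain is connected because
  the trajectories of \<open>u\<close> join each of its points to \<open>0\<close>.
\<close>

section \<open>Differentiability classes of order $k$\<close>

text \<open>The cost accumulates over infinite time, so every derivative of the value function needs
  estimates uniform in time, and differentiating the flow repeatedly would produce ever longer sums
  of mixed terms. In transport form there is one kind of object only: if
  \<open>dw F = a w - L\<close>, then along trajectories \<open>D = dw\<close> satisfies
  \<open>D' = (a D - D DF) - (DL - (Da) w)\<close>. The inverse propagator of the new coefficient is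
  the old one composed with the propagator of \<open>DF\<close>, which decays exponentially. A
  bounded old factor is therefore enough, and the new integrals converge for every continuous
  source. In this construction the vanishing of the cost at \<open>0\<close> matters in the first
  step alone, where the coefficient is \<open>0\<close>.

  Boundedness of the initial domain gives compact closures of sublevel sets. This excludes escape in
  finite time, and it gives \<open>h\<close> a positive minimum along a trajectory on which the
  value stays away from \<open>0\<close>.\<close>

lemma Ck_on_subset:
  assumes "Ck_on k F S" "T \<subseteq> S"
  shows "Ck_on k F T"
  using assms by (induction k arbitrary: F) (auto intro: continuous_on_subset)

lemma frechet_derivative_cong_open:
  assumes "open S" "x \<in> S" "\<And>y. y \<in> S \<Longrightarrow> F y = G y"
  shows "frechet_derivative F (at x) = frechet_derivative G (at x)"
    and "F differentiable (at x) \<longleftrightarrow> G differentiable (at x)"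
proof -
  have "(F has_derivative D) (at x) \<longleftrightarrow> (G has_derivative D) (at x)" for D
    using has_derivative_transform_within_open[OF _ assms(1,2), of F D UNIV G]
      has_derivative_transform_within_open[OF _ assms(1,2), of G D UNIV F] assms(3)
    by auto
  then show "frechet_derivative F (at x) = frechet_derivative G (at x)"
    "F differentiable (at x) \<longleftrightarrow> G differentiable (at x)"
    by (auto simp: frechet_derivative_def differentiable_def)
qed

lemma Ck_on_cong:
  assumes "open S" "\<And>x. x \<in> S \<Longrightarrow> F x = G x" "Ck_on k F S"
  shows "Ck_on k G S"
  using assms(2,3)
proof (induction k arbitrary: F G)
  case 0
  then show ?case by (auto intro: continuous_on_eq)
next
  case (Suc k)
  note eq = frechet_derivative_cong_open[OF assms(1) _ Suc.prems(1)]
  have "Ck_on k (\<lambda>x. frechet_derivative G (at x) d) S" for d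
    by (rule Suc.IH[of "\<lambda>x. frechet_derivative F (at x) d"]) (use Suc.prems(2) eq(1) in auto)
  then show ?case
    using Suc.prems(2) eq(2) by auto
qed

lemma Ck_on_SucD: "Ck_on (Suc k) F S \<Longrightarrow> Ck_on k F S"
proof (induction k arbitrary: F)
  case 0
  then show ?case
    by (auto intro!: differentiable_imp_continuous_on differentiable_at_imp_differentiable_on)
next
  case (Suc k)
  then show ?case unfolding Ck_on.simps(2)[of "Suc k"] Ck_on.simps(2)[of k F] by blast
qed

lemma Ck_on_imp_continuous_on: "Ck_on k F S \<Longrightarrow> continuous_on S F"
  by (induction k) (auto dest: Ck_on_SucD simp del: Ck_on.simps(2))

lemma Ck_on_le: "Ck_on k F S \<Longrightarrow> j \<le> k \<Longrightarrow> Ck_on j F S"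
  by (induction k) (auto dest: Ck_on_SucD simp del: Ck_on.simps(2) simp: le_Suc_eq)

lemma frechet_derivative_eqI:
  "(F has_derivative D) (at x) \<Longrightarrow> frechet_derivative F (at x) = D"
  using frechet_derivative_at by metis

lemma Ck_on_const: "Ck_on k (\<lambda>x. c) S"
proof (induction k arbitrary: c)
  case (Suc k)
  have "frechet_derivative (\<lambda>x. c) (at x) = (\<lambda>d. 0)" for x :: 'a
    by (rule frechet_derivative_eqI) simp
  with Suc show ?case by simp
qed simp

lemma Ck_on_bounded_linear:
  assumes "bounded_linear T" "open S" "Ck_on k F S"
  shows "Ck_on k (\<lambda>x. T (F x)) S"
  using assms(3)
proof (induction k arbitrary: F)
  case 0
  then show ?case
    by (auto intro: bounded_linear.continuous_on[OF assms(1)])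
next
  case (Suc k)
  have D: "((\<lambda>x. T (F x)) has_derivative (\<lambda>d. T (frechet_derivative F (at x) d))) (at x)"
    if "x \<in> S" for x
    using Suc.prems that
    by (intro bounded_linear.has_derivative[OF assms(1)]) (auto simp: frechet_derivative_works)
  have "Ck_on k (\<lambda>x. frechet_derivative (\<lambda>x. T (F x)) (at x) d) S" for d
    by (rule Ck_on_cong[OF assms(2) _ Suc.IH[of "\<lambda>x. frechet_derivative F (at x) d"]])
      (use Suc.prems frechet_derivative_eqI[OF D] in auto)
  then show ?case
    using D by (auto simp: differentiable_def)
qed

lemma Ck_on_add:
  assumes "open S" "Ck_on k F S" "Ck_on k G S"
  shows "Ck_on k (\<lambda>x. F x + G x) S"
  using assms(2,3)
proof (induction k arbitrary: F G)
  case 0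
  then show ?case by (auto intro: continuous_intros)
next
  case (Suc k)
  have D: "((\<lambda>x. F x + G x) has_derivative
      (\<lambda>d. frechet_derivative F (at x) d + frechet_derivative G (at x) d)) (at x)"
    if "x \<in> S" for x
    using Suc.prems that by (intro has_derivative_add) (auto simp: frechet_derivative_works)
  have "Ck_on k (\<lambda>x. frechet_derivative (\<lambda>x. F x + G x) (at x) d) S" for d
    by (rule Ck_on_cong[OF assms(1) _ Suc.IH[of "\<lambda>x. frechet_derivative F (at x) d"
            "\<lambda>x. frechet_derivative G (at x) d"]])
      (use Suc.prems frechet_derivative_eqI[OF D] in auto)
  then show ?case
    using D by (auto simp: differentiable_def)
qed

lemma Ck_on_sum:
  assumes "open S" "\<And>i. i \<in> I \<Longrightarrow> Ck_on k (F i) S"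
  shows "Ck_on k (\<lambda>x. \<Sum>i\<in>I. F i x) S"
  using assms(2)
proof (induction I rule: infinite_finite_induct)
  case (insert i I)
  then show ?case using Ck_on_add[OF assms(1), of k "F i" "\<lambda>x. \<Sum>i\<in>I. F i x"] by simp
qed (simp_all add: Ck_on_const)

lemma Ck_on_uminus: "open S \<Longrightarrow> Ck_on k F S \<Longrightarrow> Ck_on k (\<lambda>x. - F x) S"
  by (rule Ck_on_bounded_linear[OF bounded_linear_minus[OF bounded_linear_ident]])

lemma Ck_on_diff:
  "open S \<Longrightarrow> Ck_on k F S \<Longrightarrow> Ck_on k G S \<Longrightarrow> Ck_on k (\<lambda>x. F x - G x) S"
  using Ck_on_add[of S k F "\<lambda>x. - G x"] Ck_on_uminus[of S k G] by simp

lemma Ck_on_bilinear: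
  assumes "bounded_bilinear pr" "open S" "Ck_on k F S" "Ck_on k G S"
  shows "Ck_on k (\<lambda>x. pr (F x) (G x)) S"
  using assms(3,4)
proof (induction k arbitrary: F G)
  case 0
  then show ?case by (auto intro: bounded_bilinear.continuous_on[OF assms(1)])
next
  case (Suc k)
  have D: "((\<lambda>x. pr (F x) (G x)) has_derivative
      (\<lambda>d. pr (F x) (frechet_derivative G (at x) d) + pr (frechet_derivative F (at x) d) (G x))) (at x)"
    if "x \<in> S" for x
    using Suc.prems that
    by (intro bounded_bilinear.FDERIV[OF assms(1)]) (auto simp: frechet_derivative_works)
  have "Ck_on k (\<lambda>x. pr (F x) (frechet_derivative G (at x) d)
      + pr (frechet_derivative F (at x) d) (G x)) S" for d
    using Suc.prems Ck_on_SucD[OF Suc.prems(1)] Ck_on_SucD[OF Suc.prems(2)]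
    by (intro Ck_on_add[OF assms(2)] Suc.IH) auto
  then have "Ck_on k (\<lambda>x. frechet_derivative (\<lambda>x. pr (F x) (G x)) (at x) d) S" for d
    by (rule Ck_on_cong[OF assms(2), rotated]) (use frechet_derivative_eqI[OF D] in auto)
  then show ?case
    using D by (auto simp: differentiable_def)
qed

section \<open>Derivatives as operator-valued maps\<close>

lemma Ck_on_SucI:
  fixes F' :: "'a::real_normed_vector \<Rightarrow> 'a \<Rightarrow>\<^sub>L 'b::real_normed_vector"
  assumes "open S" "\<And>x. x \<in> S \<Longrightarrow> (F has_derivative blinfun_apply (F' x)) (at x)" "Ck_on k F' S"
  shows "Ck_on (Suc k) F S"
proof -
  have "Ck_on k (\<lambda>x. frechet_derivative F (at x) d) S" for d
    by (rule Ck_on_cong[OF assms(1) _ Ck_on_bounded_linear[OF blinfun.bounded_linear_left assms(1,3)]])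
      (use frechet_derivative_eqI[OF assms(2)] in auto)
  with assms(2) show ?thesis
    by (auto simp: differentiable_def)
qed

text \<open>\<open>Ck_on\<close> speaks of directional derivatives only. Packing the derivative into
  the Banach space of bounded linear maps gives it a norm and lets it be differentiated and composed
  like any other map. The value is meaningful only where the function is differentiable.\<close>

definition bderiv :: "('a::real_normed_vector \<Rightarrow> 'b::real_normed_vector) \<Rightarrow> 'a \<Rightarrow> 'a \<Rightarrow>\<^sub>L 'b"
  where "bderiv F x = Blinfun (frechet_derivative F (at x))"

lemma bderiv_apply:
  "F differentiable (at x) \<Longrightarrow> blinfun_apply (bderiv F x) = frechet_derivative F (at x)"
  unfolding bderiv_def
  by (simp add: bounded_linear_Blinfun_apply frechet_derivative_works has_derivative_bounded_linear)

lemma has_derivative_bderiv: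
  "Ck_on (Suc k) F S \<Longrightarrow> x \<in> S \<Longrightarrow> (F has_derivative blinfun_apply (bderiv F x)) (at x)"
  by (auto simp: bderiv_apply frechet_derivative_works)

text \<open>In finite dimension the derivative is a finite sum of rank-one maps whose coefficients
  are the directional derivatives along a basis. Directional smoothness thereby turns into
  smoothness in operator norm.\<close>

lemma Ck_on_bderiv:
  fixes F :: "'a::euclidean_space \<Rightarrow> 'b::real_normed_vector"
  assumes "open S" "Ck_on (Suc k) F S"
  shows "Ck_on k (bderiv F) S"
proof (rule Ck_on_cong[OF assms(1)])
  \<comment> \<open>\<open>?E b e\<close> is the rank-one map sending \<open>d\<close> to
    \<open>(b \<bullet> d) *\<^sub>R e\<close>; it is linear in \<open>e\<close>.\<close>
  let ?E = "\<lambda>b::'a. \<lambda>e::'b. blinfun_scaleR_left e o\<^sub>L blinfun_inner_right b"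
  have "bounded_linear (?E b)" for b
    by (intro bounded_linear_intros)
  then show "Ck_on k (\<lambda>x. \<Sum>b\<in>Basis. ?E b (frechet_derivative F (at x) b)) S"
    using assms by (intro Ck_on_sum Ck_on_bounded_linear[of "?E _"]) auto
  show "(\<Sum>b\<in>Basis. ?E b (frechet_derivative F (at x) b)) = bderiv F x" if "x \<in> S" for x
  proof (rule blinfun_eqI)
    fix d
    have diff: "F differentiable (at x)" using assms(2) that by auto
    then have "linear (frechet_derivative F (at x))"
      by (simp add: linear_frechet_derivative)
    then have "frechet_derivative F (at x) (\<Sum>b\<in>Basis. (d \<bullet> b) *\<^sub>R b)
        = (\<Sum>b\<in>Basis. (d \<bullet> b) *\<^sub>R frechet_derivative F (at x) b)"
      by (simp add: linear_sum linear_scale)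
    then show "blinfun_apply (\<Sum>b\<in>Basis. ?E b (frechet_derivative F (at x) b)) d = blinfun_apply (bderiv F x) d"
      by (simp add: bderiv_apply[OF diff] blinfun.sum_left inner_commute[of _ d] euclidean_representation)
  qed
qed

lemma smooth_onD: "smooth_on F S \<Longrightarrow> Ck_on k F S"
  by (simp add: smooth_on_def)

lemma smooth_on_bderiv:
  fixes F :: "'a::euclidean_space \<Rightarrow> 'b::real_normed_vector"
  shows "open S \<Longrightarrow> smooth_on F S \<Longrightarrow> smooth_on (bderiv F) S"
  unfolding smooth_on_def using Ck_on_bderiv by blast

section \<open>Differential inequalities and the global Picard--Lindelof theorem\<close>

lemma at_within_atLeast_eq:
  fixes t T :: real
  assumes "0 \<le> t" "t < T"
  shows "at t within {0..} = at t within {0..T}"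
  by (rule at_within_nhd[of t "{..<T}"]) (use assms in auto)

lemma at_within_Icc_interior:
  fixes t T :: real
  assumes "0 < t" "t < T"
  shows "at t within {0..T} = at t"
  by (rule at_within_interior) (use assms in auto)

lemma has_vector_derivative_imp_continuous_on:
  "(\<And>t. t \<in> S \<Longrightarrow> (f has_vector_derivative f' t) (at t within S)) \<Longrightarrow> continuous_on S f"
  by (auto simp: continuous_on_eq_continuous_within intro!: has_vector_derivative_continuous)

lemma has_real_derivative_inner_self:
  fixes q :: "real \<Rightarrow> 'b::real_inner"
  assumes "(q has_vector_derivative q') (at t within S)"
  shows "((\<lambda>t. q t \<bullet> q t) has_real_derivative 2 * (q' \<bullet> q t)) (at t within S)"
  using bounded_bilinear.has_vector_derivative[OF bounded_bilinear_inner assms assms]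
  by (simp add: has_real_derivative_iff_has_vector_derivative inner_commute)

lemma exp_decay_tendsto: "0 < (\<mu>::real) \<Longrightarrow> ((\<lambda>t. c * exp (- \<mu> * t)) \<longlongrightarrow> 0) at_top"
  by (intro tendsto_mult_right_zero filterlim_compose[OF exp_at_bot]
      filterlim_tendsto_neg_mult_at_bot[OF tendsto_const _ filterlim_ident]) auto

lemma exp_decay_small:
  fixes \<mu> e :: real
  assumes "0 < \<mu>" "0 < e"
  obtains T where "0 \<le> T" "\<And>t. T \<le> t \<Longrightarrow> c * exp (- \<mu> * t) < e"
proof -
  obtain T where "\<And>t. T \<le> t \<Longrightarrow> c * exp (- \<mu> * t) < e"
    using order_tendstoD(2)[OF exp_decay_tendsto[OF assms(1)] assms(2)] by (auto simp: eventually_at_top_linorder)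
  then show ?thesis using that[of "max 0 T"] by simp
qed

text \<open>The integrating factor \<open>exp (- c * t)\<close> turns the inequality into
  monotonicity. The inequality is used at interior times, where one-sided and two-sided derivatives
  agree; \<open>c\<close> may have either sign.\<close>

lemma exp_comparison:
  fixes s :: "real \<Rightarrow> real"
  assumes T: "0 \<le> T"
    and s: "\<And>t. 0 \<le> t \<Longrightarrow> t \<le> T \<Longrightarrow> (s has_real_derivative s' t) (at t within {0..T})"
    and le: "\<And>t. 0 < t \<Longrightarrow> t < T \<Longrightarrow> s' t \<le> c * s t"
  shows "s T \<le> s 0 * exp (c * T)"
proof (cases "T = 0")
  case False
  define e where "e = (\<lambda>t. s t * exp (- c * t))"
  have e: "(e has_real_derivative (s' t - c * s t) * exp (- c * t)) (at t within {0..T})"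
    if "0 \<le> t" "t \<le> T" for t
    unfolding e_def using s[OF that]
    by (auto intro!: derivative_eq_intros simp: algebra_simps)
  have "e T \<le> e 0"
  proof (rule DERIV_nonpos_imp_decreasing_open[of 0 T e])
    fix t assume that: "0 < t" "t < T"
    show "\<exists>y. (e has_real_derivative y) (at t) \<and> y \<le> 0"
      using e[of t] le[of t] that
      by (auto simp: at_within_Icc_interior mult_nonpos_nonneg intro!: exI[of _ "(s' t - c * s t) * exp (- c * t)"])
  next
    show "continuous_on {0..T} e"
      by (rule DERIV_continuous_on) (use e in auto)
  qed (use T in auto)
  then show ?thesis
    by (simp add: e_def exp_minus field_simps)
qed simp

text \<open>Argument by the first exit time: the times spent outside an open set form a compact set,
  whose least element would be positive and is excluded by \<open>step\<close>.\<close>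

lemma stays_in_open:
  fixes \<phi> :: "real \<Rightarrow> 'b::topological_space"
  assumes cont: "continuous_on {0..T} \<phi>" and S: "open S" and "\<phi> 0 \<in> S"
    and step: "\<And>t. 0 < t \<Longrightarrow> t \<le> T \<Longrightarrow> (\<And>\<tau>. 0 \<le> \<tau> \<Longrightarrow> \<tau> < t \<Longrightarrow> \<phi> \<tau> \<in> S) \<Longrightarrow> \<phi> t \<in> S"
    and t: "0 \<le> t" "t \<le> T"
  shows "\<phi> t \<in> S"
proof (rule ccontr)
  assume "\<phi> t \<notin> S"
  define N where "N = {0..T} \<inter> \<phi> -` (- S)"
  have "closed N"
    unfolding N_def using S by (intro continuous_closed_preimage cont) auto
  then have "compact N"
    using bounded_subset[of "{0..T}" N] by (auto simp: compact_eq_bounded_closed N_def)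
  moreover have "N \<noteq> {}" using \<open>\<phi> t \<notin> S\<close> t by (auto simp: N_def)
  ultimately obtain m where m: "m \<in> N" "\<And>n. n \<in> N \<Longrightarrow> m \<le> n"
    using compact_attains_inf by metis
  have "m \<noteq> 0" using m(1) assms(3) by (auto simp: N_def)
  moreover have "\<phi> \<tau> \<in> S" if "0 \<le> \<tau>" "\<tau> < m" for \<tau>
    using m(2)[of \<tau>] that m(1) by (force simp: N_def)
  ultimately show False
    using step[of m] m(1) by (auto simp: N_def)
qed

text \<open>A bootstrap: the differential inequality is available only below the level
  \<open>r\<close>, and the exponential bound that it yields stays below \<open>r\<close>.
  Comparison up to a first time of reaching \<open>r\<close> shows that there is no such
  time.\<close>

lemma exp_barrier:
  fixes s :: "real \<Rightarrow> real"
  assumes s: "\<And>t. 0 \<le> t \<Longrightarrow> t \<le> T \<Longrightarrow> (s has_real_derivative s' t) (at t within {0..T})"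
    and le: "\<And>t. 0 \<le> t \<Longrightarrow> t \<le> T \<Longrightarrow> s t < r \<Longrightarrow> s' t \<le> c * s t"
    and r: "\<And>t. 0 \<le> t \<Longrightarrow> t \<le> T \<Longrightarrow> s 0 * exp (c * t) < r"
    and t: "0 \<le> t" "t \<le> T"
  shows "s t < r" "s t \<le> s 0 * exp (c * t)"
proof -
  have *: "s t \<le> s 0 * exp (c * t)" if t: "0 \<le> t" "t \<le> T" and "\<And>\<tau>. 0 \<le> \<tau> \<Longrightarrow> \<tau> < t \<Longrightarrow> s \<tau> < r" for t
    using that by (intro exp_comparison[of t s s'] DERIV_subset[OF s] le) auto
  have "continuous_on {0..T} s"
    by (rule DERIV_continuous_on) (use s in auto)
  then have **: "s t \<in> {..<r}" if "0 \<le> t" "t \<le> T" for t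
  proof (rule stays_in_open)
    show "s 0 \<in> {..<r}" using r[of 0] t by simp
    show "s t \<in> {..<r}" if "0 < t" "t \<le> T" "\<And>\<tau>. 0 \<le> \<tau> \<Longrightarrow> \<tau> < t \<Longrightarrow> s \<tau> \<in> {..<r}" for t
      using *[of t] r[of t] that by force
  qed (use that in auto)
  show "s t < r" using **[OF t] by simp
  show "s t \<le> s 0 * exp (c * t)"
    by (rule *) (use ** t in force)+
qed

lemma vector_derivative_norm_le:
  fixes f :: "real \<Rightarrow> 'b::real_normed_vector"
  assumes f: "\<And>t. 0 \<le> t \<Longrightarrow> t \<le> T \<Longrightarrow> (f has_vector_derivative f' t) (at t within {0..T})"
    and \<phi>: "\<And>t. 0 \<le> t \<Longrightarrow> t \<le> T \<Longrightarrow> (\<phi> has_real_derivative \<phi>' t) (at t within {0..T})"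
    and le: "\<And>t. 0 \<le> t \<Longrightarrow> t \<le> T \<Longrightarrow> norm (f' t) \<le> \<phi>' t"
    and st: "0 \<le> s" "s \<le> t" "t \<le> T"
  shows "norm (f t - f s) \<le> \<phi> t - \<phi> s"
proof (cases "s = t")
  case False
  show ?thesis
  proof (rule differentiable_bound_general)
    have "continuous_on {0..T} f"
      by (rule has_vector_derivative_imp_continuous_on) (use f in auto)
    moreover have "continuous_on {0..T} \<phi>"
      by (rule DERIV_continuous_on) (use \<phi> in auto)
    ultimately show "continuous_on {s..t} f" "continuous_on {s..t} \<phi>"
      using st by (auto elim: continuous_on_subset)
    show "(f has_vector_derivative f' x) (at x)" "(\<phi> has_vector_derivative \<phi>' x) (at x)"
      "norm (f' x) \<le> \<phi>' x" if "s < x" "x < t" for x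
      using f[of x] \<phi>[of x] le[of x] that st
      by (auto simp: at_within_Icc_interior has_real_derivative_iff_has_vector_derivative)
  qed (use st False in auto)
qed simp

text \<open>For negative \<open>\<kappa>\<close> the bound controls the tail of the curve and yields
  limits at infinity; for positive \<open>\<kappa>\<close> it is a growth bound.\<close>

lemma exp_derivative_norm_le:
  fixes f :: "real \<Rightarrow> 'b::real_normed_vector"
  assumes "\<kappa> \<noteq> 0"
    and f: "\<And>t. 0 \<le> t \<Longrightarrow> (f has_vector_derivative f' t) (at t within {0..})"
    and le: "\<And>t. 0 \<le> t \<Longrightarrow> norm (f' t) \<le> c * exp (\<kappa> * t)"
    and st: "0 \<le> s" "s \<le> t"
  shows "norm (f t - f s) \<le> c / \<kappa> * exp (\<kappa> * t) - c / \<kappa> * exp (\<kappa> * s)"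
proof (rule vector_derivative_norm_le[of t f f'])
  show "((\<lambda>t. c / \<kappa> * exp (\<kappa> * t)) has_real_derivative c * exp (\<kappa> * \<tau>)) (at \<tau> within {0..t})" for \<tau>
    by (rule derivative_eq_intros refl)+ (use assms(1) in auto)
  show "(f has_vector_derivative f' \<tau>) (at \<tau> within {0..t})" if "0 \<le> \<tau>" for \<tau>
    using f[OF that] by (rule has_vector_derivative_within_subset) auto
qed (use st le in auto)

lemma integral_has_vector_derivative_atLeast:
  fixes g :: "real \<Rightarrow> 'b::banach"
  assumes "continuous_on {0..} g" "0 \<le> t"
  shows "((\<lambda>t. integral {0..t} g) has_vector_derivative g t) (at t within {0..})"
proof -
  have "((\<lambda>t. integral {0..t} g) has_vector_derivative g t) (at t within {0..t+1})"
    by (rule integral_has_vector_derivative) (use assms in \<open>auto elim: continuous_on_subset\<close>)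
  then show ?thesis
    using assms(2) by (subst at_within_atLeast_eq[of t "t+1"]) auto
qed

lemma has_vector_derivative_bound_zero:
  fixes q :: "real \<Rightarrow> 'b::real_normed_vector"
  assumes q: "\<And>t. 0 \<le> t \<Longrightarrow> (q has_vector_derivative q' t) (at t within {0..})"
    and le: "\<And>t. 0 \<le> t \<Longrightarrow> norm (q' t) \<le> M * norm (q t)"
    and 0: "q 0 = 0" and T: "0 \<le> T"
  shows "q T = 0"
proof -
  have qT: "(q has_vector_derivative q' t) (at t within {0..T})" if "0 \<le> t" for t
    using q[OF that] by (rule has_vector_derivative_within_subset) auto
  have "continuous_on {0..T} q"
    using qT by (auto simp: continuous_on_eq_continuous_within intro!: has_vector_derivative_continuous)
  then have "bounded (q ` {0..T})"
    by (intro compact_imp_bounded compact_continuous_image) auto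
  then obtain C where C: "\<And>t. 0 \<le> t \<Longrightarrow> t \<le> T \<Longrightarrow> norm (q t) \<le> C"
    unfolding bounded_iff by (metis atLeastAtMost_iff image_eqI)
  define m where "m = max 0 M"
  have m: "0 \<le> m" "norm (q' t) \<le> m * norm (q t)" if "0 \<le> t" for t
    using le[OF that] mult_right_mono[of M m "norm (q t)"] by (auto simp: m_def)
  \<comment> \<open>The norm need not be differentiable, so Gronwall is replaced by iterating the mean value inequality.\<close>
  have bound: "norm (q t) \<le> C * (m ^ n * t ^ n / fact n)" if "0 \<le> t" "t \<le> T" for n t
    using that
  proof (induction n arbitrary: t)
    case 0
    then show ?case using C by simp
  next
    case (Suc n)
    have "norm (q t - q 0) \<le> C * (m ^ Suc n * t ^ Suc n / fact (Suc n)) - C * (m ^ Suc n * 0 ^ Suc n / fact (Suc n))"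
    proof (rule vector_derivative_norm_le[of t q q' "\<lambda>t. C * (m ^ Suc n * t ^ Suc n / fact (Suc n))"
          "\<lambda>t. C * (m ^ Suc n * t ^ n / fact n)" 0 t])
      fix \<tau> assume \<tau>: "0 \<le> \<tau>" "\<tau> \<le> t"
      show "(q has_vector_derivative q' \<tau>) (at \<tau> within {0..t})"
        using q[OF \<tau>(1)] by (rule has_vector_derivative_within_subset) auto
      have "((\<lambda>t. t ^ Suc n) has_real_derivative (1 + real n) * \<tau> ^ n) (at \<tau> within {0..t})"
        by (rule derivative_eq_intros refl)+ auto
      then have "((\<lambda>t. (C * m ^ Suc n / fact (Suc n)) * t ^ Suc n) has_real_derivative
          (C * m ^ Suc n / fact (Suc n)) * ((1 + real n) * \<tau> ^ n)) (at \<tau> within {0..t})"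
        by (rule DERIV_cmult)
      moreover have "(C * m ^ Suc n / fact (Suc n)) * ((1 + real n) * \<tau> ^ n) = C * (m ^ Suc n * \<tau> ^ n / fact n)"
      proof -
        have "c * (C * m ^ Suc n / (c * fact n) * \<tau> ^ n) = C * (m ^ Suc n * \<tau> ^ n / fact n)" if "c \<noteq> 0" for c
          using that by simp
        from this[of "1 + real n"] show ?thesis by (simp add: fact_Suc mult_ac)
      qed
      ultimately show "((\<lambda>t. C * (m ^ Suc n * t ^ Suc n / fact (Suc n))) has_real_derivative
          C * (m ^ Suc n * \<tau> ^ n / fact n)) (at \<tau> within {0..t})"
        by (simp add: mult.assoc)
      have "norm (q' \<tau>) \<le> m * norm (q \<tau>)" using m \<tau> by blast
      also have "\<dots> \<le> m * (C * (m ^ n * \<tau> ^ n / fact n))"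
        using Suc \<tau> m(1)[OF order_refl] by (intro mult_left_mono Suc.IH) auto
      finally show "norm (q' \<tau>) \<le> C * (m ^ Suc n * \<tau> ^ n / fact n)"
        by (simp add: mult_ac)
    qed (use Suc in auto)
    then show ?case using 0 by simp
  qed
  have "(\<lambda>n. C * (inverse (fact n) * (m * T) ^ n)) \<longlonglongrightarrow> C * 0"
    using summable_LIMSEQ_zero[OF summable_exp] by (intro tendsto_mult tendsto_const) auto
  then have "norm (q T) \<le> 0"
    using bound[of T] T
    by (intro tendsto_lowerbound[of _ 0 sequentially "norm (q T)"])
      (auto simp: power_mult_distrib field_simps intro!: always_eventually)
  then show ?thesis by simp
qed

section \<open>Global solutions and their uniqueness\<close>

lemma picard_lindeloef_global:
  fixes G :: "real \<Rightarrow> 'b::banach \<Rightarrow> 'b"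
  assumes cont: "continuous_on ({0..} \<times> UNIV) (\<lambda>(t, y). G t y)"
    and lip: "\<And>t y z. 0 \<le> t \<Longrightarrow> norm (G t y - G t z) \<le> k * norm (y - z)"
    and bnd: "\<And>t. 0 \<le> t \<Longrightarrow> norm (G t 0) \<le> M"
  shows "\<exists>\<phi>. \<phi> 0 = y0 \<and> (\<forall>t\<ge>0. (\<phi> has_vector_derivative G t (\<phi> t)) (at t within {0..}))"
proof -
  define \<kappa> where "\<kappa> = max k 1"
  have \<kappa>: "\<kappa> > 0" "norm (G t y - G t z) \<le> \<kappa> * norm (y - z)" if "0 \<le> t" for t y z
    using lip[OF that, of y z] mult_right_mono[of k \<kappa> "norm (y - z)"] by (auto simp: \<kappa>_def)
  have \<kappa>0: "\<kappa> > 0" by (simp add: \<kappa>_def)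
  have M: "0 \<le> M" using bnd[of 0] norm_ge_zero order_trans by blast
  \<comment> \<open>The weight \<open>exp (2 * \<kappa> * t)\<close> makes the Picard operator a contraction on all of \<open>{0..}\<close> at once.\<close>
  define g where "g = (\<lambda>(\<psi> :: real \<Rightarrow>\<^sub>C 'b) s. G s (exp (2 * \<kappa> * s) *\<^sub>R \<psi> s))"
  define I where "I = (\<lambda>\<psi> t. integral {0..t} (g \<psi>))"
  \<comment> \<open>Bounded continuous functions live on the whole line, so the operator is frozen
    at its value at \<open>0\<close> for negative times.\<close>
  define N where "N = (\<lambda>\<psi> t. exp (- (2 * \<kappa> * max 0 t)) *\<^sub>R (y0 + I \<psi> (max 0 t)))"
  have g_cont: "continuous_on {0..} (g \<psi>)" for \<psi>
  proof -
    have "continuous_on {0..} (\<lambda>s. (s, exp (2 * \<kappa> * s) *\<^sub>R \<psi> s))"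
      by (intro continuous_intros continuous_on_subset[OF continuous_on_apply_bcontfun]) auto
    from continuous_on_compose2[OF cont this] show ?thesis by (auto simp: g_def)
  qed
  have I_der: "(I \<psi> has_vector_derivative g \<psi> t) (at t within {0..})" if "0 \<le> t" for \<psi> t
    unfolding I_def by (rule integral_has_vector_derivative_atLeast[OF g_cont that])
  have I0: "I \<psi> 0 = 0" for \<psi> by (simp add: I_def)
  have I_cont: "continuous_on {0..} (I \<psi>)" for \<psi>
    using I_der by (auto simp: continuous_on_eq_continuous_within intro!: has_vector_derivative_continuous)
  have I_bnd: "norm (I \<psi> t) \<le> (M + \<kappa> * norm \<psi>) / (2 * \<kappa>) * exp (2 * \<kappa> * t)" if "0 \<le> t" for \<psi> t
  proof -
    have "norm (g \<psi> s) \<le> (M + \<kappa> * norm \<psi>) * exp (2 * \<kappa> * s)" if "0 \<le> s" for s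
    proof -
      have "norm (g \<psi> s) \<le> norm (G s 0) + norm (g \<psi> s - G s 0)"
        by (metis add.commute diff_add_cancel norm_triangle_ineq)
      also have "\<dots> \<le> M + \<kappa> * norm (exp (2 * \<kappa> * s) *\<^sub>R \<psi> s)"
        using bnd[OF that] \<kappa>(2)[OF that, of "exp (2 * \<kappa> * s) *\<^sub>R \<psi> s" 0]
        by (auto simp: g_def)
      also have "\<dots> \<le> M * exp (2 * \<kappa> * s) + \<kappa> * (exp (2 * \<kappa> * s) * norm \<psi>)"
        using \<kappa>0 M that mult_left_mono[of 1 "exp (2 * \<kappa> * s)" M] norm_bounded[of \<psi> s]
        by (intro add_mono mult_left_mono) auto
      finally show ?thesis by (simp add: algebra_simps)
    qed
    then have "norm (I \<psi> t - I \<psi> 0) \<le> (M + \<kappa> * norm \<psi>) / (2 * \<kappa>) * exp (2 * \<kappa> * t)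
        - (M + \<kappa> * norm \<psi>) / (2 * \<kappa>) * exp (2 * \<kappa> * 0)"
      using \<kappa>0 that I_der by (intro exp_derivative_norm_le[where f' = "g \<psi>"]) auto
    also have "\<dots> \<le> (M + \<kappa> * norm \<psi>) / (2 * \<kappa>) * exp (2 * \<kappa> * t)"
      using \<kappa>0 M by simp
    finally show ?thesis by (simp add: I0)
  qed
  have N_bcont: "N \<psi> \<in> bcontfun" for \<psi>
  proof (rule bcontfun_normI)
    show "continuous_on UNIV (N \<psi>)"
      unfolding N_def
      by (intro continuous_intros continuous_on_compose2[OF I_cont]) auto
    fix t
    let ?t = "max 0 t" and ?E = "exp (2 * \<kappa> * max 0 t)"
    have 1: "1 \<le> ?E" using \<kappa>0 by simp
    have "norm (N \<psi> t) \<le> exp (- (2 * \<kappa> * ?t)) * (norm y0 + (M + \<kappa> * norm \<psi>) / (2 * \<kappa>) * ?E)"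
      unfolding N_def norm_scaleR abs_exp_cancel
      using norm_triangle_ineq[of y0 "I \<psi> ?t"] I_bnd[of ?t \<psi>] by (intro mult_left_mono) auto
    also have "\<dots> = norm y0 / ?E + (M + \<kappa> * norm \<psi>) / (2 * \<kappa>)"
      by (simp add: exp_minus field_simps)
    also have "\<dots> \<le> norm y0 + (M + \<kappa> * norm \<psi>) / (2 * \<kappa>)"
      using 1 mult_left_mono[OF 1, of "norm y0"] by (simp add: field_simps)
    finally show "norm (N \<psi> t) \<le> norm y0 + (M + \<kappa> * norm \<psi>) / (2 * \<kappa>)" .
  qed
  define P where "P = (\<lambda>\<psi>. Bcontfun (N \<psi>))"
  have P: "apply_bcontfun (P \<psi>) = N \<psi>" for \<psi>
    unfolding P_def by (rule Bcontfun_inverse[OF N_bcont])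
  \<comment> \<open>The factor 1/2 comes from integrating \<open>exp (2 * \<kappa> * s)\<close>,
    which gains \<open>1 / (2 * \<kappa>)\<close> against the Lipschitz constant
    \<open>\<kappa>\<close>.\<close>
  have "dist (P \<psi>) (P \<xi>) \<le> 1/2 * dist \<psi> \<xi>" for \<psi> \<xi>
  proof (rule dist_bound)
    fix t
    let ?t = "max 0 t" and ?E = "exp (2 * \<kappa> * max 0 t)"
    have "norm (g \<psi> s - g \<xi> s) \<le> \<kappa> * dist \<psi> \<xi> * exp (2 * \<kappa> * s)" if "0 \<le> s" for s
    proof -
      have "norm (g \<psi> s - g \<xi> s) \<le> \<kappa> * norm (exp (2 * \<kappa> * s) *\<^sub>R \<psi> s - exp (2 * \<kappa> * s) *\<^sub>R \<xi> s)"
        unfolding g_def by (rule \<kappa>(2)[OF that])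
      also have "\<dots> = \<kappa> * (exp (2 * \<kappa> * s) * dist (\<psi> s) (\<xi> s))"
        by (simp add: dist_norm flip: scaleR_diff_right)
      also have "\<dots> \<le> \<kappa> * (exp (2 * \<kappa> * s) * dist \<psi> \<xi>)"
        using \<kappa>0 dist_bounded[of \<psi> s \<xi>] by (intro mult_left_mono) auto
      finally show ?thesis by (simp add: mult_ac)
    qed
    then have "norm ((I \<psi> ?t - I \<xi> ?t) - (I \<psi> 0 - I \<xi> 0)) \<le> \<kappa> * dist \<psi> \<xi> / (2 * \<kappa>) * exp (2 * \<kappa> * ?t)
        - \<kappa> * dist \<psi> \<xi> / (2 * \<kappa>) * exp (2 * \<kappa> * 0)"
      using \<kappa>0 I_der
      by (intro exp_derivative_norm_le[where f' = "\<lambda>s. g \<psi> s - g \<xi> s" and f = "\<lambda>t. I \<psi> t - I \<xi> t"])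
        (auto intro!: has_vector_derivative_diff)
    also have "\<dots> \<le> dist \<psi> \<xi> / 2 * ?E"
      using \<kappa>0 by simp
    finally have *: "norm (I \<psi> ?t - I \<xi> ?t) \<le> dist \<psi> \<xi> / 2 * ?E" by (simp add: I0)
    have "dist (P \<psi> t) (P \<xi> t) = exp (- (2 * \<kappa> * ?t)) * norm (I \<psi> ?t - I \<xi> ?t)"
      by (simp add: P N_def dist_norm flip: scaleR_diff_right)
    also have "\<dots> \<le> exp (- (2 * \<kappa> * ?t)) * (dist \<psi> \<xi> / 2 * ?E)"
      using * by (intro mult_left_mono) auto
    also have "\<dots> = 1/2 * dist \<psi> \<xi>" by (simp add: exp_minus field_simps)
    finally show "dist (P \<psi> t) (P \<xi> t) \<le> 1/2 * dist \<psi> \<xi>" .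
  qed
  then obtain \<psi> where \<psi>: "P \<psi> = \<psi>"
    using banach_fix_type[of "1/2" P] by auto
  have \<psi>_eq: "exp (2 * \<kappa> * t) *\<^sub>R \<psi> t = y0 + I \<psi> t" if "0 \<le> t" for t
  proof -
    have "\<psi> t = N \<psi> t" using P[of \<psi>] \<psi> by simp
    then show ?thesis using that by (simp add: N_def exp_minus)
  qed
  show ?thesis
  proof (intro exI[of _ "\<lambda>t. y0 + I \<psi> t"] conjI allI impI)
    fix t :: real assume "0 \<le> t"
    then show "((\<lambda>t. y0 + I \<psi> t) has_vector_derivative G t (y0 + I \<psi> t)) (at t within {0..})"
      using has_vector_derivative_add[OF has_vector_derivative_const I_der[of t \<psi>]] \<psi>_eq[of t]
      by (simp add: g_def)
  qed (simp add: I0)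
qed

lemma lipschitz_curves_unique:
  fixes \<phi> \<psi> :: "real \<Rightarrow> 'b::real_inner"
  assumes "0 \<le> T" and lip: "L-lipschitz_on K F"
    and \<phi>: "\<And>t. 0 \<le> t \<Longrightarrow> t \<le> T \<Longrightarrow> \<phi> t \<in> K \<and> (\<phi> has_vector_derivative F (\<phi> t)) (at t within {0..T})"
    and \<psi>: "\<And>t. 0 \<le> t \<Longrightarrow> t \<le> T \<Longrightarrow> \<psi> t \<in> K \<and> (\<psi> has_vector_derivative F (\<psi> t)) (at t within {0..T})"
  shows "norm (\<phi> T - \<psi> T) \<le> norm (\<phi> 0 - \<psi> 0) * exp (L * T)"
proof -
  define s where "s = (\<lambda>t. (\<phi> t - \<psi> t) \<bullet> (\<phi> t - \<psi> t))"
  have "s T \<le> s 0 * exp ((2 * L) * T)"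
  proof (rule exp_comparison)
    fix t assume "0 \<le> t" "t \<le> T"
    then show "(s has_real_derivative 2 * ((F (\<phi> t) - F (\<psi> t)) \<bullet> (\<phi> t - \<psi> t))) (at t within {0..T})"
      unfolding s_def
      by (intro has_real_derivative_inner_self has_vector_derivative_diff) (use \<phi> \<psi> in auto)
  next
    fix t assume "0 < t" "t < T"
    then have "norm (F (\<phi> t) - F (\<psi> t)) \<le> L * norm (\<phi> t - \<psi> t)"
      using \<phi>[of t] \<psi>[of t] lipschitz_onD[OF lip] by (auto simp: dist_norm)
    then have "(F (\<phi> t) - F (\<psi> t)) \<bullet> (\<phi> t - \<psi> t) \<le> L * norm (\<phi> t - \<psi> t) * norm (\<phi> t - \<psi> t)"
      by (meson norm_cauchy_schwarz mult_right_mono norm_ge_zero order_trans)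
    then show "2 * ((F (\<phi> t) - F (\<psi> t)) \<bullet> (\<phi> t - \<psi> t)) \<le> 2 * L * s t"
      by (simp add: s_def dot_square_norm power2_eq_square)
  qed (rule assms(1))
  then have "(norm (\<phi> T - \<psi> T))\<^sup>2 \<le> (norm (\<phi> 0 - \<psi> 0) * exp (L * T))\<^sup>2"
    by (simp add: s_def dot_square_norm power_mult_distrib power2_eq_square[of "exp _"] flip: exp_add)
      (simp add: algebra_simps)
  then show ?thesis
    by (rule power2_le_imp_le) auto
qed

section \<open>Linear evolution equations and quadratic Lyapunov forms\<close>

lemma has_vector_derivative_shift:
  fixes \<phi> :: "real \<Rightarrow> 'b::real_normed_vector"
  assumes "\<And>t. 0 \<le> t \<Longrightarrow> (\<phi> has_vector_derivative \<phi>' t) (at t within {0..})" "0 \<le> s" "0 \<le> t"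
  shows "((\<lambda>t. \<phi> (s + t)) has_vector_derivative \<phi>' (s + t)) (at t within {0..})"
proof -
  have "((\<lambda>t. s + t) has_vector_derivative 1) (at t within {0..})"
    by (auto intro!: derivative_eq_intros)
  moreover have "(\<phi> has_vector_derivative \<phi>' (s + t)) (at (s + t) within (\<lambda>t. s + t) ` {0..})"
    using assms(1)[of "s + t"] assms(2,3) by (auto intro: has_vector_derivative_within_subset)
  ultimately show ?thesis
    using vector_diff_chain_within[of "\<lambda>t. s + t" 1 t "{0..}" \<phi> "\<phi>' (s + t)"] by (simp add: o_def)
qed

text \<open>As \<open>K\<close> may be nonconvex, the mean value theorem does not apply directly;
  the constant comes from local Lipschitz continuity and compactness. \<open>local_lipschitz\<close>
  is a notion for time-dependent fields, hence the dummy time.\<close>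

lemma C1_lipschitz_on_compact:
  fixes F :: "'a::euclidean_space \<Rightarrow> 'a"
  assumes "open \<Omega>" "Ck_on 1 F \<Omega>" "compact K" "K \<subseteq> \<Omega>"
  obtains L where "0 \<le> L" "L-lipschitz_on K F"
proof -
  have C1: "Ck_on (Suc 0) F \<Omega>" using assms(2) by simp
  have "continuous_on (UNIV \<times> \<Omega>) (\<lambda>p::real \<times> 'a. bderiv F (snd p))"
    by (rule continuous_on_compose2[OF Ck_on_imp_continuous_on[OF Ck_on_bderiv[OF assms(1) C1]], of _ snd])
      (auto intro: continuous_intros)
  then have "local_lipschitz (UNIV::real set) \<Omega> (\<lambda>_. F)"
    using assms(1) has_derivative_bderiv[OF C1]
    by (intro c1_implies_local_lipschitz[where f' = "\<lambda>p. bderiv F (snd p)"]) auto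
  then have "local_lipschitz {0::real} K (\<lambda>_. F)"
    by (rule local_lipschitz_subset) (use assms in auto)
  then obtain L where "\<And>t. t \<in> {0::real} \<Longrightarrow> L-lipschitz_on K F"
    by (rule local_lipschitz_compact_implies_lipschitz[where f = "\<lambda>_::real. F"]) (use assms(3) in auto)
  then show ?thesis using that lipschitz_on_nonneg by blast
qed

text \<open>Both arcs together form a compact subset of the domain, on which \<open>F\<close> is
  Lipschitz; Gronwall does the rest.\<close>

lemma C1_solution_unique:
  fixes F :: "'a::euclidean_space \<Rightarrow> 'a"
  assumes "open \<Omega>" "Ck_on 1 F \<Omega>" "0 \<le> T"
    and \<phi>: "\<And>t. 0 \<le> t \<Longrightarrow> t \<le> T \<Longrightarrow> \<phi> t \<in> \<Omega> \<and> (\<phi> has_vector_derivative F (\<phi> t)) (at t within {0..T})"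
    and \<psi>: "\<And>t. 0 \<le> t \<Longrightarrow> t \<le> T \<Longrightarrow> \<psi> t \<in> \<Omega> \<and> (\<psi> has_vector_derivative F (\<psi> t)) (at t within {0..T})"
    and "\<phi> 0 = \<psi> 0"
  shows "\<phi> T = \<psi> T"
proof -
  define K where "K = \<phi> ` {0..T} \<union> \<psi> ` {0..T}"
  have "continuous_on {0..T} \<phi>" "continuous_on {0..T} \<psi>"
    using \<phi> \<psi> by (auto intro: has_vector_derivative_imp_continuous_on[where f' = "\<lambda>t. F (\<phi> t)"]
        has_vector_derivative_imp_continuous_on[where f' = "\<lambda>t. F (\<psi> t)"])
  then have "compact K" "K \<subseteq> \<Omega>"
    using \<phi> \<psi> by (auto simp: K_def intro!: compact_Un compact_continuous_image)
  then obtain L where "L-lipschitz_on K F"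
    using C1_lipschitz_on_compact[OF assms(1,2)] by blast
  then have "norm (\<phi> T - \<psi> T) \<le> norm (\<phi> 0 - \<psi> 0) * exp (L * T)"
    by (rule lipschitz_curves_unique[OF assms(3)]) (use \<phi> \<psi> in \<open>auto simp: K_def\<close>)
  then show ?thesis using assms(6) by simp
qed

section \<open>Propagators of nonautonomous linear equations\<close>

text \<open>\<open>\<Psi>\<close> is the propagator of \<open>y' = b y\<close> and
  \<open>\<Phi>\<close> its inverse, which solves the adjoint equation. Carrying both, with both
  products equal to the identity, avoids inverting operators on an infinite-dimensional
  space.\<close>

definition fundamental_pair ::
  "(real \<Rightarrow> 'e::real_normed_vector \<Rightarrow>\<^sub>L 'e) \<Rightarrow> (real \<Rightarrow> 'e \<Rightarrow>\<^sub>L 'e) \<Rightarrow> (real \<Rightarrow> 'e \<Rightarrow>\<^sub>L 'e) \<Rightarrow> bool"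
  where "fundamental_pair b \<Psi> \<Phi> \<longleftrightarrow> \<Psi> 0 = id_blinfun \<and> \<Phi> 0 = id_blinfun \<and>
    (\<forall>t\<ge>0. (\<Psi> has_vector_derivative b t o\<^sub>L \<Psi> t) (at t within {0..}) \<and>
      (\<Phi> has_vector_derivative - (\<Phi> t o\<^sub>L b t)) (at t within {0..}) \<and>
      \<Phi> t o\<^sub>L \<Psi> t = id_blinfun \<and> \<Psi> t o\<^sub>L \<Phi> t = id_blinfun)"

lemma blinfun_compose_assoc: "(A o\<^sub>L B) o\<^sub>L C = A o\<^sub>L (B o\<^sub>L C)"
  by (rule blinfun_eqI) simp

lemma blinfun_compose_id [simp]: "id_blinfun o\<^sub>L A = A" "A o\<^sub>L id_blinfun = A"
  by (auto intro: blinfun_eqI)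

lemmas compose_has_vector_derivative =
  bounded_bilinear.has_vector_derivative[OF bounded_bilinear_blinfun_compose]

lemmas apply_has_vector_derivative =
  bounded_bilinear.has_vector_derivative[OF blinfun.bounded_bilinear_axioms]

lemma has_vector_derivative_zero_const:
  fixes f :: "real \<Rightarrow> 'b::real_normed_vector"
  assumes "\<And>t. 0 \<le> t \<Longrightarrow> (f has_vector_derivative 0) (at t within {0..})" "0 \<le> t"
  shows "f t = f 0"
proof -
  obtain c where "\<And>t. t \<in> {0..} \<Longrightarrow> f t = c"
    using has_vector_derivative_zero_constant[of "{0..}" f] assms(1) by auto
  then show ?thesis using assms(2) by simp
qed

text \<open>Picard iteration in the algebra of operators gives both factors. The product
  \<open>\<Phi> o\<^sub>L \<Psi>\<close> is constant by the product rule. In infinite dimension a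
  left inverse may fail to be a right inverse, so the other product is treated separately: its
  deviation from the identity solves a linear equation with initial value \<open>0\<close>.\<close>

lemma fundamental_pair_exists:
  fixes b :: "real \<Rightarrow> 'e::banach \<Rightarrow>\<^sub>L 'e"
  assumes cont: "continuous_on {0..} b" and bnd: "\<And>t. 0 \<le> t \<Longrightarrow> norm (b t) \<le> M"
  shows "\<exists>\<Psi> \<Phi>. fundamental_pair b \<Psi> \<Phi>"
proof -
  have cont': "continuous_on ({0..} \<times> UNIV) (\<lambda>p::real \<times> ('e \<Rightarrow>\<^sub>L 'e). b (fst p))"
    by (rule continuous_on_compose2[OF cont continuous_on_fst[OF continuous_on_id]]) auto
  have "\<exists>\<Psi>. \<Psi> 0 = id_blinfun \<and> (\<forall>t\<ge>0. (\<Psi> has_vector_derivative b t o\<^sub>L \<Psi> t) (at t within {0..}))"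
  proof (rule picard_lindeloef_global[where M = 0])
    show "continuous_on ({0..} \<times> UNIV) (\<lambda>(t, y :: 'e \<Rightarrow>\<^sub>L 'e). b t o\<^sub>L y)"
      using bounded_bilinear.continuous_on[OF bounded_bilinear_blinfun_compose cont' continuous_on_snd[OF continuous_on_id]]
      by (simp add: split_beta)
    show "norm ((b t o\<^sub>L y) - (b t o\<^sub>L z)) \<le> M * norm (y - z)" if "0 \<le> t" for t and y z :: "'e \<Rightarrow>\<^sub>L 'e"
      using norm_blinfun_compose[of "b t" "y - z"] mult_right_mono[OF bnd[OF that], of "norm (y - z)"]
      by (simp add: bounded_bilinear.diff_right[OF bounded_bilinear_blinfun_compose])
  qed simp
  then obtain \<Psi> where \<Psi>: "\<Psi> 0 = id_blinfun"
    "\<And>t. 0 \<le> t \<Longrightarrow> (\<Psi> has_vector_derivative b t o\<^sub>L \<Psi> t) (at t within {0..})" by blast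
  have "\<exists>\<Phi>. \<Phi> 0 = id_blinfun \<and> (\<forall>t\<ge>0. (\<Phi> has_vector_derivative - (\<Phi> t o\<^sub>L b t)) (at t within {0..}))"
  proof (rule picard_lindeloef_global[where M = 0])
    show "continuous_on ({0..} \<times> UNIV) (\<lambda>(t, y :: 'e \<Rightarrow>\<^sub>L 'e). - (y o\<^sub>L b t))"
      using continuous_on_minus[OF bounded_bilinear.continuous_on[OF bounded_bilinear_blinfun_compose
            continuous_on_snd[OF continuous_on_id] cont']]
      by (simp add: split_beta)
    show "norm (- (y o\<^sub>L b t) - - (z o\<^sub>L b t)) \<le> M * norm (y - z)" if "0 \<le> t" for t and y z :: "'e \<Rightarrow>\<^sub>L 'e"
      using norm_blinfun_compose[of "z - y" "b t"] mult_left_mono[OF bnd[OF that], of "norm (z - y)"]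
      by (simp add: bounded_bilinear.diff_left[OF bounded_bilinear_blinfun_compose] norm_minus_commute mult.commute)
  qed simp
  then obtain \<Phi> where \<Phi>: "\<Phi> 0 = id_blinfun"
    "\<And>t. 0 \<le> t \<Longrightarrow> (\<Phi> has_vector_derivative - (\<Phi> t o\<^sub>L b t)) (at t within {0..})" by blast
  have id: "id_blinfun o\<^sub>L (id_blinfun :: 'e \<Rightarrow>\<^sub>L 'e) = id_blinfun"
    by (rule blinfun_eqI) simp
  have "\<Phi> t o\<^sub>L \<Psi> t = \<Phi> 0 o\<^sub>L \<Psi> 0" if "0 \<le> t" for t
  proof (rule has_vector_derivative_zero_const[OF _ that, where f = "\<lambda>t. \<Phi> t o\<^sub>L \<Psi> t"])
    fix t :: real assume "0 \<le> t"
    have "(\<Phi> t o\<^sub>L (b t o\<^sub>L \<Psi> t)) + (- (\<Phi> t o\<^sub>L b t) o\<^sub>L \<Psi> t) = 0"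
      by (rule blinfun_eqI) (simp add: blinfun.bilinear_simps)
    then show "((\<lambda>t. \<Phi> t o\<^sub>L \<Psi> t) has_vector_derivative 0) (at t within {0..})"
      using compose_has_vector_derivative[OF \<Phi>(2)[OF \<open>0 \<le> t\<close>] \<Psi>(2)[OF \<open>0 \<le> t\<close>]] by simp
  qed
  moreover have "(\<Psi> t o\<^sub>L \<Phi> t) - id_blinfun = 0" if "0 \<le> t" for t
  proof (rule has_vector_derivative_bound_zero[OF _ _ _ that, where q = "\<lambda>t. (\<Psi> t o\<^sub>L \<Phi> t) - id_blinfun"])
    fix t :: real assume t: "0 \<le> t"
    let ?q = "(\<Psi> t o\<^sub>L \<Phi> t) - id_blinfun"
    have eq: "((\<Psi> t o\<^sub>L - (\<Phi> t o\<^sub>L b t)) + ((b t o\<^sub>L \<Psi> t) o\<^sub>L \<Phi> t)) - 0 = (b t o\<^sub>L ?q) - (?q o\<^sub>L b t)"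
      by (rule blinfun_eqI) (simp add: blinfun.bilinear_simps)
    show "((\<lambda>t. (\<Psi> t o\<^sub>L \<Phi> t) - id_blinfun) has_vector_derivative (b t o\<^sub>L ?q) - (?q o\<^sub>L b t)) (at t within {0..})"
      unfolding eq[symmetric]
      by (intro has_vector_derivative_diff has_vector_derivative_const compose_has_vector_derivative \<Psi> \<Phi> t)
    have "norm ((b t o\<^sub>L ?q) - (?q o\<^sub>L b t)) \<le> norm (b t) * norm ?q + norm ?q * norm (b t)"
      using norm_triangle_ineq4 norm_blinfun_compose add_mono order_trans by meson
    also have "\<dots> \<le> (2 * M) * norm ?q"
      using mult_right_mono[OF bnd[OF t], of "norm ?q"] by (simp add: mult.commute)
    finally show "norm ((b t o\<^sub>L ?q) - (?q o\<^sub>L b t)) \<le> (2 * M) * norm ?q" .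
  qed (simp add: \<Psi> \<Phi> id)
  ultimately have "fundamental_pair b \<Psi> \<Phi>"
    unfolding fundamental_pair_def using \<Psi> \<Phi> id by auto
  then show ?thesis by blast
qed

text \<open>The product of \<open>Z\<close> with the propagator is constant. This explicit form of
  uniqueness is what identifies propagators in \<open>Phi_cocycle\<close> and
  \<open>Phi_lift_coeff\<close>.\<close>

lemma fundamental_pair_adjoint_solution:
  assumes fp: "fundamental_pair b \<Psi> \<Phi>"
    and Z: "\<And>t. 0 \<le> t \<Longrightarrow> (Z has_vector_derivative - (Z t o\<^sub>L b t)) (at t within {0..})" and "0 \<le> t"
  shows "Z t = Z 0 o\<^sub>L \<Phi> t"
proof -
  have "Z t o\<^sub>L \<Psi> t = Z 0 o\<^sub>L \<Psi> 0"
  proof (rule has_vector_derivative_zero_const[OF _ assms(3), where f = "\<lambda>t. Z t o\<^sub>L \<Psi> t"])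
    fix t :: real assume "0 \<le> t"
    have "(Z t o\<^sub>L (b t o\<^sub>L \<Psi> t)) + (- (Z t o\<^sub>L b t) o\<^sub>L \<Psi> t) = 0"
      by (rule blinfun_eqI) (simp add: blinfun.bilinear_simps)
    then show "((\<lambda>t. Z t o\<^sub>L \<Psi> t) has_vector_derivative 0) (at t within {0..})"
      using compose_has_vector_derivative[OF Z[OF \<open>0 \<le> t\<close>], of \<Psi> "b t o\<^sub>L \<Psi> t"] fp \<open>0 \<le> t\<close>
      by (simp add: fundamental_pair_def)
  qed
  then have "(Z t o\<^sub>L \<Psi> t) o\<^sub>L \<Phi> t = (Z 0 o\<^sub>L \<Psi> 0) o\<^sub>L \<Phi> t" by simp
  then have "Z t o\<^sub>L (\<Psi> t o\<^sub>L \<Phi> t) = (Z 0 o\<^sub>L \<Psi> 0) o\<^sub>L \<Phi> t"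
    by (simp add: blinfun_compose_assoc)
  then have "Z t o\<^sub>L id_blinfun = (Z 0 o\<^sub>L id_blinfun) o\<^sub>L \<Phi> t"
    using fp assms(3) by (simp add: fundamental_pair_def)
  then show ?thesis by simp
qed

lemma fundamental_pair_solution:
  assumes fp: "fundamental_pair b \<Psi> \<Phi>"
    and z: "\<And>t. 0 \<le> t \<Longrightarrow> (z has_vector_derivative blinfun_apply (b t) (z t)) (at t within {0..})" and "0 \<le> t"
  shows "z t = \<Psi> t (z 0)"
proof -
  have "\<Phi> t (z t) = \<Phi> 0 (z 0)"
  proof (rule has_vector_derivative_zero_const[OF _ assms(3), where f = "\<lambda>t. \<Phi> t (z t)"])
    fix t :: real assume "0 \<le> t"
    then show "((\<lambda>t. \<Phi> t (z t)) has_vector_derivative 0) (at t within {0..})"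
      using apply_has_vector_derivative[OF _ z[of t], of \<Phi> "- (\<Phi> t o\<^sub>L b t)"] fp
      by (simp add: fundamental_pair_def blinfun.bilinear_simps)
  qed
  moreover have "\<Psi> t (\<Phi> t (z t)) = z t"
    using fp assms(3) blinfun_apply_blinfun_compose[of "\<Psi> t" "\<Phi> t" "z t"] by (simp add: fundamental_pair_def)
  ultimately show ?thesis using fp by (simp add: fundamental_pair_def)
qed

lemma fundamental_pair_continuous:
  assumes "fundamental_pair b \<Psi> \<Phi>"
  shows "continuous_on {0..} \<Psi>" "continuous_on {0..} \<Phi>"
  using assms has_vector_derivative_imp_continuous_on[of "{0..}" \<Psi> "\<lambda>t. b t o\<^sub>L \<Psi> t"]
    has_vector_derivative_imp_continuous_on[of "{0..}" \<Phi> "\<lambda>t. - (\<Phi> t o\<^sub>L b t)"]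
  by (auto simp: fundamental_pair_def)

section \<open>A quadratic form that decreases along a contracting linear system\<close>

lemma lyapunov_form_exists:
  fixes A :: "'a::euclidean_space \<Rightarrow>\<^sub>L 'a"
  assumes fp: "fundamental_pair (\<lambda>_. A) Y \<Phi>" and T: "0 \<le> T"
    and half: "\<And>y. norm (Y T y) \<le> 1/2 * norm y"
  shows "\<exists>B \<epsilon> \<mu>. bounded_bilinear B \<and> (\<forall>y z. B y z = (B z y :: real)) \<and> 0 < \<epsilon> \<and> 0 < \<mu> \<and>
    (\<forall>y. \<epsilon> * (norm y)\<^sup>2 \<le> B y y) \<and> (\<forall>y. B (A y) y \<le> - \<mu> * B y y)"
proof -
  \<comment> \<open>Small enough that \<open>\<epsilon> * (A y \<bullet> y)\<close> costs at most
    1/4 of the squared norm; the integral gains 3/8, which leaves the 1/8 found below.\<close>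
  define \<epsilon> where "\<epsilon> = 1 / (4 * (norm A + 1))"
  have \<epsilon>: "0 < \<epsilon>" "\<epsilon> * norm A \<le> 1/4"
    by (simp add: \<epsilon>_def add_nonneg_pos) (simp add: \<epsilon>_def divide_simps add_nonneg_pos)
  \<comment> \<open>The small multiple of the inner product makes the form coercive for free; a finite horizon
    suffices because the propagator contracts over \<open>T\<close>.\<close>
  define B where "B = (\<lambda>y z. \<epsilon> * (y \<bullet> z) + integral {0..T} (\<lambda>t. Y t y \<bullet> Y t z))"
  have Yc: "continuous_on {0..T} (\<lambda>t. Y t y)" for y
    using fundamental_pair_continuous(1)[OF fp]
    by (intro bounded_linear.continuous_on[OF blinfun.bounded_linear_left]) (auto elim: continuous_on_subset)
  have int: "(\<lambda>t. Y t y \<bullet> Y t z) integrable_on {0..T}" for y z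
    by (intro integrable_continuous_real continuous_intros Yc)
  have "bilinear B"
    unfolding bilinear_def B_def
    by (auto intro!: linearI simp: blinfun.bilinear_simps inner_left_distrib inner_right_distrib
        integral_add int algebra_simps)
  then have B: "bounded_bilinear B"
    by (simp add: bilinear_conv_bounded_bilinear)
  then obtain M where M: "\<And>y z. norm (B y z) \<le> norm y * norm z * M" "0 < M"
    using bounded_bilinear.pos_bounded by metis
  have low: "\<epsilon> * (norm y)\<^sup>2 \<le> B y y" for y
    using integral_nonneg[OF int[of y y]] by (simp add: B_def dot_square_norm)
  have "B (A y) y \<le> - (1 / (8 * M)) * B y y" for y
  proof -
    \<comment> \<open>\<open>A\<close> commutes with its own propagator by uniqueness: both sides
      solve the same equation with initial value \<open>A y\<close>.\<close>
    have comm: "A (Y t y) = Y t (A y)" if "0 \<le> t" for t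
    proof -
      have "((\<lambda>t. A (Y t y)) has_vector_derivative A (A (Y t y))) (at t within {0..})" if "0 \<le> t" for t
        using fp that
          bounded_linear.has_vector_derivative[OF blinfun.bounded_linear_right[of A],
            OF bounded_linear.has_vector_derivative[OF blinfun.bounded_linear_left[of y], of Y "A o\<^sub>L Y t"]]
        by (simp add: fundamental_pair_def)
      from fundamental_pair_solution[OF fp this that]
      show ?thesis using fp by (simp add: fundamental_pair_def)
    qed
    have der: "((\<lambda>t. Y t y \<bullet> Y t y) has_vector_derivative 2 * (Y t (A y) \<bullet> Y t y)) (at t within {0..T})"
      if "t \<in> {0..T}" for t
    proof -
      have "(Y has_vector_derivative A o\<^sub>L Y t) (at t within {0..T})"
        using fp that has_vector_derivative_within_subset[of Y _ t "{0..}" "{0..T}"]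
        by (auto simp: fundamental_pair_def)
      from has_real_derivative_inner_self[OF bounded_linear.has_vector_derivative[OF blinfun.bounded_linear_left[of y] this]]
      show ?thesis using that comm by (simp add: has_real_derivative_iff_has_vector_derivative)
    qed
    have "((\<lambda>t. 2 * (Y t (A y) \<bullet> Y t y)) has_integral Y T y \<bullet> Y T y - Y 0 y \<bullet> Y 0 y) {0..T}"
      by (rule fundamental_theorem_of_calculus[OF T der])
    then have "2 * integral {0..T} (\<lambda>t. Y t (A y) \<bullet> Y t y) = (norm (Y T y))\<^sup>2 - (norm y)\<^sup>2"
      using fp by (simp add: fundamental_pair_def dot_square_norm integral_unique flip: integral_mult_right)
    moreover have "(norm (Y T y))\<^sup>2 \<le> (1/2 * norm y)\<^sup>2"
      by (rule power_mono[OF half]) simp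
    moreover have "\<epsilon> * (A y \<bullet> y) \<le> 1/4 * (norm y)\<^sup>2"
    proof -
      have "\<epsilon> * (A y \<bullet> y) \<le> \<epsilon> * (norm A * norm y * norm y)"
        using \<epsilon>(1) norm_blinfun[of A y] norm_cauchy_schwarz[of "A y" y]
        by (intro mult_left_mono) (meson mult_right_mono norm_ge_zero order_trans, simp)
      also have "\<dots> \<le> 1/4 * (norm y * norm y)"
        using mult_right_mono[OF \<epsilon>(2), of "norm y * norm y"] by (simp add: mult_ac)
      finally show ?thesis by (simp add: power2_eq_square)
    qed
    ultimately have "B (A y) y \<le> - (1/8) * (norm y)\<^sup>2"
      unfolding B_def by (simp add: power2_eq_square)
    moreover have "B y y \<le> M * (norm y)\<^sup>2"
      using M(1)[of y y] by (simp add: power2_eq_square mult_ac)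
    ultimately have "8 * B (A y) y * M \<le> - B y y"
      using mult_right_mono[of "8 * B (A y) y" "- (norm y)\<^sup>2" M] M(2) by (simp add: mult.commute)
    then show ?thesis using M(2) by (simp add: field_simps)
  qed
  moreover have "\<forall>y z. B y z = B z y" by (simp add: B_def inner_commute)
  moreover have "0 < 1 / (8 * M)" using M(2) by simp
  ultimately show ?thesis using B \<epsilon>(1) low by blast
qed

section \<open>Exponentially stable flows\<close>

lemma inner_le_norm_mult: "norm a \<le> k \<Longrightarrow> a \<bullet> b \<le> k * norm b"
  using norm_cauchy_schwarz[of a b] mult_right_mono[of "norm a" k "norm b"] by simp

text \<open>Up to \<open>T\<close> only a growth bound is known, after \<open>T\<close> the form
  \<open>B\<close> contracts. The constant \<open>C\<close> is fixed before the curve, so one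
  estimate serves differences of trajectories, single trajectories and solutions of the variational
  equation.\<close>

lemma two_phase_decay:
  fixes B :: "'a::euclidean_space \<Rightarrow> 'a \<Rightarrow> real"
  assumes B: "bounded_bilinear B" and sym: "\<And>y z. B y z = B z y" and \<epsilon>: "0 < \<epsilon>"
    and low: "\<And>y. \<epsilon> * (norm y)\<^sup>2 \<le> B y y" and "0 \<le> T" "0 \<le> L" "0 < \<mu>"
  shows "\<exists>C>0. \<forall>\<delta> \<delta>'. (\<forall>t\<ge>0. (\<delta> has_vector_derivative \<delta>' t) (at t within {0..})) \<longrightarrow>
    (\<forall>t. 0 \<le> t \<and> t \<le> T \<longrightarrow> \<delta>' t \<bullet> \<delta> t \<le> L * (norm (\<delta> t))\<^sup>2) \<longrightarrow>
    (\<forall>t\<ge>T. B (\<delta>' t) (\<delta> t) \<le> - \<mu> * B (\<delta> t) (\<delta> t)) \<longrightarrow>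
    (\<forall>t\<ge>0. norm (\<delta> t) \<le> C * exp (- \<mu> * t) * norm (\<delta> 0))"
proof -
  obtain M where M: "\<And>y z. norm (B y z) \<le> norm y * norm z * M" "0 < M"
    using bounded_bilinear.pos_bounded[OF B] by metis
  have up: "B y y \<le> M * (norm y)\<^sup>2" for y
    using M(1)[of y y] by (simp add: power2_eq_square mult_ac)
  \<comment> \<open>\<open>q\<close> compares the Euclidean norm with the one given by
    \<open>B\<close>; the maximum with 1 lets the same constant cover the times before
    \<open>T\<close>.\<close>
  define q where "q = sqrt (max 1 (M / \<epsilon>))"
  have q: "1 \<le> q" "q\<^sup>2 = max 1 (M / \<epsilon>)" by (simp_all add: q_def)
  \<comment> \<open>The exponential pays for the growth up to \<open>T\<close> and for the decay
    missed during that time.\<close>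
  define C where "C = q * exp ((L + \<mu>) * T)"
  show ?thesis
  proof (intro exI[of _ C] conjI allI impI)
    show "0 < C" unfolding C_def by (rule mult_pos_pos) (use q(1) in linarith, simp)
    fix \<delta> \<delta>' and t :: real
    assume der: "\<forall>t\<ge>0. (\<delta> has_vector_derivative \<delta>' t) (at t within {0..})"
      and 1: "\<forall>t. 0 \<le> t \<and> t \<le> T \<longrightarrow> \<delta>' t \<bullet> \<delta> t \<le> L * (norm (\<delta> t))\<^sup>2"
      and 2: "\<forall>t\<ge>T. B (\<delta>' t) (\<delta> t) \<le> - \<mu> * B (\<delta> t) (\<delta> t)" and t: "0 \<le> t"
    have early: "norm (\<delta> t) \<le> exp (L * T) * norm (\<delta> 0)" if t: "0 \<le> t" "t \<le> T" for t
    proof -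
      have "\<delta> t \<bullet> \<delta> t \<le> (\<delta> 0 \<bullet> \<delta> 0) * exp ((2 * L) * t)"
      proof (rule exp_comparison[OF t(1)])
        fix \<tau> assume "0 \<le> \<tau>" "\<tau> \<le> t"
        then show "((\<lambda>t. \<delta> t \<bullet> \<delta> t) has_real_derivative 2 * (\<delta>' \<tau> \<bullet> \<delta> \<tau>)) (at \<tau> within {0..t})"
          by (intro has_real_derivative_inner_self has_vector_derivative_within_subset[OF der[rule_format]]) auto
      next
        fix \<tau> assume "0 < \<tau>" "\<tau> < t"
        then show "2 * (\<delta>' \<tau> \<bullet> \<delta> \<tau>) \<le> 2 * L * (\<delta> \<tau> \<bullet> \<delta> \<tau>)"
          using 1 t by (simp add: dot_square_norm)
      qed
      also have "\<dots> = (exp (L * t) * norm (\<delta> 0))\<^sup>2"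
        unfolding mult.assoc exp_double power_mult_distrib dot_square_norm by (rule mult.commute)
      finally have "(norm (\<delta> t))\<^sup>2 \<le> (exp (L * t) * norm (\<delta> 0))\<^sup>2"
        by (simp only: dot_square_norm)
      then have "norm (\<delta> t) \<le> exp (L * t) * norm (\<delta> 0)"
        by (rule power2_le_imp_le) simp
      also have "\<dots> \<le> exp (L * T) * norm (\<delta> 0)"
        using mult_left_mono[OF t(2) \<open>0 \<le> L\<close>] by (intro mult_right_mono) simp_all
      finally show ?thesis .
    qed
    show "norm (\<delta> t) \<le> C * exp (- \<mu> * t) * norm (\<delta> 0)"
    proof (cases "t \<le> T")
      case True
      have e: "0 \<le> \<mu> * (T - t)" using True \<open>0 < \<mu>\<close> by simp
      have "L * T \<le> (L + \<mu>) * T + - \<mu> * t"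
        using e by (simp add: distrib_right right_diff_distrib)
      then have "exp (L * T) \<le> 1 * (exp ((L + \<mu>) * T) * exp (- \<mu> * t))"
        unfolding exp_add[symmetric] by simp
      also have "\<dots> \<le> q * (exp ((L + \<mu>) * T) * exp (- \<mu> * t))"
        by (rule mult_right_mono[OF q(1)]) simp
      finally have "exp (L * T) \<le> C * exp (- \<mu> * t)"
        unfolding C_def mult.assoc .
      from mult_right_mono[OF this norm_ge_zero] show ?thesis
        by (rule order_trans[OF early[OF t True]])
    next
      case False
      define s where "s = (\<lambda>\<tau>. B (\<delta> (T + \<tau>)) (\<delta> (T + \<tau>)))"
      have "s (t - T) \<le> s 0 * exp ((- 2 * \<mu>) * (t - T))"
      proof (rule exp_comparison)
        fix \<tau> assume \<tau>: "0 \<le> \<tau>" "\<tau> \<le> t - T"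
        have "((\<lambda>\<tau>. \<delta> (T + \<tau>)) has_vector_derivative \<delta>' (T + \<tau>)) (at \<tau> within {0..})"
          using der \<open>0 \<le> T\<close> \<tau> by (intro has_vector_derivative_shift) auto
        then have "((\<lambda>\<tau>. \<delta> (T + \<tau>)) has_vector_derivative \<delta>' (T + \<tau>)) (at \<tau> within {0..t - T})"
          by (rule has_vector_derivative_within_subset) auto
        from bounded_bilinear.has_vector_derivative[OF B this this]
        show "(s has_real_derivative 2 * B (\<delta>' (T + \<tau>)) (\<delta> (T + \<tau>))) (at \<tau> within {0..t - T})"
          by (simp add: s_def has_real_derivative_iff_has_vector_derivative sym[of "\<delta> (T + \<tau>)" "\<delta>' (T + \<tau>)"])
      next
        fix \<tau> assume \<tau>: "0 < \<tau>" "\<tau> < t - T"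
        then show "2 * B (\<delta>' (T + \<tau>)) (\<delta> (T + \<tau>)) \<le> - 2 * \<mu> * s \<tau>"
          using 2[rule_format, of "T + \<tau>"] by (simp add: s_def)
      qed (use False in auto)
      then have "\<epsilon> * (norm (\<delta> t))\<^sup>2 \<le> B (\<delta> T) (\<delta> T) * (exp (- \<mu> * (t - T)))\<^sup>2"
        using low[of "\<delta> t"] exp_double[of "- \<mu> * (t - T)"] by (simp add: s_def mult.assoc)
      also have "\<dots> \<le> M * (norm (\<delta> T))\<^sup>2 * (exp (- \<mu> * (t - T)))\<^sup>2"
        by (rule mult_right_mono[OF up]) simp
      finally have "(norm (\<delta> t))\<^sup>2 \<le> (M / \<epsilon>) * (norm (\<delta> T) * exp (- \<mu> * (t - T)))\<^sup>2"
        using \<epsilon> by (simp only: power_mult_distrib pos_le_divide_eq times_divide_eq_left mult_ac)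
      also have "\<dots> \<le> q\<^sup>2 * (norm (\<delta> T) * exp (- \<mu> * (t - T)))\<^sup>2"
        unfolding q(2) by (rule mult_right_mono) auto
      finally have "(norm (\<delta> t))\<^sup>2 \<le> (q * (norm (\<delta> T) * exp (- \<mu> * (t - T))))\<^sup>2"
        by (simp add: power_mult_distrib)
      then have "norm (\<delta> t) \<le> q * (norm (\<delta> T) * exp (- \<mu> * (t - T)))"
        by (rule power2_le_imp_le) (use q(1) in auto)
      also have "\<dots> \<le> q * ((exp (L * T) * norm (\<delta> 0)) * exp (- \<mu> * (t - T)))"
        using q(1) early[of T] \<open>0 \<le> T\<close> by (intro mult_left_mono mult_right_mono) auto
      also have "\<dots> = C * exp (- \<mu> * t) * norm (\<delta> 0)"
      proof -
        have "exp (L * T) * exp (- \<mu> * (t - T)) = exp ((L + \<mu>) * T) * exp (- \<mu> * t)"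
          unfolding exp_add[symmetric] by (rule arg_cong[of _ _ exp]) (simp add: distrib_right right_diff_distrib)
        then show ?thesis unfolding C_def by (simp only: mult_ac)
      qed
      finally show ?thesis .
    qed
  qed
qed

section \<open>Contraction near the equilibrium and uniform decay near a trajectory\<close>

text \<open>What an admissible pair supplies for its closed loop, freed from controllers and
  matrices. The semigroup law is derived from uniqueness in \<open>X_flow\<close>;
  \<open>X_exp\<close> is the only quantitative input.\<close>

locale stable_flow =
  fixes F :: "'a::euclidean_space \<Rightarrow> 'a" and \<Omega> :: "'a set" and X :: "'a \<Rightarrow> real \<Rightarrow> 'a"
  assumes open_dom: "open \<Omega>" and zero_in_dom: "0 \<in> \<Omega>" and F_zero: "F 0 = 0"
    and F_smooth: "smooth_on F \<Omega>"
    and X_zero: "x \<in> \<Omega> \<Longrightarrow> X x 0 = x"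
    and X_in: "x \<in> \<Omega> \<Longrightarrow> 0 \<le> t \<Longrightarrow> X x t \<in> \<Omega>"
    and X_der: "x \<in> \<Omega> \<Longrightarrow> 0 \<le> t \<Longrightarrow> (X x has_vector_derivative F (X x t)) (at t within {0..})"
    and X_lim: "x \<in> \<Omega> \<Longrightarrow> (X x \<longlongrightarrow> 0) at_top"
    and X_exp: "\<exists>\<epsilon>>0. \<exists>C>0. \<exists>\<nu>>0. ball 0 \<epsilon> \<subseteq> \<Omega> \<and>
        (\<forall>x\<in>ball 0 \<epsilon>. \<forall>t\<ge>0. norm (X x t) \<le> C * exp (- \<nu> * t) * norm x)"
begin

lemma F_C1: "Ck_on 1 F \<Omega>" "Ck_on (Suc 0) F \<Omega>"
  using smooth_onD[OF F_smooth] by auto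

lemma F_has_derivative: "x \<in> \<Omega> \<Longrightarrow> (F has_derivative bderiv F x) (at x)"
  by (rule has_derivative_bderiv[OF F_C1(2)])

lemma continuous_on_bderiv_F: "continuous_on \<Omega> (bderiv F)"
  using Ck_on_imp_continuous_on[OF Ck_on_bderiv[OF open_dom F_C1(2)]] .

lemma X_flow:
  assumes "x \<in> \<Omega>" "0 \<le> s" "0 \<le> t"
  shows "X x (s + t) = X (X x s) t"
proof (rule C1_solution_unique[OF open_dom F_C1(1) assms(3), where \<phi> = "\<lambda>t. X x (s + t)"])
  fix \<tau> :: real assume \<tau>: "0 \<le> \<tau>" "\<tau> \<le> t"
  show "X x (s + \<tau>) \<in> \<Omega> \<and>
      ((\<lambda>t. X x (s + t)) has_vector_derivative F (X x (s + \<tau>))) (at \<tau> within {0..t})"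
    using \<tau> assms X_in[of x "s + \<tau>"]
    by (auto intro!: has_vector_derivative_within_subset[OF has_vector_derivative_shift[where \<phi>' = "\<lambda>t. F (X x t)"]] X_der)
  show "X (X x s) \<tau> \<in> \<Omega> \<and> (X (X x s) has_vector_derivative F (X (X x s) \<tau>)) (at \<tau> within {0..t})"
    using \<tau> assms by (auto intro!: X_in has_vector_derivative_within_subset[OF X_der])
qed (use assms in \<open>simp add: X_zero X_in\<close>)

lemma X_continuous: "x \<in> \<Omega> \<Longrightarrow> continuous_on {0..} (X x)"
  by (rule has_vector_derivative_imp_continuous_on[where f' = "\<lambda>t. F (X x t)"]) (use X_der in auto)

text \<open>Near \<open>0\<close> the linearized and the nonlinear flow differ by a small multiple
  of the initial norm. As the nonlinear flow shrinks small vectors by the factor 1/4 at a suitable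
  time, the linear one shrinks them by 1/2, and homogeneity removes the smallness.\<close>

lemma linearization_halving:
  assumes fp: "fundamental_pair (\<lambda>_. bderiv F 0) Y \<Phi>"
  shows "\<exists>T\<ge>0. \<forall>y. norm (Y T y) \<le> 1/2 * norm y"
proof -
  obtain \<epsilon> C \<nu> where \<epsilon>: "0 < \<epsilon>" "0 < C" "0 < \<nu>" "ball 0 \<epsilon> \<subseteq> \<Omega>"
    and dec': "\<forall>x\<in>ball 0 \<epsilon>. \<forall>t\<ge>0. norm (X x t) \<le> C * exp (- \<nu> * t) * norm x"
    using X_exp by blast
  have dec: "norm (X x t) \<le> C * exp (- \<nu> * t) * norm x" if "x \<in> ball 0 \<epsilon>" "0 \<le> t" for x t
    using dec' that by blast
  obtain T where T: "0 \<le> T" "C * exp (- \<nu> * T) < 1/4"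
    using exp_decay_small[OF \<epsilon>(3), of "1/4" C] by (metis order_refl zero_less_divide_1_iff zero_less_numeral)
  let ?A = "bderiv F 0"
  define c where "c = 2 * norm ?A + 1"
  \<comment> \<open>Chosen so that the error accumulated up to \<open>T\<close> is at most a quarter
    of the initial norm.\<close>
  define \<eta> where "\<eta> = 1 / (4 * C * exp (c * T))"
  have \<eta>: "0 < \<eta>" "\<eta> * C * exp (c * T) = 1/4" using \<epsilon>(2) by (auto simp: \<eta>_def)
  obtain d where d: "0 < d" "\<And>x. norm x < d \<Longrightarrow> norm (F x - ?A x) \<le> \<eta> * norm x"
    using F_has_derivative[OF zero_in_dom] \<eta>(1) unfolding has_derivative_at_alt
    by (auto simp: F_zero)
  define r where "r = min \<epsilon> (d / C)"
  have r: "0 < r" using \<epsilon> d by (simp add: r_def)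
  have small: "norm (Y T x) \<le> 1/2 * norm x" if x: "norm x < r" for x
  proof -
    have xin: "x \<in> ball 0 \<epsilon>" "x \<in> \<Omega>" using x \<epsilon>(4) by (auto simp: r_def subset_iff)
    have Xx: "norm (X x t) \<le> C * norm x" "norm (X x t) < d" if "0 \<le> t" for t
    proof -
      have "norm (X x t) \<le> C * exp (- \<nu> * t) * norm x" using dec[OF xin(1) that] .
      also have "\<dots> \<le> C * 1 * norm x"
        using \<epsilon> that by (intro mult_right_mono mult_left_mono) auto
      finally show "norm (X x t) \<le> C * norm x" by simp
      also have "C * norm x < d" using x \<epsilon>(2) by (simp add: r_def field_simps)
      finally show "norm (X x t) < d" .
    qed
    define e where "e = \<eta> * C * norm x"
    define D where "D = (\<lambda>t. X x t - Y t x)"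
    \<comment> \<open>Adding the constant \<open>e\<^sup>2\<close> absorbs the inhomogeneous term:
      after \<open>2 * e * norm (D t) \<le> e\<^sup>2 + (norm (D t))\<^sup>2\<close> the inequality
      is homogeneous in \<open>s\<close>.\<close>
    define s where "s = (\<lambda>t. D t \<bullet> D t + e\<^sup>2)"
    have "s T \<le> s 0 * exp (c * T)"
    proof (rule exp_comparison[OF T(1)])
      fix t assume t: "0 \<le> t" "t \<le> T"
      have "(Y has_vector_derivative ?A o\<^sub>L Y t) (at t within {0..T})"
        using fp t has_vector_derivative_within_subset[of Y _ t "{0..}" "{0..T}"]
        by (auto simp: fundamental_pair_def)
      from bounded_linear.has_vector_derivative[OF blinfun.bounded_linear_left[of x] this]
      have "(D has_vector_derivative F (X x t) - ?A (Y t x)) (at t within {0..T})"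
        unfolding D_def using t xin
        by (intro has_vector_derivative_diff) (auto intro: has_vector_derivative_within_subset[OF X_der])
      from DERIV_add[OF has_real_derivative_inner_self[OF this] DERIV_const[of "e\<^sup>2"]]
      show "(s has_real_derivative 2 * ((F (X x t) - ?A (Y t x)) \<bullet> D t)) (at t within {0..T})"
        by (simp add: s_def)
    next
      fix t assume t: "0 < t" "t < T"
      have "norm (F (X x t) - ?A (X x t)) \<le> \<eta> * norm (X x t)"
        using d(2) Xx t by simp
      also have "\<dots> \<le> e" using Xx(1)[of t] t \<eta>(1) by (simp add: e_def)
      finally have 1: "norm (F (X x t) - ?A (X x t)) \<le> e" .
      have "(F (X x t) - ?A (Y t x)) \<bullet> D t = (F (X x t) - ?A (X x t)) \<bullet> D t + ?A (D t) \<bullet> D t"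
        by (simp add: D_def blinfun.bilinear_simps algebra_simps)
      also have "\<dots> \<le> e * norm (D t) + norm ?A * norm (D t) * norm (D t)"
        by (intro add_mono inner_le_norm_mult 1 norm_blinfun)
      finally have "2 * ((F (X x t) - ?A (Y t x)) \<bullet> D t) \<le> 2 * e * norm (D t) + 2 * norm ?A * (norm (D t))\<^sup>2"
        by (simp add: power2_eq_square)
      also have "2 * e * norm (D t) \<le> e\<^sup>2 + (norm (D t))\<^sup>2"
        using zero_le_power2[of "e - norm (D t)"] by (simp add: power2_diff)
      also have "e\<^sup>2 + (norm (D t))\<^sup>2 + 2 * norm ?A * (norm (D t))\<^sup>2 \<le> c * s t"
        by (simp add: c_def s_def dot_square_norm algebra_simps)
      finally show "2 * ((F (X x t) - ?A (Y t x)) \<bullet> D t) \<le> c * s t" by simp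
    qed
    then have "(norm (D T))\<^sup>2 + e\<^sup>2 \<le> e\<^sup>2 * exp (c * T)"
      using fp X_zero[OF xin(2)] by (simp add: s_def D_def fundamental_pair_def dot_square_norm)
    then have "(norm (D T))\<^sup>2 \<le> e\<^sup>2 * exp (c * T)"
      using zero_le_power2[of e] by linarith
    also have "\<dots> \<le> e\<^sup>2 * (exp (c * T))\<^sup>2"
      using T(1) self_le_power[of "exp (c * T)" 2] by (intro mult_left_mono) (auto simp: c_def)
    finally have "(norm (D T))\<^sup>2 \<le> (e * exp (c * T))\<^sup>2"
      by (simp add: power_mult_distrib)
    moreover have "0 \<le> e" using \<eta>(1) \<epsilon>(2) by (simp add: e_def)
    ultimately have "norm (D T) \<le> e * exp (c * T)"
      by (metis exp_ge_zero mult_nonneg_nonneg power2_le_imp_le)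
    also have "\<dots> = 1/4 * norm x" using \<eta>(2) by (simp add: e_def)
    finally have "norm (D T) \<le> 1/4 * norm x" .
    moreover have "norm (X x T) \<le> 1/4 * norm x"
      using dec[OF xin(1) T(1)] mult_right_mono[of "C * exp (- \<nu> * T)" "1/4" "norm x"] T(2) by simp
    moreover have "norm (Y T x) \<le> norm (X x T) + norm (D T)"
      using norm_triangle_ineq4[of "X x T" "D T"] by (simp add: D_def)
    ultimately show ?thesis by simp
  qed
  have "norm (Y T y) \<le> 1/2 * norm y" for y
  proof (cases "y = 0")
    case False
    define k where "k = r / (2 * norm y)"
    have k: "0 < k" using r False by (simp add: k_def)
    have "norm (k *\<^sub>R y) < r" using r False by (simp add: k_def)
    from small[OF this] show ?thesis using k by (simp add: blinfun.scaleR_right)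
  qed (simp add: blinfun.zero_right)
  then show ?thesis using T(1) by blast
qed

text \<open>By continuity, the Lyapunov form of the linearization at \<open>0\<close> still
  decreases for the derivatives at nearby points, at half the rate. The mean value theorem on a
  segment inside the convex ball transfers this from derivatives to differences of
  \<open>F\<close>.\<close>

lemma quadratic_contraction:
  obtains B :: "'a \<Rightarrow> 'a \<Rightarrow> real" and \<epsilon> \<mu> \<rho> where "bounded_bilinear B" "\<And>y z. B y z = B z y"
    "0 < \<epsilon>" "0 < \<mu>" "0 < \<rho>" "cball 0 \<rho> \<subseteq> \<Omega>" "\<And>y. \<epsilon> * (norm y)\<^sup>2 \<le> B y y"
    "\<And>x y. x \<in> cball 0 \<rho> \<Longrightarrow> B (bderiv F x y) y \<le> - \<mu> * B y y"
    "\<And>x z. x \<in> cball 0 \<rho> \<Longrightarrow> z \<in> cball 0 \<rho> \<Longrightarrow> B (F x - F z) (x - z) \<le> - \<mu> * B (x - z) (x - z)"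
proof -
  let ?A = "bderiv F 0"
  obtain Y \<Phi> where fp: "fundamental_pair (\<lambda>_. ?A) Y \<Phi>"
    using fundamental_pair_exists[of "\<lambda>_. ?A" "norm ?A"] by auto
  obtain T where T: "0 \<le> T" "\<And>y. norm (Y T y) \<le> 1/2 * norm y"
    using linearization_halving[OF fp] by blast
  from lyapunov_form_exists[OF fp T] obtain B \<epsilon> \<mu> where B: "bounded_bilinear B"
    and sym: "\<And>y z. B y z = (B z y :: real)" and pos: "0 < \<epsilon>" "0 < \<mu>"
    and low: "\<And>y. \<epsilon> * (norm y)\<^sup>2 \<le> B y y" and A: "\<And>y. B (?A y) y \<le> - \<mu> * B y y"
    by blast
  interpret B: bounded_bilinear B by (rule B)
  obtain M where M: "\<And>y z. norm (B y z) \<le> norm y * norm z * M" "0 < M"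
    using B.pos_bounded by metis
  \<comment> \<open>A perturbation of the derivative by this much costs half of the decay rate,
    measured through the coercivity of \<open>B\<close>.\<close>
  define \<eta> where "\<eta> = \<mu> * \<epsilon> / (2 * M)"
  have \<eta>: "0 < \<eta>" using pos M by (simp add: \<eta>_def)
  have "isCont (bderiv F) 0"
    using continuous_on_bderiv_F open_dom zero_in_dom by (simp add: continuous_on_eq_continuous_at)
  then obtain d where d: "0 < d" "\<And>x. norm x < d \<Longrightarrow> norm (bderiv F x - ?A) < \<eta>"
    using \<eta> unfolding continuous_at_eps_delta by (auto simp: dist_norm)
  obtain d' where d': "0 < d'" "cball 0 d' \<subseteq> \<Omega>"
    using open_dom zero_in_dom open_contains_cball by blast
  define \<rho> where "\<rho> = min (d / 2) d'"
  have \<rho>: "0 < \<rho>" "\<rho> < d" "cball 0 \<rho> \<subseteq> \<Omega>" using d d' by (auto simp: \<rho>_def)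
  have D: "B (bderiv F x y) y \<le> - (\<mu> / 2) * B y y" if "x \<in> cball 0 \<rho>" for x y
  proof -
    have "norm (bderiv F x - ?A) < \<eta>" using d(2) that \<rho> by simp
    then have "norm (bderiv F x y - ?A y) \<le> \<eta> * norm y"
      using norm_blinfun[of "bderiv F x - ?A" y] mult_right_mono[of "norm (bderiv F x - ?A)" \<eta> "norm y"]
      by (simp add: blinfun.diff_left)
    then have "norm (bderiv F x y - ?A y) * norm y * M \<le> \<eta> * norm y * norm y * M"
      using M(2) by (intro mult_right_mono) auto
    also have "\<dots> = \<mu> / 2 * (\<epsilon> * (norm y)\<^sup>2)"
      using M(2) by (simp add: \<eta>_def power2_eq_square)
    also have "\<dots> \<le> \<mu> / 2 * B y y"
      using low pos by (intro mult_left_mono) auto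
    finally have "B (bderiv F x y - ?A y) y \<le> \<mu> / 2 * B y y"
      using M(1)[of "bderiv F x y - ?A y" y] by simp
    then show ?thesis using A[of y] by (simp add: B.diff_left)
  qed
  have "B (F x - F z) (x - z) \<le> - (\<mu> / 2) * B (x - z) (x - z)"
    if xz: "x \<in> cball 0 \<rho>" "z \<in> cball 0 \<rho>" for x z
  proof -
    define \<gamma> where "\<gamma> = (\<lambda>\<tau>. z + \<tau> *\<^sub>R (x - z))"
    have \<gamma>: "\<gamma> \<tau> \<in> cball 0 \<rho>" if "0 \<le> \<tau>" "\<tau> \<le> 1" for \<tau>
    proof -
      have "\<gamma> \<tau> = (1 - \<tau>) *\<^sub>R z + \<tau> *\<^sub>R x" by (simp add: \<gamma>_def algebra_simps)
      then show ?thesis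
        using convexD[OF convex_cball xz(2,1), of "1 - \<tau>" \<tau>] that by simp
    qed
    have der: "((\<lambda>\<tau>. B (F (\<gamma> \<tau>)) (x - z)) has_derivative
        (\<lambda>h. B (bderiv F (\<gamma> \<tau>) (h *\<^sub>R (x - z))) (x - z))) (at \<tau> within {0..1})"
      if "\<tau> \<in> {0..1}" for \<tau>
    proof -
      have "(\<gamma> has_derivative (\<lambda>h. h *\<^sub>R (x - z))) (at \<tau> within {0..1})"
        unfolding \<gamma>_def by (auto intro!: derivative_eq_intros)
      moreover have "(F has_derivative bderiv F (\<gamma> \<tau>)) (at (\<gamma> \<tau>))"
        using \<gamma>[of \<tau>] that \<rho>(3) by (intro F_has_derivative) auto
      ultimately have "((\<lambda>\<tau>. F (\<gamma> \<tau>)) has_derivative (\<lambda>h. bderiv F (\<gamma> \<tau>) (h *\<^sub>R (x - z)))) (at \<tau> within {0..1})"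
        by (rule has_derivative_compose)
      then show ?thesis
        by (rule bounded_linear.has_derivative[OF B.bounded_linear_left])
    qed
    then obtain \<tau> where \<tau>: "\<tau> \<in> {0<..<1}"
      "B (F (\<gamma> 1)) (x - z) - B (F (\<gamma> 0)) (x - z) = B (bderiv F (\<gamma> \<tau>) ((1 - 0) *\<^sub>R (x - z))) (x - z)"
      using mvt_simple[of 0 1 "\<lambda>\<tau>. B (F (\<gamma> \<tau>)) (x - z)" "\<lambda>\<tau> h. B (bderiv F (\<gamma> \<tau>) (h *\<^sub>R (x - z))) (x - z)"]
      by auto
    then show ?thesis
      using D[OF \<gamma>[of \<tau>], of "x - z"] by (simp add: \<gamma>_def B.diff_left)
  qed
  then show ?thesis
    using that[of B \<epsilon> "\<mu> / 2" \<rho>] B sym pos \<rho> low D by auto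
qed

text \<open>The estimates near one initial point, with common constants: decay of trajectories, of
  their differences and of solutions of the variational equation. The segments join points at equal
  times; they lie in \<open>K\<close> so that the mean value theorem can be used between
  neighbouring trajectories.\<close>

definition locally_decaying :: "'a \<Rightarrow> real \<Rightarrow> real \<Rightarrow> real \<Rightarrow> 'a set \<Rightarrow> bool"
  where "locally_decaying x\<^sub>0 r C \<mu> K \<longleftrightarrow>
    0 < r \<and> 0 < C \<and> 0 < \<mu> \<and> ball x\<^sub>0 r \<subseteq> \<Omega> \<and> compact K \<and> K \<subseteq> \<Omega> \<and>
    (\<forall>x\<in>ball x\<^sub>0 r. \<forall>t\<ge>0. X x t \<in> K \<and> norm (X x t) \<le> C * exp (- \<mu> * t) \<and>
      (\<forall>z\<in>ball x\<^sub>0 r. closed_segment (X x t) (X z t) \<subseteq> K \<and>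
        norm (X x t - X z t) \<le> C * exp (- \<mu> * t) * norm (x - z))) \<and>
    (\<forall>x\<in>ball x\<^sub>0 r. \<forall>\<eta>.
      (\<forall>t\<ge>0. (\<eta> has_vector_derivative blinfun_apply (bderiv F (X x t)) (\<eta> t)) (at t within {0..})) \<longrightarrow>
      (\<forall>t\<ge>0. norm (\<eta> t) \<le> C * exp (- \<mu> * t) * norm (\<eta> 0)))"

text \<open>The trajectory of the centre reaches the contraction region near \<open>0\<close> at a
  finite time \<open>T\<close>. Up to then neighbours remain in a tube around its compact arc, with
  Lipschitz growth; afterwards they contract in the form \<open>B\<close>. The three decay bounds
  are instances of \<open>two_phase_decay\<close>.\<close>

lemma locally_decaying_exists:
  assumes x0: "x\<^sub>0 \<in> \<Omega>"
  shows "\<exists>r C \<mu> K. locally_decaying x\<^sub>0 r C \<mu> K"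
proof -
  obtain B \<epsilon> \<mu> \<rho> where B: "bounded_bilinear B" and sym: "\<And>y z. B y z = (B z y :: real)"
    and pos: "0 < \<epsilon>" "0 < \<mu>" "0 < \<rho>" and \<rho>: "cball 0 \<rho> \<subseteq> \<Omega>"
    and low: "\<And>y. \<epsilon> * (norm y)\<^sup>2 \<le> B y y"
    and D: "\<And>x y. x \<in> cball 0 \<rho> \<Longrightarrow> B (bderiv F x y) y \<le> - \<mu> * B y y"
    and con: "\<And>x z. x \<in> cball 0 \<rho> \<Longrightarrow> z \<in> cball 0 \<rho> \<Longrightarrow> B (F x - F z) (x - z) \<le> - \<mu> * B (x - z) (x - z)"
    by (rule quadratic_contraction) (rule that)
  interpret B: bounded_bilinear B by (rule B)
  \<comment> \<open>A sublevel set rather than a ball, since it is the form \<open>B\<close>, not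
    the Euclidean norm, that decreases along trajectories.\<close>
  define U where "U = {x. B x x < \<epsilon> * \<rho>\<^sup>2}"
  have U_open: "open U"
    unfolding U_def by (intro open_Collect_less B.continuous_on continuous_on_id continuous_on_const)
  have U_ball: "x \<in> ball 0 \<rho>" if "x \<in> U" for x
  proof -
    have "\<epsilon> * (norm x)\<^sup>2 < \<epsilon> * \<rho>\<^sup>2" using low[of x] that by (simp add: U_def)
    then have "(norm x)\<^sup>2 < \<rho>\<^sup>2" using pos by simp
    then have "norm x < \<rho>" by (rule power2_less_imp_less) (use pos in simp)
    then show ?thesis by simp
  qed
  have "((\<lambda>t. B (X x\<^sub>0 t) (X x\<^sub>0 t)) \<longlongrightarrow> B 0 0) at_top"
    by (intro B.tendsto X_lim x0)
  then have "\<forall>\<^sub>F t in at_top. B (X x\<^sub>0 t) (X x\<^sub>0 t) < \<epsilon> * \<rho>\<^sup>2"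
    by (rule order_tendstoD) (use pos in \<open>simp add: B.zero_left\<close>)
  then have "\<forall>\<^sub>F t in at_top. 0 \<le> t \<and> B (X x\<^sub>0 t) (X x\<^sub>0 t) < \<epsilon> * \<rho>\<^sup>2"
    using eventually_ge_at_top by (rule eventually_conj[rotated])
  then obtain T where T: "0 \<le> T" "X x\<^sub>0 T \<in> U"
    by (auto dest!: eventually_happens simp: U_def)
  define c where "c = X x\<^sub>0 ` {0..T}"
  have c: "compact c" "c \<subseteq> \<Omega>"
    unfolding c_def using X_continuous[OF x0] X_in[OF x0]
    by (auto intro!: compact_continuous_image elim: continuous_on_subset)
  then obtain e where e: "0 < e" "(\<Union>x\<in>c. cball x e) \<subseteq> \<Omega>"
    using compact_subset_open_imp_cball_epsilon_subset open_dom by blast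
  define K where "K = (\<Union>x\<in>c. cball x e) \<union> cball 0 \<rho>"
  have K: "compact K" "K \<subseteq> \<Omega>"
    using compact_minkowski_sum_cball[OF c(1)] e \<rho> by (auto simp: K_def)
  have K0: "0 \<in> K" using pos by (simp add: K_def)
  obtain L where L: "0 \<le> L" "L-lipschitz_on K F"
    using C1_lipschitz_on_compact[OF open_dom F_C1(1) K] by blast
  have "bounded (bderiv F ` K)"
    using K continuous_on_bderiv_F
    by (intro compact_imp_bounded compact_continuous_image) (auto elim: continuous_on_subset)
  then obtain L' where L': "\<And>x. x \<in> K \<Longrightarrow> norm (bderiv F x) \<le> L'"
    unfolding bounded_iff by blast
  define N where "N = max L L'"
  have N: "0 \<le> N" "L \<le> N" "L' \<le> N" using L by (auto simp: N_def)
  obtain C where C: "0 < C" and decay': "\<forall>\<delta> \<delta>'.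
    (\<forall>t\<ge>0. (\<delta> has_vector_derivative \<delta>' t) (at t within {0..})) \<longrightarrow>
    (\<forall>t. 0 \<le> t \<and> t \<le> T \<longrightarrow> \<delta>' t \<bullet> \<delta> t \<le> N * (norm (\<delta> t))\<^sup>2) \<longrightarrow>
    (\<forall>t\<ge>T. B (\<delta>' t) (\<delta> t) \<le> - \<mu> * B (\<delta> t) (\<delta> t)) \<longrightarrow>
    (\<forall>t\<ge>0. norm (\<delta> t) \<le> C * exp (- \<mu> * t) * norm (\<delta> 0))"
    using two_phase_decay[OF B sym pos(1) low T(1) N(1) pos(2)] by (elim exE conjE)
  have decay: "norm (\<delta> t) \<le> C * exp (- \<mu> * t) * norm (\<delta> 0)"
    if "\<And>t. 0 \<le> t \<Longrightarrow> (\<delta> has_vector_derivative \<delta>' t) (at t within {0..})"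
      "\<And>t. 0 \<le> t \<Longrightarrow> t \<le> T \<Longrightarrow> \<delta>' t \<bullet> \<delta> t \<le> N * (norm (\<delta> t))\<^sup>2"
      "\<And>t. T \<le> t \<Longrightarrow> B (\<delta>' t) (\<delta> t) \<le> - \<mu> * B (\<delta> t) (\<delta> t)" "0 \<le> t" for \<delta> \<delta>' t
    using spec[OF spec[OF decay', of \<delta>], of \<delta>'] that by simp
  have F_inner: "(F x - F z) \<bullet> (x - z) \<le> N * (norm (x - z))\<^sup>2" if "x \<in> K" "z \<in> K" for x z
  proof -
    have "norm (F x - F z) \<le> L * norm (x - z)"
      using lipschitz_onD[OF L(2) that] by (simp add: dist_norm)
    also have "\<dots> \<le> N * norm (x - z)" by (rule mult_right_mono[OF N(2)]) simp
    finally show ?thesis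
      using inner_le_norm_mult[of "F x - F z" "N * norm (x - z)" "x - z"] by (simp add: power2_eq_square mult.assoc)
  qed
  have U_inv: "X z t \<in> U" if z: "z \<in> \<Omega>" "X z T \<in> U" "T \<le> t" for z t
  proof -
    define s where "s = (\<lambda>\<tau>. B (X z (T + \<tau>)) (X z (T + \<tau>)))"
    have s0: "0 \<le> s 0" "s 0 < \<epsilon> * \<rho>\<^sup>2"
      using order_trans[OF _ low[of "X z T"], of 0] pos z(2) by (auto simp: s_def U_def)
    have "s (t - T) < \<epsilon> * \<rho>\<^sup>2"
    proof (rule exp_barrier[where s = s and c = "- 2 * \<mu>" and T = "t - T"])
      fix \<tau> assume \<tau>: "0 \<le> \<tau>" "\<tau> \<le> t - T"
      have "((\<lambda>\<tau>. X z (T + \<tau>)) has_vector_derivative F (X z (T + \<tau>))) (at \<tau> within {0..})"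
        using T(1) \<tau> z by (intro has_vector_derivative_shift[where \<phi>' = "\<lambda>t. F (X z t)"] X_der) auto
      then have "((\<lambda>\<tau>. X z (T + \<tau>)) has_vector_derivative F (X z (T + \<tau>))) (at \<tau> within {0..t - T})"
        by (rule has_vector_derivative_within_subset) auto
      from B.has_vector_derivative[OF this this]
      show "(s has_real_derivative 2 * B (F (X z (T + \<tau>))) (X z (T + \<tau>))) (at \<tau> within {0..t - T})"
        by (simp add: s_def has_real_derivative_iff_has_vector_derivative sym[of "X z (T + \<tau>)" "F (X z (T + \<tau>))"])
    next
      fix \<tau> assume \<tau>: "0 \<le> \<tau>" "\<tau> \<le> t - T" "s \<tau> < \<epsilon> * \<rho>\<^sup>2"
      then have "X z (T + \<tau>) \<in> ball 0 \<rho>" by (intro U_ball) (simp add: U_def s_def)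
      then have "X z (T + \<tau>) \<in> cball 0 \<rho>" by simp
      from con[OF this, of 0] show "2 * B (F (X z (T + \<tau>))) (X z (T + \<tau>)) \<le> - 2 * \<mu> * s \<tau>"
        using pos by (simp add: s_def F_zero)
    next
      fix \<tau> assume \<tau>: "0 \<le> \<tau>" "\<tau> \<le> t - T"
      have "exp (- 2 * \<mu> * \<tau>) \<le> 1" using pos \<tau> by simp
      from mult_left_mono[OF this s0(1)] show "s 0 * exp (- 2 * \<mu> * \<tau>) < \<epsilon> * \<rho>\<^sup>2"
        using s0(2) by simp
    qed (use z in auto)
    then show ?thesis by (simp add: s_def U_def)
  qed
  obtain e2 where e2: "0 < e2" "ball (X x\<^sub>0 T) e2 \<subseteq> U"
    using U_open T(2) open_contains_ball by blast
  define e1 where "e1 = min e e2"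
  have e1: "0 < e1" "e1 \<le> e" "e1 \<le> e2" using e e2 by (auto simp: e1_def)
  \<comment> \<open>Lipschitz growth up to \<open>T\<close> enlarges distances by at most
    \<open>exp (L * T)\<close>, so neighbours within this radius stay in the tube and are in
    \<open>U\<close> at time \<open>T\<close>.\<close>
  define r where "r = e1 * exp (- (L * T))"
  have r: "0 < r" "r \<le> e1" "r * exp (L * T) = e1"
    using e1 L(1) T(1) mult_left_mono[of "exp (- (L * T))" 1 e1] by (simp_all add: r_def flip: exp_add)
  have x0c: "x\<^sub>0 \<in> c" unfolding c_def by (rule image_eqI[of _ _ 0]) (use T X_zero[OF x0] in auto)
  have rO: "ball x\<^sub>0 r \<subseteq> \<Omega>"
  proof -
    have "ball x\<^sub>0 r \<subseteq> cball x\<^sub>0 e" using r(2) e1(2) by auto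
    then show ?thesis using e(2) x0c by blast
  qed
  have tube: "dist (X x\<^sub>0 t) (X z t) < e1" if z: "z \<in> ball x\<^sub>0 r" and t: "0 \<le> t" "t \<le> T" for z t
  proof -
    have zO: "z \<in> \<Omega>" using z rO by blast
    define s where "s = (\<lambda>t. (X z t - X x\<^sub>0 t) \<bullet> (X z t - X x\<^sub>0 t))"
    have s_norm: "s t = (norm (X z t - X x\<^sub>0 t))\<^sup>2" for t by (simp add: s_def dot_square_norm)
    have "s t < e1\<^sup>2"
    proof (rule exp_barrier[where s = s and c = "2 * L" and T = T])
      fix t assume "0 \<le> t" "t \<le> T"
      then show "(s has_real_derivative 2 * ((F (X z t) - F (X x\<^sub>0 t)) \<bullet> (X z t - X x\<^sub>0 t))) (at t within {0..T})"
        unfolding s_def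
        by (intro has_real_derivative_inner_self has_vector_derivative_diff
            has_vector_derivative_within_subset[OF X_der] zO x0) auto
    next
      fix t assume t: "0 \<le> t" "t \<le> T" "s t < e1\<^sup>2"
      then have "norm (X z t - X x\<^sub>0 t) < e1"
        unfolding s_norm using e1(1) by (metis less_eq_real_def power2_less_imp_less)
      then have "X z t \<in> cball (X x\<^sub>0 t) e" using e1 by (simp add: dist_norm norm_minus_commute)
      then have in_K: "X z t \<in> K" "X x\<^sub>0 t \<in> K"
        using t e(1) by (auto simp: K_def c_def intro!: bexI[of _ t])
      have "norm (F (X z t) - F (X x\<^sub>0 t)) \<le> L * norm (X z t - X x\<^sub>0 t)"
        using lipschitz_onD[OF L(2) in_K] by (simp add: dist_norm)
      from inner_le_norm_mult[OF this, of "X z t - X x\<^sub>0 t"]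
      show "2 * ((F (X z t) - F (X x\<^sub>0 t)) \<bullet> (X z t - X x\<^sub>0 t)) \<le> 2 * L * s t"
        by (simp add: s_norm power2_eq_square)
    next
      fix t assume t: "0 \<le> t" "t \<le> T"
      have "norm (z - x\<^sub>0) < r" using z by (simp add: dist_norm norm_minus_commute)
      then have "norm (z - x\<^sub>0) * exp (L * T) < e1"
        using r(3) mult_strict_right_mono[of "norm (z - x\<^sub>0)" r "exp (L * T)"] by simp
      moreover have "norm (z - x\<^sub>0) * exp (L * t) \<le> norm (z - x\<^sub>0) * exp (L * T)"
        using mult_left_mono[OF t(2) L(1)] by (intro mult_left_mono) auto
      ultimately have "(norm (z - x\<^sub>0) * exp (L * t))\<^sup>2 < e1\<^sup>2"
        by (intro power_strict_mono) auto
      then show "s 0 * exp (2 * L * t) < e1\<^sup>2"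
        by (simp add: s_norm X_zero zO x0 power_mult_distrib exp_double mult.assoc)
    qed (use t in auto)
    then have "norm (X z t - X x\<^sub>0 t) < e1"
      unfolding s_norm using e1(1) by (metis less_eq_real_def power2_less_imp_less)
    then show ?thesis by (simp add: dist_norm norm_minus_commute)
  qed
  have late: "X z t \<in> ball 0 \<rho>" if "z \<in> ball x\<^sub>0 r" "T \<le> t" for z t
  proof (rule U_ball, rule U_inv)
    show "X z T \<in> U" using tube[OF that(1) T(1)] e1 e2 by auto
  qed (use that rO in auto)
  have in_K: "X z t \<in> K" if "z \<in> ball x\<^sub>0 r" "0 \<le> t" for z t
  proof (cases "t \<le> T")
    case True
    then have "X z t \<in> cball (X x\<^sub>0 t) e" using tube[OF that(1,2)] e1 by auto
    then show ?thesis using that True by (auto simp: K_def c_def intro!: bexI[of _ t])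
  next
    case False
    then show ?thesis using late[OF that(1), of t] by (auto simp: K_def)
  qed
  have seg: "closed_segment (X x t) (X z t) \<subseteq> K"
    if "x \<in> ball x\<^sub>0 r" "z \<in> ball x\<^sub>0 r" "0 \<le> t" for x z t
  proof (cases "t \<le> T")
    case True
    then have "X x t \<in> cball (X x\<^sub>0 t) e" "X z t \<in> cball (X x\<^sub>0 t) e"
      using tube[OF that(1,3)] tube[OF that(2,3)] e1 by auto
    then have "closed_segment (X x t) (X z t) \<subseteq> cball (X x\<^sub>0 t) e"
      by (rule closed_segment_subset) (rule convex_cball)
    moreover have "X x\<^sub>0 t \<in> c" using True that by (simp add: c_def)
    ultimately show ?thesis unfolding K_def by blast
  next
    case False
    then have "closed_segment (X x t) (X z t) \<subseteq> cball 0 \<rho>"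
      using late[OF that(1), of t] late[OF that(2), of t]
      by (intro closed_segment_subset convex_cball) auto
    then show ?thesis unfolding K_def by blast
  qed
  \<comment> \<open>The bound on trajectories carries no factor \<open>norm x\<close>, so the size
    of the initial ball enters here.\<close>
  define C' where "C' = C * (1 + norm x\<^sub>0 + r)"
  have C': "C \<le> C'" "0 < C'"
  proof -
    show "C \<le> C'" using C r(1) mult_left_mono[of 1 "1 + norm x\<^sub>0 + r" C] by (simp add: C'_def)
    with C show "0 < C'" by simp
  qed
  have mono: "C * exp (- \<mu> * t) * k \<le> C' * exp (- \<mu> * t) * k" if "0 \<le> k" for t k :: real
    using C' that by (intro mult_right_mono) auto
  have diff: "norm (X x t - X z t) \<le> C' * exp (- \<mu> * t) * norm (x - z)"
    if "x \<in> ball x\<^sub>0 r" "z \<in> ball x\<^sub>0 r" "0 \<le> t" for x z t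
  proof -
    have xz: "x \<in> \<Omega>" "z \<in> \<Omega>" using that rO by auto
    have "norm (X x t - X z t) \<le> C * exp (- \<mu> * t) * norm (X x 0 - X z 0)"
    proof (rule decay[of "\<lambda>t. X x t - X z t" "\<lambda>t. F (X x t) - F (X z t)", OF _ _ _ that(3)])
      show "((\<lambda>t. X x t - X z t) has_vector_derivative F (X x t) - F (X z t)) (at t within {0..})"
        if "0 \<le> t" for t using that xz by (intro has_vector_derivative_diff X_der)
      show "(F (X x t) - F (X z t)) \<bullet> (X x t - X z t) \<le> N * (norm (X x t - X z t))\<^sup>2" if "0 \<le> t" for t
        using in_K \<open>x \<in> ball x\<^sub>0 r\<close> \<open>z \<in> ball x\<^sub>0 r\<close> that by (intro F_inner) auto
      show "B (F (X x t) - F (X z t)) (X x t - X z t) \<le> - \<mu> * B (X x t - X z t) (X x t - X z t)" if "T \<le> t" for t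
        using late[of x t] late[of z t] \<open>x \<in> ball x\<^sub>0 r\<close> \<open>z \<in> ball x\<^sub>0 r\<close> that by (intro con) auto
    qed
    also have "\<dots> \<le> C' * exp (- \<mu> * t) * norm (X x 0 - X z 0)" by (rule mono) simp
    finally show ?thesis by (simp add: X_zero xz)
  qed
  have bound: "norm (X x t) \<le> C' * exp (- \<mu> * t)" if x: "x \<in> ball x\<^sub>0 r" "0 \<le> t" for x t
  proof -
    have xO: "x \<in> \<Omega>" using x rO by auto
    have "norm (X x t) \<le> C * exp (- \<mu> * t) * norm (X x 0)"
    proof (rule decay[of "X x" "\<lambda>t. F (X x t)", OF _ _ _ x(2)])
      show "F (X x t) \<bullet> X x t \<le> N * (norm (X x t))\<^sup>2" if "0 \<le> t" for t
        using F_inner[OF in_K[OF x(1) that] K0] by (simp add: F_zero)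
      show "B (F (X x t)) (X x t) \<le> - \<mu> * B (X x t) (X x t)" if "T \<le> t" for t
        using con[of "X x t" 0] late[OF x(1) that] pos by (simp add: F_zero)
    qed (use X_der xO in auto)
    also have "\<dots> \<le> C * exp (- \<mu> * t) * (1 + norm x\<^sub>0 + r)"
    proof (rule mult_left_mono)
      have "norm x \<le> norm x\<^sub>0 + norm (x - x\<^sub>0)" by (metis add.commute diff_add_cancel norm_triangle_ineq)
      then show "norm (X x 0) \<le> 1 + norm x\<^sub>0 + r"
        using x by (simp add: X_zero xO dist_norm norm_minus_commute)
    qed (use C in simp)
    finally show ?thesis by (simp add: C'_def mult_ac)
  qed
  have lin: "norm (\<eta> t) \<le> C' * exp (- \<mu> * t) * norm (\<eta> 0)"
    if x: "x \<in> ball x\<^sub>0 r" and \<eta>: "\<forall>t\<ge>0. (\<eta> has_vector_derivative blinfun_apply (bderiv F (X x t)) (\<eta> t)) (at t within {0..})"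
      and t: "0 \<le> t" for x \<eta> t
  proof -
    have "norm (\<eta> t) \<le> C * exp (- \<mu> * t) * norm (\<eta> 0)"
    proof (rule decay[of \<eta> "\<lambda>t. bderiv F (X x t) (\<eta> t)", OF _ _ _ t])
      show "bderiv F (X x t) (\<eta> t) \<bullet> \<eta> t \<le> N * (norm (\<eta> t))\<^sup>2" if "0 \<le> t" for t
      proof -
        have "norm (bderiv F (X x t) (\<eta> t)) \<le> norm (bderiv F (X x t)) * norm (\<eta> t)"
          by (rule norm_blinfun)
        also have "\<dots> \<le> N * norm (\<eta> t)"
          using L'[OF in_K[OF x that]] N by (intro mult_right_mono) auto
        finally show ?thesis
          using inner_le_norm_mult[of "bderiv F (X x t) (\<eta> t)" "N * norm (\<eta> t)" "\<eta> t"]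
          by (simp add: power2_eq_square mult.assoc)
      qed
      show "B (bderiv F (X x t) (\<eta> t)) (\<eta> t) \<le> - \<mu> * B (\<eta> t) (\<eta> t)" if "T \<le> t" for t
        using late[OF x that] by (intro D) auto
    qed (use \<eta> in auto)
    also have "\<dots> \<le> C' * exp (- \<mu> * t) * norm (\<eta> 0)" by (rule mono) simp
    finally show ?thesis .
  qed
  have "locally_decaying x\<^sub>0 r C' \<mu> K"
    unfolding locally_decaying_def
    by (intro conjI ballI allI impI)
      (rule r(1) C'(2) pos(2) rO K in_K bound seg diff lin | assumption)+
  then show ?thesis by blast
qed

end

interpretation blinfun_compose: bounded_bilinear "(o\<^sub>L)"
  by (rule bounded_bilinear_blinfun_compose)

text \<open>The estimate in the first variable is uniform on bounded time intervals, so continuity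
  in time is used only along the reference curve.\<close>

lemma joint_continuity:
  fixes f :: "'x::metric_space \<Rightarrow> real \<Rightarrow> 'c::real_normed_vector"
  assumes cont: "\<And>x. x \<in> S \<Longrightarrow> continuous_on {0..} (f x)"
    and unif: "\<And>x\<^sub>0 T e. x\<^sub>0 \<in> S \<Longrightarrow> 0 \<le> T \<Longrightarrow> 0 < e \<Longrightarrow>
      \<exists>d>0. \<forall>x\<in>S. dist x x\<^sub>0 < d \<longrightarrow> (\<forall>t\<in>{0..T}. norm (f x t - f x\<^sub>0 t) \<le> e)"
  shows "continuous_on (S \<times> {0..}) (\<lambda>(x, t). f x t)"
  unfolding continuous_on_iff
proof (intro ballI allI impI)
  fix q :: "'x \<times> real" and e :: real assume q: "q \<in> S \<times> {0..}" and e: "0 < e"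
  obtain x\<^sub>0 t\<^sub>0 where qe: "q = (x\<^sub>0, t\<^sub>0)" by (cases q)
  have x0: "x\<^sub>0 \<in> S" and t0: "t\<^sub>0 \<in> {0..}" using q qe by auto
  have "0 \<le> t\<^sub>0 + 1" "0 < e / 4" using t0 e by auto
  from unif[OF x0 this] obtain d where d0: "0 < d"
    "\<forall>x\<in>S. dist x x\<^sub>0 < d \<longrightarrow> (\<forall>t\<in>{0..t\<^sub>0 + 1}. norm (f x t - f x\<^sub>0 t) \<le> e / 4)"
    by (elim exE conjE)
  then have d: "0 < d" "\<And>x t. x \<in> S \<Longrightarrow> dist x x\<^sub>0 < d \<Longrightarrow> t \<in> {0..t\<^sub>0 + 1} \<Longrightarrow> norm (f x t - f x\<^sub>0 t) \<le> e / 4"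
    by blast+
  from cont[OF x0, unfolded continuous_on_iff, rule_format, OF t0 \<open>0 < e / 4\<close>]
  obtain d' where d': "0 < d'" "\<And>t. t \<in> {0..} \<Longrightarrow> dist t t\<^sub>0 < d' \<Longrightarrow> dist (f x\<^sub>0 t) (f x\<^sub>0 t\<^sub>0) < e / 4"
    by blast
  show "\<exists>\<delta>>0. \<forall>p\<in>S \<times> {0..}. dist p q < \<delta> \<longrightarrow> dist (case p of (x, t) \<Rightarrow> f x t) (case q of (x, t) \<Rightarrow> f x t) < e"
  proof (intro exI[of _ "min (min d d') 1"] conjI ballI impI)
    fix p assume p: "p \<in> S \<times> {0..}" "dist p q < min (min d d') 1"
    obtain x t where pe: "p = (x, t)" by (cases p)
    have 1: "dist x x\<^sub>0 < min (min d d') 1" "dist t t\<^sub>0 < min (min d d') 1"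
      using dist_fst_le[of p "(x\<^sub>0, t\<^sub>0)"] dist_snd_le[of p "(x\<^sub>0, t\<^sub>0)"] p(2) by (auto simp: pe qe)
    have "norm (f x t - f x\<^sub>0 t) \<le> e / 4"
      by (rule d(2)) (use 1 p(1) in \<open>auto simp: pe dist_real_def\<close>)
    moreover have "dist (f x\<^sub>0 t) (f x\<^sub>0 t\<^sub>0) < e / 4"
      by (rule d'(2)) (use 1 p(1) in \<open>auto simp: pe\<close>)
    ultimately show "dist (case p of (x, t) \<Rightarrow> f x t) (case q of (x, t) \<Rightarrow> f x t) < e"
      using dist_triangle[of "f x t" "f x\<^sub>0 t\<^sub>0" "f x\<^sub>0 t"] e by (simp add: pe qe dist_norm)
  qed (use d d' in auto)
qed

lemma exponential_cauchy_limit: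
  fixes f :: "real \<Rightarrow> 'b::banach"
  assumes bnd: "\<And>s t. 0 \<le> s \<Longrightarrow> s \<le> t \<Longrightarrow> norm (f t - f s) \<le> c * exp (- \<mu> * s)" and "0 < \<mu>" "0 \<le> s"
  shows "norm (lim (\<lambda>n. f (real n)) - f s) \<le> c * exp (- \<mu> * s)"
    and "(f \<longlongrightarrow> lim (\<lambda>n. f (real n))) at_top"
proof -
  have "Cauchy (\<lambda>n. f (real n))"
  proof (rule metric_CauchyI)
    fix e :: real assume "0 < e"
    obtain T where T: "0 \<le> T" "\<And>t. T \<le> t \<Longrightarrow> c * exp (- \<mu> * t) < e / 2"
      by (rule exp_decay_small[OF \<open>0 < \<mu>\<close>, of "e / 2"]) (use \<open>0 < e\<close> that in auto)
    define N where "N = nat \<lceil>T\<rceil>"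
    have N: "T \<le> real N" unfolding N_def by linarith
    have "dist (f (real m)) (f (real N)) < e / 2" if "N \<le> m" for m
      using bnd[of "real N" "real m"] T(2)[OF N] that by (simp add: dist_norm)
    then have "dist (f (real m)) (f (real n)) < e" if "N \<le> m" "N \<le> n" for m n
      using that by (meson dist_triangle_half_l)
    then show "\<exists>N. \<forall>m\<ge>N. \<forall>n\<ge>N. dist (f (real m)) (f (real n)) < e" by blast
  qed
  then have conv: "(\<lambda>n. f (real n)) \<longlonglongrightarrow> lim (\<lambda>n. f (real n))"
    by (simp add: Cauchy_convergent_iff convergent_LIMSEQ_iff)
  have le: "norm (lim (\<lambda>n. f (real n)) - f s) \<le> c * exp (- \<mu> * s)" if "0 \<le> s" for s
  proof (rule tendsto_upperbound)
    show "(\<lambda>n. norm (f (real n) - f s)) \<longlonglongrightarrow> norm (lim (\<lambda>n. f (real n)) - f s)"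
      by (intro tendsto_intros conv)
    have "\<forall>\<^sub>F n in sequentially. s \<le> real n"
      using filterlim_real_sequentially unfolding filterlim_at_top by blast
    then show "\<forall>\<^sub>F n in sequentially. norm (f (real n) - f s) \<le> c * exp (- \<mu> * s)"
      by eventually_elim (use bnd that in auto)
  qed simp
  then show "norm (lim (\<lambda>n. f (real n)) - f s) \<le> c * exp (- \<mu> * s)" using \<open>0 \<le> s\<close> by blast
  have "((\<lambda>t. f t - lim (\<lambda>n. f (real n))) \<longlongrightarrow> 0) at_top"
  proof (rule Lim_null_comparison)
    show "\<forall>\<^sub>F t in at_top. norm (f t - lim (\<lambda>n. f (real n))) \<le> c * exp (- \<mu> * t)"
      using eventually_ge_at_top[of 0] by eventually_elim (use le in \<open>simp add: norm_minus_commute\<close>)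
  qed (rule exp_decay_tendsto[OF \<open>0 < \<mu>\<close>])
  then show "(f \<longlongrightarrow> lim (\<lambda>n. f (real n))) at_top" by (simp add: LIM_zero_iff)
qed

section \<open>Dependence on the initial point, uniformly in time\<close>

context stable_flow
begin

text \<open>Neighbouring trajectories contract towards each other, so the dependence on the initial
  point is uniform over all of \<open>{0..}\<close> and not merely on bounded time intervals. The
  compact set is fixed before the distance \<open>d\<close>.\<close>

lemma X_stays_close:
  assumes x0: "x\<^sub>0 \<in> \<Omega>"
  obtains K where "compact K" "K \<subseteq> \<Omega>" "\<And>d. 0 < d \<Longrightarrow> \<exists>r>0. \<forall>x\<in>ball x\<^sub>0 r. x \<in> \<Omega> \<and>
    (\<forall>t\<ge>0. closed_segment (X x\<^sub>0 t) (X x t) \<subseteq> K \<and> norm (X x t - X x\<^sub>0 t) < d)"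
proof -
  obtain r C \<mu> K where dec: "locally_decaying x\<^sub>0 r C \<mu> K" using locally_decaying_exists[OF x0] by blast
  then have r: "0 < r" "0 < C" "0 < \<mu>" "ball x\<^sub>0 r \<subseteq> \<Omega>" "compact K" "K \<subseteq> \<Omega>" "x\<^sub>0 \<in> ball x\<^sub>0 r"
    by (auto simp: locally_decaying_def)
  have "\<exists>r>0. \<forall>x\<in>ball x\<^sub>0 r. x \<in> \<Omega> \<and>
    (\<forall>t\<ge>0. closed_segment (X x\<^sub>0 t) (X x t) \<subseteq> K \<and> norm (X x t - X x\<^sub>0 t) < d)" if d: "0 < d" for d
  proof (intro exI[of _ "min r (d / C)"] conjI ballI allI impI)
    show "0 < min r (d / C)" using d r by simp
    fix x assume x: "x \<in> ball x\<^sub>0 (min r (d / C))"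
    then have xr: "x \<in> ball x\<^sub>0 r" by simp
    then show "x \<in> \<Omega>" using r by blast
    fix t :: real assume t: "0 \<le> t"
    show "closed_segment (X x\<^sub>0 t) (X x t) \<subseteq> K"
      using dec xr r(7) t unfolding locally_decaying_def by blast
    have "norm (X x t - X x\<^sub>0 t) \<le> C * exp (- \<mu> * t) * norm (x - x\<^sub>0)"
      using dec xr r(7) t unfolding locally_decaying_def by blast
    also have "\<dots> \<le> C * 1 * norm (x - x\<^sub>0)"
      using r t by (intro mult_right_mono mult_left_mono) auto
    also have "\<dots> < d" using x r(2) by (simp add: dist_norm norm_minus_commute field_simps)
    finally show "norm (X x t - X x\<^sub>0 t) < d" .
  qed
  then show ?thesis using that r by blast
qed

lemma X_uniformly_close:
  fixes G :: "'a \<Rightarrow> 'c::metric_space"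
  assumes G: "continuous_on \<Omega> G" and x0: "x\<^sub>0 \<in> \<Omega>" and e: "0 < e"
  shows "\<exists>d>0. \<forall>x\<in>ball x\<^sub>0 d. x \<in> \<Omega> \<and> (\<forall>t\<ge>0. dist (G (X x t)) (G (X x\<^sub>0 t)) < e)"
proof -
  obtain K where K: "compact K" "K \<subseteq> \<Omega>" and close: "\<And>d. 0 < d \<Longrightarrow> \<exists>r>0. \<forall>x\<in>ball x\<^sub>0 r. x \<in> \<Omega> \<and>
    (\<forall>t\<ge>0. closed_segment (X x\<^sub>0 t) (X x t) \<subseteq> K \<and> norm (X x t - X x\<^sub>0 t) < d)"
    by (rule X_stays_close[OF x0]) (rule that)
  have "uniformly_continuous_on K G"
    by (rule compact_uniformly_continuous[OF continuous_on_subset[OF G K(2)] K(1)])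
  then obtain d where d: "0 < d" "\<And>y z. y \<in> K \<Longrightarrow> z \<in> K \<Longrightarrow> dist y z < d \<Longrightarrow> dist (G y) (G z) < e"
    using e unfolding uniformly_continuous_on_def by metis
  obtain r where r: "0 < r" "\<forall>x\<in>ball x\<^sub>0 r. x \<in> \<Omega> \<and>
    (\<forall>t\<ge>0. closed_segment (X x\<^sub>0 t) (X x t) \<subseteq> K \<and> norm (X x t - X x\<^sub>0 t) < d)"
    using close[OF d(1)] by blast
  have "dist (G (X x t)) (G (X x\<^sub>0 t)) < e" if "x \<in> ball x\<^sub>0 r" "0 \<le> t" for x t
  proof -
    have "closed_segment (X x\<^sub>0 t) (X x t) \<subseteq> K" "norm (X x t - X x\<^sub>0 t) < d" using r(2) that by blast+
    then show ?thesis using ends_in_segment by (intro d(2)) (auto simp: dist_norm)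
  qed
  then show ?thesis using r by blast
qed

text \<open>All segments between neighbouring trajectories lie in one compact set, on which the
  derivative is uniformly continuous. A single modulus therefore serves all times, as integration up
  to infinity requires.\<close>

lemma X_uniform_linearization:
  fixes G :: "'a \<Rightarrow> 'c::real_normed_vector"
  assumes G: "Ck_on (Suc 0) G \<Omega>" and x0: "x\<^sub>0 \<in> \<Omega>" and e: "0 < e"
  shows "\<exists>d>0. \<forall>x\<in>ball x\<^sub>0 d. \<forall>t\<ge>0.
    norm (G (X x t) - G (X x\<^sub>0 t) - bderiv G (X x\<^sub>0 t) (X x t - X x\<^sub>0 t)) \<le> e * norm (X x t - X x\<^sub>0 t)"
proof -
  obtain K where K: "compact K" "K \<subseteq> \<Omega>" and close: "\<And>d. 0 < d \<Longrightarrow> \<exists>r>0. \<forall>x\<in>ball x\<^sub>0 r. x \<in> \<Omega> \<and>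
    (\<forall>t\<ge>0. closed_segment (X x\<^sub>0 t) (X x t) \<subseteq> K \<and> norm (X x t - X x\<^sub>0 t) < d)"
    by (rule X_stays_close[OF x0]) (rule that)
  have "uniformly_continuous_on K (bderiv G)"
    by (rule compact_uniformly_continuous[OF
          continuous_on_subset[OF Ck_on_imp_continuous_on[OF Ck_on_bderiv[OF open_dom G]] K(2)] K(1)])
  then obtain d where d: "0 < d" "\<And>y z. y \<in> K \<Longrightarrow> z \<in> K \<Longrightarrow> dist y z < d \<Longrightarrow> dist (bderiv G y) (bderiv G z) < e"
    using e unfolding uniformly_continuous_on_def by metis
  obtain r where r: "0 < r" "\<forall>x\<in>ball x\<^sub>0 r. x \<in> \<Omega> \<and>
    (\<forall>t\<ge>0. closed_segment (X x\<^sub>0 t) (X x t) \<subseteq> K \<and> norm (X x t - X x\<^sub>0 t) < d)"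
    using close[OF d(1)] by blast
  show ?thesis
  proof (intro exI[of _ r] conjI ballI allI impI r(1))
    fix x and t :: real assume x: "x \<in> ball x\<^sub>0 r" and t: "0 \<le> t"
    let ?S = "closed_segment (X x\<^sub>0 t) (X x t)"
    have S: "?S \<subseteq> K" and small: "norm (X x t - X x\<^sub>0 t) < d" using r(2) x t by blast+
    have "norm (G (X x t) - G (X x\<^sub>0 t) - bderiv G (X x\<^sub>0 t) (X x t - X x\<^sub>0 t)) \<le> norm (X x t - X x\<^sub>0 t) * e"
    proof (rule differentiable_bound_linearization[where S = ?S])
      show "X x\<^sub>0 t + s *\<^sub>R (X x t - X x\<^sub>0 t) \<in> ?S" if "s \<in> {0..1}" for s
        using that by (auto simp: closed_segment_def algebra_simps intro!: exI[of _ s])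
      show "(G has_derivative bderiv G y) (at y within ?S)" if "y \<in> ?S" for y
        using has_derivative_bderiv[OF G] S K that by (blast intro: has_derivative_at_withinI)
      show "onorm (blinfun_apply (bderiv G y) - blinfun_apply (bderiv G (X x\<^sub>0 t))) \<le> e" if y: "y \<in> ?S" for y
      proof -
        have "norm (y - X x\<^sub>0 t) \<le> norm (X x t - X x\<^sub>0 t)"
          using segment_bound1[OF y] by (simp add: norm_minus_commute)
        then have "dist (bderiv G y) (bderiv G (X x\<^sub>0 t)) < e"
          using small S y by (intro d(2)) (auto simp: dist_norm)
        then show ?thesis by (simp add: dist_norm norm_blinfun.rep_eq minus_blinfun.rep_eq fun_diff_def)
      qed
    qed simp
    then show "norm (G (X x t) - G (X x\<^sub>0 t) - bderiv G (X x\<^sub>0 t) (X x t - X x\<^sub>0 t)) \<le> e * norm (X x t - X x\<^sub>0 t)"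
      by (simp add: mult.commute)
  qed
qed

lemma X_in_compact:
  assumes "x\<^sub>0 \<in> \<Omega>"
  obtains K d where "compact K" "K \<subseteq> \<Omega>" "0 < d" "ball x\<^sub>0 d \<subseteq> \<Omega>" "\<And>x t. x \<in> ball x\<^sub>0 d \<Longrightarrow> 0 \<le> t \<Longrightarrow> X x t \<in> K"
  using locally_decaying_exists[OF assms] unfolding locally_decaying_def by blast

lemma X_jointly_continuous: "continuous_on (\<Omega> \<times> {0..}) (\<lambda>(x, t). X x t)"
proof (rule joint_continuity)
  fix x\<^sub>0 and T e :: real assume "x\<^sub>0 \<in> \<Omega>" "0 < e"
  from X_uniformly_close[OF continuous_on_id this]
  obtain d where "0 < d" "\<And>x t. x \<in> ball x\<^sub>0 d \<Longrightarrow> 0 \<le> t \<Longrightarrow> dist (X x t) (X x\<^sub>0 t) < e" by auto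
  then show "\<exists>d>0. \<forall>x\<in>\<Omega>. dist x x\<^sub>0 < d \<longrightarrow> (\<forall>t\<in>{0..T}. norm (X x t - X x\<^sub>0 t) \<le> e)"
    by (intro exI[of _ d]) (auto simp: dist_norm norm_minus_commute intro!: less_imp_le)
qed (rule X_continuous)

lemma continuous_on_along:
  assumes "continuous_on \<Omega> G" "x \<in> \<Omega>"
  shows "continuous_on {0..} (\<lambda>t. G (X x t))"
  by (rule continuous_on_compose2[OF assms(1) X_continuous[OF assms(2)]]) (use X_in assms in auto)

section \<open>Propagators along trajectories\<close>

text \<open>At nonnegative times the pair is determined by its equations, but its existence is known
  only along trajectories in the domain; the choice makes \<open>Psi\<close> and \<open>Phi\<close>
  total functions of the initial point.\<close>

definition evolution :: "('a \<Rightarrow> 'e::banach \<Rightarrow>\<^sub>L 'e) \<Rightarrow> 'a \<Rightarrow> (real \<Rightarrow> 'e \<Rightarrow>\<^sub>L 'e) \<times> (real \<Rightarrow> 'e \<Rightarrow>\<^sub>L 'e)"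
  where "evolution a x = (SOME p. fundamental_pair (\<lambda>t. a (X x t)) (fst p) (snd p))"

definition Psi :: "('a \<Rightarrow> 'e::banach \<Rightarrow>\<^sub>L 'e) \<Rightarrow> 'a \<Rightarrow> real \<Rightarrow> 'e \<Rightarrow>\<^sub>L 'e"
  where "Psi a x = fst (evolution a x)"

definition Phi :: "('a \<Rightarrow> 'e::banach \<Rightarrow>\<^sub>L 'e) \<Rightarrow> 'a \<Rightarrow> real \<Rightarrow> 'e \<Rightarrow>\<^sub>L 'e"
  where "Phi a x = snd (evolution a x)"

lemma fundamental_pair_evolution:
  assumes a: "continuous_on \<Omega> a" and x: "x \<in> \<Omega>"
  shows "fundamental_pair (\<lambda>t. a (X x t)) (Psi a x) (Phi a x)"
proof -
  obtain K d where K: "compact K" "K \<subseteq> \<Omega>" "0 < d" "ball x d \<subseteq> \<Omega>"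
    "\<And>y t. y \<in> ball x d \<Longrightarrow> 0 \<le> t \<Longrightarrow> X y t \<in> K"
    by (rule X_in_compact[OF x]) (rule that)
  have "bounded (a ` K)"
    using K a by (intro compact_imp_bounded compact_continuous_image) (auto elim: continuous_on_subset)
  then obtain M where "\<And>y. y \<in> K \<Longrightarrow> norm (a y) \<le> M" unfolding bounded_iff by blast
  then have "\<exists>\<Psi> \<Phi>. fundamental_pair (\<lambda>t. a (X x t)) \<Psi> \<Phi>"
    using K(3) K(5)[of x] by (intro fundamental_pair_exists[of _ M] continuous_on_along a x) auto
  then have "\<exists>p. fundamental_pair (\<lambda>t. a (X x t)) (fst p) (snd p)" by auto
  then show ?thesis unfolding Psi_def Phi_def evolution_def by (rule someI_ex)
qed

lemma Phi_der: "continuous_on \<Omega> a \<Longrightarrow> x \<in> \<Omega> \<Longrightarrow> 0 \<le> t \<Longrightarrow>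
    (Phi a x has_vector_derivative - (Phi a x t o\<^sub>L a (X x t))) (at t within {0..})"
  and Psi_der: "continuous_on \<Omega> a \<Longrightarrow> x \<in> \<Omega> \<Longrightarrow> 0 \<le> t \<Longrightarrow>
    (Psi a x has_vector_derivative a (X x t) o\<^sub>L Psi a x t) (at t within {0..})"
  and Psi_Phi: "continuous_on \<Omega> a \<Longrightarrow> x \<in> \<Omega> \<Longrightarrow> 0 \<le> t \<Longrightarrow> Psi a x t o\<^sub>L Phi a x t = id_blinfun"
  and Phi_zero: "continuous_on \<Omega> a \<Longrightarrow> x \<in> \<Omega> \<Longrightarrow> Phi a x 0 = id_blinfun"
  and Psi_zero: "continuous_on \<Omega> a \<Longrightarrow> x \<in> \<Omega> \<Longrightarrow> Psi a x 0 = id_blinfun"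
  using fundamental_pair_evolution[of a x] by (auto simp: fundamental_pair_def)

text \<open>As functions of \<open>t\<close> both sides solve the adjoint equation along the
  trajectory from \<open>X x s\<close>, and they agree at \<open>t = 0\<close>.\<close>

lemma Phi_cocycle:
  assumes a: "continuous_on \<Omega> a" and x: "x \<in> \<Omega>" and "0 \<le> s" "0 \<le> t"
  shows "Phi a x (s + t) = Phi a x s o\<^sub>L Phi a (X x s) t"
proof -
  have "Phi a x (s + t) = Phi a x (s + 0) o\<^sub>L Phi a (X x s) t"
  proof (rule fundamental_pair_adjoint_solution[OF _ _ assms(4), where Z = "\<lambda>t. Phi a x (s + t)"])
    show "fundamental_pair (\<lambda>t. a (X (X x s) t)) (Psi a (X x s)) (Phi a (X x s))"
      by (rule fundamental_pair_evolution[OF a]) (use X_in x assms in auto)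
    show "((\<lambda>t. Phi a x (s + t)) has_vector_derivative - (Phi a x (s + t) o\<^sub>L a (X (X x s) t))) (at t within {0..})"
      if "0 \<le> t" for t
      using has_vector_derivative_shift[OF Phi_der[OF a x] assms(3) that] X_flow[OF x assms(3) that] by simp
  qed
  then show ?thesis by simp
qed

end

section \<open>Linear transport equations along the flow\<close>

context stable_flow
begin

text \<open>The bounds make the integral of \<open>Phi a x t (L (X x t))\<close> over infinite time
  converge, locally uniformly in the initial point. Of \<open>Phi\<close> itself only boundedness is
  asked, because it is the identity at the start of the induction, where
  \<open>a = 0\<close>.\<close>

definition stable_pair :: "('a \<Rightarrow> 'e::banach \<Rightarrow>\<^sub>L 'e) \<Rightarrow> ('a \<Rightarrow> 'e) \<Rightarrow> bool"
  where "stable_pair a L \<longleftrightarrow> (\<forall>x\<^sub>0\<in>\<Omega>. \<exists>r>0. \<exists>C>0. \<exists>\<mu>>0. \<forall>x\<in>ball x\<^sub>0 r \<inter> \<Omega>. \<forall>t\<ge>0.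
    norm (Phi a x t) \<le> C \<and> norm (Phi a x t (L (X x t))) \<le> C * exp (- \<mu> * t))"

lemma stable_pairE:
  assumes "stable_pair a L" "x\<^sub>0 \<in> \<Omega>"
  obtains r C \<mu> where "0 < r" "0 < C" "0 < \<mu>" "ball x\<^sub>0 r \<subseteq> \<Omega>"
    "\<And>x t. x \<in> ball x\<^sub>0 r \<Longrightarrow> 0 \<le> t \<Longrightarrow> norm (Phi a x t) \<le> C"
    "\<And>x t. x \<in> ball x\<^sub>0 r \<Longrightarrow> 0 \<le> t \<Longrightarrow> norm (Phi a x t (L (X x t))) \<le> C * exp (- \<mu> * t)"
proof -
  from assms(1)[unfolded stable_pair_def] assms(2)
  obtain r C \<mu> where r: "0 < r" "0 < C" "0 < \<mu>" and bnd: "\<forall>x\<in>ball x\<^sub>0 r \<inter> \<Omega>. \<forall>t\<ge>0.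
    norm (Phi a x t) \<le> C \<and> norm (Phi a x t (L (X x t))) \<le> C * exp (- \<mu> * t)" by blast
  obtain r' where r': "0 < r'" "ball x\<^sub>0 r' \<subseteq> \<Omega>"
    using open_dom assms(2) open_contains_ball by blast
  show ?thesis
    by (rule that[of "min r r'" C \<mu>]) (use r r' bnd in auto)
qed

text \<open>The product of \<open>Phi a x\<close> with the propagator at \<open>x\<^sub>0\<close>
  would be the identity for equal initial points; its time derivative contains only the difference
  of the two coefficients, which is small uniformly in time.\<close>

lemma Phi_jointly_continuous:
  assumes a: "continuous_on \<Omega> a" and st: "stable_pair a L"
  shows "continuous_on (\<Omega> \<times> {0..}) (\<lambda>(x, t). Phi a x t)"
proof (rule joint_continuity)
  show "continuous_on {0..} (Phi a x)" if "x \<in> \<Omega>" for x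
    by (rule fundamental_pair_continuous(2)[OF fundamental_pair_evolution[OF a that]])
next
  fix x\<^sub>0 and T e :: real assume x0: "x\<^sub>0 \<in> \<Omega>" and T: "0 \<le> T" and e: "0 < e"
  obtain r C \<mu> where r: "0 < r" "0 < C" "0 < \<mu>" "ball x\<^sub>0 r \<subseteq> \<Omega>"
    "\<And>x t. x \<in> ball x\<^sub>0 r \<Longrightarrow> 0 \<le> t \<Longrightarrow> norm (Phi a x t) \<le> C"
    "\<And>x t. x \<in> ball x\<^sub>0 r \<Longrightarrow> 0 \<le> t \<Longrightarrow> norm (Phi a x t (L (X x t))) \<le> C * exp (- \<mu> * t)"
    by (rule stable_pairE[OF st x0]) (rule that)
  have "continuous_on {0..T} (Psi a x\<^sub>0)"
    using fundamental_pair_continuous(1)[OF fundamental_pair_evolution[OF a x0]]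
    by (rule continuous_on_subset) auto
  then have "bounded (Psi a x\<^sub>0 ` {0..T})"
    by (intro compact_imp_bounded compact_continuous_image) auto
  then obtain M where M: "0 < M" "\<And>t. t \<in> {0..T} \<Longrightarrow> norm (Psi a x\<^sub>0 t) \<le> M"
    unfolding bounded_pos by blast
  \<comment> \<open>The divisor collects the bound on \<open>Phi\<close> (used twice), the bound on
    \<open>Psi\<close> and the length of the time interval.\<close>
  define k where "k = e / (C * C * M * (T + 1))"
  have k: "0 < k" using e r M T by (simp add: k_def)
  obtain d where d: "0 < d" "\<And>x t. x \<in> ball x\<^sub>0 d \<Longrightarrow> 0 \<le> t \<Longrightarrow> dist (a (X x t)) (a (X x\<^sub>0 t)) < k"
    using X_uniformly_close[OF a x0 k] by blast
  show "\<exists>d>0. \<forall>x\<in>\<Omega>. dist x x\<^sub>0 < d \<longrightarrow> (\<forall>t\<in>{0..T}. norm (Phi a x t - Phi a x\<^sub>0 t) \<le> e)"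
  proof (intro exI[of _ "min r d"] conjI ballI impI)
    show "0 < min r d" using r d by simp
    fix x t assume x: "x \<in> \<Omega>" "dist x x\<^sub>0 < min r d" and t: "t \<in> {0..T}"
    have xr: "x \<in> ball x\<^sub>0 r" "x \<in> ball x\<^sub>0 d" "x\<^sub>0 \<in> ball x\<^sub>0 r" using x r by (auto simp: dist_commute)
    let ?Q = "\<lambda>t. Phi a x t o\<^sub>L Psi a x\<^sub>0 t"
    have "norm (?Q t - ?Q 0) \<le> C * k * M * t - C * k * M * 0"
    proof (rule vector_derivative_norm_le[where f = ?Q and T = T])
      fix s assume s: "0 \<le> s" "s \<le> T"
      let ?q = "(Phi a x s o\<^sub>L (a (X x\<^sub>0 s) o\<^sub>L Psi a x\<^sub>0 s)) + (- (Phi a x s o\<^sub>L a (X x s)) o\<^sub>L Psi a x\<^sub>0 s)"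
      show "(?Q has_vector_derivative ?q) (at s within {0..T})"
        by (rule has_vector_derivative_within_subset[OF compose_has_vector_derivative[OF Phi_der Psi_der]])
          (use a x x0 s in auto)
      show "((\<lambda>t. C * k * M * t) has_real_derivative C * k * M) (at s within {0..T})"
        by (auto intro!: derivative_eq_intros)
      have "?q = Phi a x s o\<^sub>L (a (X x\<^sub>0 s) - a (X x s)) o\<^sub>L Psi a x\<^sub>0 s"
        by (rule blinfun_eqI) (simp add: blinfun.bilinear_simps)
      then have "norm ?q \<le> norm (Phi a x s) * norm (a (X x\<^sub>0 s) - a (X x s)) * norm (Psi a x\<^sub>0 s)"
        by (simp only:) (rule order_trans[OF norm_blinfun_compose mult_right_mono[OF norm_blinfun_compose norm_ge_zero]])
      also have "\<dots> \<le> C * k * M"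
        using r(5)[OF xr(1) s(1)] d(2)[OF xr(2) s(1)] M(2)[of s] s r(2) k
        by (intro mult_mono) (auto simp: dist_norm norm_minus_commute)
      finally show "norm ?q \<le> C * k * M" .
    qed (use t in auto)
    then have Q: "norm (?Q t - id_blinfun) \<le> C * k * M * t"
      by (simp add: Phi_zero[OF a x(1)] Psi_zero[OF a x0])
    have "Phi a x t - Phi a x\<^sub>0 t = (?Q t - id_blinfun) o\<^sub>L Phi a x\<^sub>0 t"
      using Psi_Phi[OF a x0, of t] t by (simp add: blinfun_compose.diff_left blinfun_compose_assoc)
    then have "norm (Phi a x t - Phi a x\<^sub>0 t) \<le> norm (?Q t - id_blinfun) * norm (Phi a x\<^sub>0 t)"
      by (simp add: norm_blinfun_compose)
    also have "\<dots> \<le> (C * k * M * (T + 1)) * C"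
    proof (rule mult_mono)
      have "C * k * M * t \<le> C * k * M * (T + 1)" using t r(2) k M(1) by (intro mult_left_mono) auto
      with Q show "norm (?Q t - id_blinfun) \<le> C * k * M * (T + 1)" by simp
      show "norm (Phi a x\<^sub>0 t) \<le> C" using r(5)[OF xr(3)] t by auto
    qed (use r k M T in auto)
    also have "\<dots> = e" using r(2) M(1) T by (simp add: k_def)
    finally show "norm (Phi a x t - Phi a x\<^sub>0 t) \<le> e" .
  qed
qed

definition integrand :: "('a \<Rightarrow> 'e::banach \<Rightarrow>\<^sub>L 'e) \<Rightarrow> ('a \<Rightarrow> 'e) \<Rightarrow> 'a \<Rightarrow> real \<Rightarrow> 'e"
  where "integrand a L x t = Phi a x t (L (X x t))"

text \<open>Variation of constants without a contribution from infinity: the solution of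
  \<open>dw F = a w - L\<close> along trajectories. For \<open>a = 0\<close> it is the accumulated
  cost \<open>L\<close>. The limit runs over integers; \<open>transport_limit\<close> extends it to
  real times.\<close>

definition transport :: "('a \<Rightarrow> 'e::banach \<Rightarrow>\<^sub>L 'e) \<Rightarrow> ('a \<Rightarrow> 'e) \<Rightarrow> 'a \<Rightarrow> 'e"
  where "transport a L x = lim (\<lambda>n. integral {0..real n} (integrand a L x))"

context
  fixes a :: "'a \<Rightarrow> 'e::banach \<Rightarrow>\<^sub>L 'e" and L :: "'a \<Rightarrow> 'e"
  assumes a: "continuous_on \<Omega> a" and L: "continuous_on \<Omega> L" and st: "stable_pair a L"
begin

lemma integrand_jointly_continuous: "continuous_on (\<Omega> \<times> {0..}) (\<lambda>(x, t). integrand a L x t)"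
proof -
  have "continuous_on (\<Omega> \<times> {0..}) (\<lambda>p. L (case p of (x, t) \<Rightarrow> X x t))"
    by (rule continuous_on_compose2[OF L X_jointly_continuous]) (use X_in in auto)
  from blinfun.continuous_on[OF Phi_jointly_continuous[OF a st] this]
  show ?thesis by (simp add: split_beta integrand_def)
qed

lemma integrand_continuous: "x \<in> \<Omega> \<Longrightarrow> continuous_on {0..} (integrand a L x)"
  using continuous_on_compose2[OF integrand_jointly_continuous, of "{0..}" "\<lambda>t. (x, t)"]
  by (auto simp: continuous_on_Pair)

lemma integral_integrand_der:
  "x \<in> \<Omega> \<Longrightarrow> 0 \<le> t \<Longrightarrow>
    ((\<lambda>t. integral {0..t} (integrand a L x)) has_vector_derivative integrand a L x t) (at t within {0..})"
  by (rule integral_has_vector_derivative_atLeast[OF integrand_continuous])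

lemma transport_tail:
  assumes "x\<^sub>0 \<in> \<Omega>"
  obtains r c \<mu> where "0 < r" "0 < c" "0 < \<mu>" "ball x\<^sub>0 r \<subseteq> \<Omega>"
    "\<And>x s. x \<in> ball x\<^sub>0 r \<Longrightarrow> 0 \<le> s \<Longrightarrow>
      norm (transport a L x - integral {0..s} (integrand a L x)) \<le> c * exp (- \<mu> * s)"
    "\<And>x. x \<in> ball x\<^sub>0 r \<Longrightarrow> ((\<lambda>s. integral {0..s} (integrand a L x)) \<longlongrightarrow> transport a L x) at_top"
proof -
  obtain r C \<mu> where r: "0 < r" "0 < C" "0 < \<mu>" "ball x\<^sub>0 r \<subseteq> \<Omega>"
    and "\<And>x t. x \<in> ball x\<^sub>0 r \<Longrightarrow> 0 \<le> t \<Longrightarrow> norm (Phi a x t) \<le> C"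
    and bnd: "\<And>x t. x \<in> ball x\<^sub>0 r \<Longrightarrow> 0 \<le> t \<Longrightarrow> norm (Phi a x t (L (X x t))) \<le> C * exp (- \<mu> * t)"
    by (rule stable_pairE[OF st assms]) (rule that)
  have tail: "norm (integral {0..t} (integrand a L x) - integral {0..s} (integrand a L x)) \<le> C / \<mu> * exp (- \<mu> * s)"
    if "x \<in> ball x\<^sub>0 r" "0 \<le> s" "s \<le> t" for x s t
  proof -
    have "norm (integral {0..t} (integrand a L x) - integral {0..s} (integrand a L x))
      \<le> C / (- \<mu>) * exp (- \<mu> * t) - C / (- \<mu>) * exp (- \<mu> * s)"
      using r that bnd
      by (intro exp_derivative_norm_le[where f' = "integrand a L x"] integral_integrand_der)
        (auto simp: integrand_def)
    also have "\<dots> \<le> C / \<mu> * exp (- \<mu> * s)" using r by simp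
    finally show ?thesis .
  qed
  show ?thesis
  proof (rule that[of r "C / \<mu>" \<mu>])
    show "0 < C / \<mu>" using r by simp
    show "norm (transport a L x - integral {0..s} (integrand a L x)) \<le> C / \<mu> * exp (- \<mu> * s)"
      if "x \<in> ball x\<^sub>0 r" "0 \<le> s" for x s
      unfolding transport_def by (rule exponential_cauchy_limit(1)[OF tail[OF that(1)] r(3) that(2)])
    show "((\<lambda>s. integral {0..s} (integrand a L x)) \<longlongrightarrow> transport a L x) at_top" if "x \<in> ball x\<^sub>0 r" for x
      unfolding transport_def by (rule exponential_cauchy_limit(2)[OF tail[OF that] r(3) order_refl])
  qed (use r in auto)
qed

lemma transport_limit:
  assumes "x \<in> \<Omega>"
  shows "((\<lambda>s. integral {0..s} (integrand a L x)) \<longlongrightarrow> transport a L x) at_top"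
proof -
  obtain r c \<mu> where "0 < r" "0 < c" "0 < \<mu>" "ball x r \<subseteq> \<Omega>"
    "\<And>y s. y \<in> ball x r \<Longrightarrow> 0 \<le> s \<Longrightarrow>
      norm (transport a L y - integral {0..s} (integrand a L y)) \<le> c * exp (- \<mu> * s)"
    "\<And>y. y \<in> ball x r \<Longrightarrow> ((\<lambda>s. integral {0..s} (integrand a L y)) \<longlongrightarrow> transport a L y) at_top"
    by (rule transport_tail[OF assms]) (rule that)
  then show ?thesis by simp
qed

text \<open>Integrals over a bounded time interval depend continuously on the initial point, and the
  tails are small uniformly near it.\<close>

lemma continuous_on_transport: "continuous_on \<Omega> (transport a L)"
  unfolding continuous_on_iff
proof (intro ballI allI impI)
  fix x\<^sub>0 and e :: real assume x0: "x\<^sub>0 \<in> \<Omega>" and e: "0 < e"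
  obtain r c \<mu> where r: "0 < r" "0 < c" "0 < \<mu>" "ball x\<^sub>0 r \<subseteq> \<Omega>"
    and tail: "\<And>x s. x \<in> ball x\<^sub>0 r \<Longrightarrow> 0 \<le> s \<Longrightarrow>
      norm (transport a L x - integral {0..s} (integrand a L x)) \<le> c * exp (- \<mu> * s)"
    and "\<And>x. x \<in> ball x\<^sub>0 r \<Longrightarrow> ((\<lambda>s. integral {0..s} (integrand a L x)) \<longlongrightarrow> transport a L x) at_top"
    by (rule transport_tail[OF x0]) (rule that)
  obtain s where s0: "0 \<le> s" "\<And>t. s \<le> t \<Longrightarrow> c * exp (- \<mu> * t) < e / 3"
    by (rule exp_decay_small[OF r(3), of "e / 3" c]) (use e that in auto)
  have s: "0 \<le> s" "c * exp (- \<mu> * s) < e / 3" using s0 by auto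
  have "continuous_on \<Omega> (\<lambda>x. integral (cbox 0 s) (integrand a L x))"
    by (rule integral_continuous_on_param, rule continuous_on_subset[OF integrand_jointly_continuous])
      (use s in auto)
  then have "continuous_on \<Omega> (\<lambda>x. integral {0..s} (integrand a L x))" by simp
  from this[unfolded continuous_on_iff, rule_format, OF x0, of "e / 3"] e
  obtain d where d: "0 < d" "\<And>x. x \<in> \<Omega> \<Longrightarrow> dist x x\<^sub>0 < d \<Longrightarrow>
      dist (integral {0..s} (integrand a L x)) (integral {0..s} (integrand a L x\<^sub>0)) < e / 3"
    by auto
  show "\<exists>d>0. \<forall>x\<in>\<Omega>. dist x x\<^sub>0 < d \<longrightarrow> dist (transport a L x) (transport a L x\<^sub>0) < e"
  proof (intro exI[of _ "min d r"] conjI ballI impI)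
    fix x assume x: "x \<in> \<Omega>" "dist x x\<^sub>0 < min d r"
    let ?I = "\<lambda>x. integral {0..s} (integrand a L x)"
    have "dist (transport a L x) (?I x) < e / 3" "dist (transport a L x\<^sub>0) (?I x\<^sub>0) < e / 3"
      using tail[of x s] tail[of x\<^sub>0 s] x s r(1) by (auto simp: dist_norm norm_minus_commute)
    moreover have "dist (?I x) (?I x\<^sub>0) < e / 3" using d(2) x by simp
    ultimately show "dist (transport a L x) (transport a L x\<^sub>0) < e"
      using dist_triangle[of "transport a L x" "transport a L x\<^sub>0" "?I x"]
        dist_triangle[of "?I x" "transport a L x\<^sub>0" "?I x\<^sub>0"]
      by (simp add: dist_commute)
  qed (use d r in auto)
qed

text \<open>The dynamic programming principle: the integral is split at time \<open>s\<close>, and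
  the cocycle law identifies the remainder with the transport from \<open>X x s\<close>.\<close>

lemma transport_flow:
  assumes x: "x \<in> \<Omega>" and s: "0 \<le> s"
  shows "transport a L x = integral {0..s} (integrand a L x) + Phi a x s (transport a L (X x s))"
proof -
  let ?I = "\<lambda>x t. integral {0..t} (integrand a L x)"
  have xs: "X x s \<in> \<Omega>" by (rule X_in[OF x s])
  have cocycle: "Phi a x s (integrand a L (X x s) t) = integrand a L x (s + t)" if "0 \<le> t" for t
    by (simp add: integrand_def Phi_cocycle[OF a x s that] X_flow[OF x s that])
  have "?I x (s + t) - Phi a x s (?I (X x s) t) = ?I x (s + 0) - Phi a x s (?I (X x s) 0)" if "0 \<le> t" for t
  proof (rule has_vector_derivative_zero_const[OF _ that, where f = "\<lambda>t. ?I x (s + t) - Phi a x s (?I (X x s) t)"])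
    fix t :: real assume t: "0 \<le> t"
    show "((\<lambda>t. ?I x (s + t) - Phi a x s (?I (X x s) t)) has_vector_derivative 0) (at t within {0..})"
      using has_vector_derivative_diff[OF
          has_vector_derivative_shift[OF integral_integrand_der[OF x] s t]
          bounded_linear.has_vector_derivative[OF blinfun.bounded_linear_right integral_integrand_der[OF xs t]], of "Phi a x s"]
      by (simp add: cocycle[OF t])
  qed
  then have eq: "?I x (s + t) = ?I x s + Phi a x s (?I (X x s) t)" if "0 \<le> t" for t
    using that by (simp add: blinfun.zero_right diff_eq_eq)
  have "((\<lambda>t. ?I x (s + t)) \<longlongrightarrow> transport a L x) at_top"
    by (rule filterlim_compose[OF transport_limit[OF x] filterlim_tendsto_add_at_top[OF tendsto_const filterlim_ident]])
  moreover have "((\<lambda>t. ?I x s + Phi a x s (?I (X x s) t)) \<longlongrightarrow> ?I x s + Phi a x s (transport a L (X x s))) at_top"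
    by (intro tendsto_add tendsto_const bounded_linear.tendsto[OF blinfun.bounded_linear_right] transport_limit xs)
  then have "((\<lambda>t. ?I x (s + t)) \<longlongrightarrow> ?I x s + Phi a x s (transport a L (X x s))) at_top"
    by (rule Lim_transform_eventually) (use eventually_ge_at_top[of 0] in eventually_elim, simp add: eq)
  ultimately show ?thesis
    by (rule tendsto_unique[OF trivial_limit_at_top_linorder])
qed

text \<open>At this stage the transport is only known to be continuous in space. Along a trajectory
  it is nevertheless differentiable, because \<open>transport_flow\<close>, solved for the value at
  \<open>X x s\<close>, expresses it through a propagator and an integral.\<close>

lemma transport_along_flow:
  assumes x: "x \<in> \<Omega>" and s: "0 \<le> s"
  shows "((\<lambda>s. transport a L (X x s)) has_vector_derivative
    a (X x s) (transport a L (X x s)) - L (X x s)) (at s within {0..})"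
proof -
  let ?I = "\<lambda>t. integral {0..t} (integrand a L x)"
  have eq: "transport a L (X x t) = Psi a x t (transport a L x - ?I t)" if "t \<in> {0..}" for t
  proof -
    have "transport a L x - ?I t = Phi a x t (transport a L (X x t))"
      using transport_flow[OF x, of t] that by simp
    then have "Psi a x t (transport a L x - ?I t) = (Psi a x t o\<^sub>L Phi a x t) (transport a L (X x t))"
      by (simp only: blinfun_apply_blinfun_compose)
    also have "\<dots> = transport a L (X x t)"
      unfolding Psi_Phi[OF a x that[simplified]] by simp
    finally show ?thesis by simp
  qed
  have "((\<lambda>t. Psi a x t (transport a L x - ?I t)) has_vector_derivative
      Psi a x s (0 - integrand a L x s) + (a (X x s) o\<^sub>L Psi a x s) (transport a L x - ?I s)) (at s within {0..})"
    by (intro apply_has_vector_derivative has_vector_derivative_diff has_vector_derivative_const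
        integral_integrand_der Psi_der a x s)
  moreover have "Psi a x s (integrand a L x s) = L (X x s)"
    using Psi_Phi[OF a x s] blinfun_apply_blinfun_compose[of "Psi a x s" "Phi a x s" "L (X x s)"]
    by (simp add: integrand_def)
  ultimately have "((\<lambda>t. Psi a x t (transport a L x - ?I t)) has_vector_derivative
      a (X x s) (transport a L (X x s)) - L (X x s)) (at s within {0..})"
    using eq[of s] s by (simp add: blinfun.minus_right)
  then show ?thesis
    by (rule has_vector_derivative_transform[rotated 2]) (use eq s in auto)
qed

end

section \<open>The transport equation of the derivative\<close>

context
  fixes J :: "'e::banach \<Rightarrow>\<^sub>L ('a \<Rightarrow>\<^sub>L 'e)" and K :: "('a \<Rightarrow>\<^sub>L 'e) \<Rightarrow>\<^sub>L 'e"
  assumes JK: "\<And>A. J (K A) = A" and KJ: "\<And>e. K (J e) = e"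
begin

text \<open>
  Differentiating the transport equation of \<open>(a, L)\<close> shows that the derivative of its solution again
  solves a transport equation. \<open>J\<close> and \<open>K\<close> identify derivatives with elements of the same Banach
  space, so that this step can be iterated.
\<close>

definition lift_coeff :: "('a \<Rightarrow> 'e \<Rightarrow>\<^sub>L 'e) \<Rightarrow> 'a \<Rightarrow> 'e \<Rightarrow>\<^sub>L 'e"
  where "lift_coeff a x =
    K o\<^sub>L (blinfun_compose.prod_right (a x) - blinfun_compose.prod_left (bderiv F x)) o\<^sub>L J"

text \<open>Differentiating \<open>dw F = a w - L\<close> in space produces terms with
  \<open>dw\<close>, which form \<open>lift_coeff\<close>, and terms free of it, collected here. The
  subtracted one sends \<open>y\<close> to the derivative of \<open>a\<close> in direction
  \<open>y\<close>, applied to \<open>w\<close>.\<close>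

definition lift_source :: "('a \<Rightarrow> 'e \<Rightarrow>\<^sub>L 'e) \<Rightarrow> ('a \<Rightarrow> 'e) \<Rightarrow> 'a \<Rightarrow> 'e"
  where "lift_source a L x = K (bderiv L x - (blinfun.prod_left (transport a L x) o\<^sub>L bderiv a x))"

lemma bounded_linear_conjugation: "bounded_linear (\<lambda>A. K o\<^sub>L A o\<^sub>L J)"
  by (rule bounded_linear_compose[OF blinfun_compose.bounded_linear_left blinfun_compose.bounded_linear_right])

lemma Ck_on_lift_coeff:
  assumes "Ck_on k a \<Omega>"
  shows "Ck_on k (lift_coeff a) \<Omega>"
proof -
  have "Ck_on k (\<lambda>x. blinfun_compose.prod_right (a x) - blinfun_compose.prod_left (bderiv F x) ::
      ('a \<Rightarrow>\<^sub>L 'e) \<Rightarrow>\<^sub>L ('a \<Rightarrow>\<^sub>L 'e)) \<Omega>"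
    using smooth_onD[OF smooth_on_bderiv[OF open_dom F_smooth]] assms
    by (intro Ck_on_diff open_dom Ck_on_bounded_linear[OF blinfun_compose.bounded_linear_prod_right]
        Ck_on_bounded_linear[OF blinfun_compose.bounded_linear_prod_left])
  from Ck_on_bounded_linear[OF bounded_linear_conjugation open_dom this]
  show ?thesis by (simp add: lift_coeff_def[abs_def])
qed

lemma Ck_on_lift_source:
  assumes "Ck_on (Suc k) a \<Omega>" "Ck_on (Suc k) L \<Omega>" "Ck_on k (transport a L) \<Omega>"
  shows "Ck_on k (lift_source a L) \<Omega>"
  unfolding lift_source_def[abs_def]
  by (intro Ck_on_bounded_linear[OF blinfun.bounded_linear_right] open_dom Ck_on_diff
      Ck_on_bderiv assms Ck_on_bilinear[OF bounded_bilinear_blinfun_compose]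
      Ck_on_bounded_linear[OF blinfun.bounded_linear_prod_left])

text \<open>Left and right multiplication commute, so the propagator splits into a factor for
  \<open>a\<close> on the left and one for the linearized flow on the right. The right factor is the
  forward propagator \<open>Psi\<close>, because of the minus sign in
  \<open>lift_coeff\<close>.\<close>

lemma Phi_lift_coeff:
  assumes a: "continuous_on \<Omega> a" and x: "x \<in> \<Omega>" and t: "0 \<le> t"
  shows "Phi (lift_coeff a) x t e = K (Phi a x t o\<^sub>L J e o\<^sub>L Psi (bderiv F) x t)"
proof -
  have la: "continuous_on \<Omega> (lift_coeff a)"
    using Ck_on_lift_coeff[of 0 a] a by simp
  define Z where "Z = (\<lambda>t. K o\<^sub>L (blinfun_compose.prod_right (Phi a x t) o\<^sub>L
      blinfun_compose.prod_left (Psi (bderiv F) x t)) o\<^sub>L J)"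
  have "Z t = Z 0 o\<^sub>L Phi (lift_coeff a) x t"
  proof (rule fundamental_pair_adjoint_solution[OF fundamental_pair_evolution[OF la x] _ t])
    fix t :: real assume t: "0 \<le> t"
    have 1: "((\<lambda>t. blinfun_compose.prod_right (Phi a x t) :: ('a \<Rightarrow>\<^sub>L 'e) \<Rightarrow>\<^sub>L ('a \<Rightarrow>\<^sub>L 'e)) has_vector_derivative
        blinfun_compose.prod_right (- (Phi a x t o\<^sub>L a (X x t)))) (at t within {0..})"
      by (rule bounded_linear.has_vector_derivative[OF blinfun_compose.bounded_linear_prod_right Phi_der[OF a x t]])
    have 2: "((\<lambda>t. blinfun_compose.prod_left (Psi (bderiv F) x t) :: ('a \<Rightarrow>\<^sub>L 'e) \<Rightarrow>\<^sub>L ('a \<Rightarrow>\<^sub>L 'e)) has_vector_derivative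
        blinfun_compose.prod_left (bderiv F (X x t) o\<^sub>L Psi (bderiv F) x t)) (at t within {0..})"
      by (rule bounded_linear.has_vector_derivative[OF blinfun_compose.bounded_linear_prod_left
            Psi_der[OF continuous_on_bderiv_F x t]])
    from bounded_linear.has_vector_derivative[OF bounded_linear_conjugation compose_has_vector_derivative[OF 1 2]]
    have "(Z has_vector_derivative K o\<^sub>L
      ((blinfun_compose.prod_right (Phi a x t) o\<^sub>L blinfun_compose.prod_left (bderiv F (X x t) o\<^sub>L Psi (bderiv F) x t)) +
       (blinfun_compose.prod_right (- (Phi a x t o\<^sub>L a (X x t))) o\<^sub>L blinfun_compose.prod_left (Psi (bderiv F) x t)))
      o\<^sub>L J) (at t within {0..})"
      by (simp add: Z_def)
    moreover have "K o\<^sub>L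
      ((blinfun_compose.prod_right (Phi a x t) o\<^sub>L blinfun_compose.prod_left (bderiv F (X x t) o\<^sub>L Psi (bderiv F) x t)) +
       (blinfun_compose.prod_right (- (Phi a x t o\<^sub>L a (X x t))) o\<^sub>L blinfun_compose.prod_left (Psi (bderiv F) x t)))
      o\<^sub>L J = - (Z t o\<^sub>L lift_coeff a (X x t))"
    proof (rule blinfun_eqI)
      fix e
      have "(Phi a x t o\<^sub>L (J e o\<^sub>L (bderiv F (X x t) o\<^sub>L Psi (bderiv F) x t))) +
          (- (Phi a x t o\<^sub>L a (X x t)) o\<^sub>L (J e o\<^sub>L Psi (bderiv F) x t))
        = - (Phi a x t o\<^sub>L ((a (X x t) o\<^sub>L J e) - (J e o\<^sub>L bderiv F (X x t))) o\<^sub>L Psi (bderiv F) x t)"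
        by (rule blinfun_eqI) (simp add: blinfun.bilinear_simps)
      then show "(K o\<^sub>L
      ((blinfun_compose.prod_right (Phi a x t) o\<^sub>L blinfun_compose.prod_left (bderiv F (X x t) o\<^sub>L Psi (bderiv F) x t)) +
       (blinfun_compose.prod_right (- (Phi a x t o\<^sub>L a (X x t))) o\<^sub>L blinfun_compose.prod_left (Psi (bderiv F) x t)))
      o\<^sub>L J) e = (- (Z t o\<^sub>L lift_coeff a (X x t))) e"
        by (simp add: Z_def lift_coeff_def blinfun.add_left blinfun.diff_left blinfun.minus_left JK
            blinfun_compose_assoc flip: blinfun.minus_right)
    qed
    ultimately show "(Z has_vector_derivative - (Z t o\<^sub>L lift_coeff a (X x t))) (at t within {0..})"
      by simp
  qed
  moreover have "Z 0 = id_blinfun"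
    by (rule blinfun_eqI) (simp add: Z_def Phi_zero[OF a x] Psi_zero[OF continuous_on_bderiv_F x] KJ)
  ultimately have "Phi (lift_coeff a) x t e = Z t e" by simp
  then show ?thesis by (simp add: Z_def blinfun_compose_assoc)
qed

text \<open>By \<open>Phi_lift_coeff\<close>, \<open>Phi\<close> of the lifted coefficient is a
  bounded factor times the exponentially decaying propagator of \<open>bderiv F\<close>. It decays
  by itself, so \<open>L'\<close> may be any continuous source, and the induction never has to show
  that a lifted source vanishes at \<open>0\<close>.\<close>

lemma stable_pair_lift:
  assumes a: "continuous_on \<Omega> a" and L': "continuous_on \<Omega> L'" and st: "stable_pair a L"
  shows "stable_pair (lift_coeff a) L'"
  unfolding stable_pair_def
proof
  fix x\<^sub>0 assume x0: "x\<^sub>0 \<in> \<Omega>"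
  obtain r C \<mu> where r: "0 < r" "0 < C" "0 < \<mu>" "ball x\<^sub>0 r \<subseteq> \<Omega>"
    and Phi_le: "\<And>x t. x \<in> ball x\<^sub>0 r \<Longrightarrow> 0 \<le> t \<Longrightarrow> norm (Phi a x t) \<le> C"
    and "\<And>x t. x \<in> ball x\<^sub>0 r \<Longrightarrow> 0 \<le> t \<Longrightarrow> norm (Phi a x t (L (X x t))) \<le> C * exp (- \<mu> * t)"
    by (rule stable_pairE[OF st x0]) (rule that)
  obtain r' C' \<mu>' S where dec: "locally_decaying x\<^sub>0 r' C' \<mu>' S"
    using locally_decaying_exists[OF x0] by blast
  then have r': "0 < r'" "0 < C'" "0 < \<mu>'" "compact S" "S \<subseteq> \<Omega>" by (auto simp: locally_decaying_def)
  have Psi_le: "norm (Psi (bderiv F) x t) \<le> C' * exp (- \<mu>' * t)"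
    if x: "x \<in> ball x\<^sub>0 r'" and t: "0 \<le> t" for x t
  proof (rule norm_blinfun_bound)
    show "0 \<le> C' * exp (- \<mu>' * t)" using r' by simp
    fix y
    have xO: "x \<in> \<Omega>" using dec x by (auto simp: locally_decaying_def)
    have "((\<lambda>t. Psi (bderiv F) x t y) has_vector_derivative bderiv F (X x t) (Psi (bderiv F) x t y)) (at t within {0..})"
      if "0 \<le> t" for t
      using bounded_linear.has_vector_derivative[OF blinfun.bounded_linear_left
          Psi_der[OF continuous_on_bderiv_F xO that], of y] by simp
    then have "norm (Psi (bderiv F) x t y) \<le> C' * exp (- \<mu>' * t) * norm (Psi (bderiv F) x 0 y)"
      using dec x t unfolding locally_decaying_def by blast
    then show "norm (Psi (bderiv F) x t y) \<le> C' * exp (- \<mu>' * t) * norm y"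
      by (simp add: Psi_zero[OF continuous_on_bderiv_F xO])
  qed
  have "bounded (L' ` S)"
    using r' L' by (intro compact_imp_bounded compact_continuous_image) (auto elim: continuous_on_subset)
  then obtain M where M: "0 < M" "\<And>y. y \<in> S \<Longrightarrow> norm (L' y) \<le> M" unfolding bounded_pos by blast
  define Q where "Q = norm K * (C * norm J) * C'"
  have Q: "0 \<le> Q" using r r' by (simp add: Q_def)
  have bnd: "norm (Phi (lift_coeff a) x t e) \<le> Q * exp (- \<mu>' * t) * norm e"
    if x: "x \<in> ball x\<^sub>0 (min r r')" and t: "0 \<le> t" for x t e
  proof -
    have xO: "x \<in> \<Omega>" using x r by auto
    have "norm (Phi a x t o\<^sub>L J e o\<^sub>L Psi (bderiv F) x t) \<le> norm (Phi a x t) * norm (J e) * norm (Psi (bderiv F) x t)"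
      by (rule order_trans[OF norm_blinfun_compose mult_right_mono[OF norm_blinfun_compose norm_ge_zero]])
    also have "\<dots> \<le> C * (norm J * norm e) * (C' * exp (- \<mu>' * t))"
      using Phi_le[of x t] Psi_le[of x t] x t r r' norm_blinfun[of J e] by (intro mult_mono) auto
    finally have "norm K * norm (Phi a x t o\<^sub>L J e o\<^sub>L Psi (bderiv F) x t)
        \<le> norm K * (C * (norm J * norm e) * (C' * exp (- \<mu>' * t)))"
      by (rule mult_left_mono) simp
    also have "\<dots> = Q * exp (- \<mu>' * t) * norm e" by (simp add: Q_def)
    finally show ?thesis
      unfolding Phi_lift_coeff[OF a xO t] by (rule order_trans[OF norm_blinfun])
  qed
  have "\<forall>x\<in>ball x\<^sub>0 (min r r') \<inter> \<Omega>. \<forall>t\<ge>0. norm (Phi (lift_coeff a) x t) \<le> Q + Q * M + 1 \<and>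
      norm (Phi (lift_coeff a) x t (L' (X x t))) \<le> (Q + Q * M + 1) * exp (- \<mu>' * t)"
  proof (intro conjI ballI allI impI)
    fix x and t :: real assume x: "x \<in> ball x\<^sub>0 (min r r') \<inter> \<Omega>" and t: "0 \<le> t"
    have "exp (- \<mu>' * t) \<le> 1" using r' t by simp
    from mult_left_mono[OF this Q] have e1: "Q * exp (- \<mu>' * t) \<le> Q" by simp
    have QM: "0 \<le> Q * M" using Q M by simp
    have "norm (Phi (lift_coeff a) x t) \<le> Q"
    proof (rule norm_blinfun_bound[OF Q])
      fix e show "norm (Phi (lift_coeff a) x t e) \<le> Q * norm e"
        using bnd[of x t e] mult_right_mono[OF e1, of "norm e"] x t by auto
    qed
    with QM show "norm (Phi (lift_coeff a) x t) \<le> Q + Q * M + 1" by simp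
    have "X x t \<in> S" using dec x t by (auto simp: locally_decaying_def)
    from M(2)[OF this] have "norm (Phi (lift_coeff a) x t (L' (X x t))) \<le> Q * exp (- \<mu>' * t) * M"
      using Q by (intro order_trans[OF bnd mult_left_mono]) (use x t in auto)
    also have "\<dots> \<le> (Q + Q * M + 1) * exp (- \<mu>' * t)"
      using Q by (simp add: algebra_simps)
    finally show "norm (Phi (lift_coeff a) x t (L' (X x t))) \<le> (Q + Q * M + 1) * exp (- \<mu>' * t)" .
  qed
  moreover have "0 < Q + Q * M + 1" using Q M by (simp add: add_nonneg_pos)
  moreover have "0 < min r r'" using r r' by simp
  ultimately show "\<exists>r>0. \<exists>C>0. \<exists>\<mu>>0. \<forall>x\<in>ball x\<^sub>0 r \<inter> \<Omega>. \<forall>t\<ge>0. norm (Phi (lift_coeff a) x t) \<le> C \<and>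
      norm (Phi (lift_coeff a) x t (L' (X x t))) \<le> C * exp (- \<mu> * t)"
    using r'(3) by blast
qed

lemma transport_has_derivative:
  assumes aC: "Ck_on (Suc 0) a \<Omega>" and LC: "Ck_on (Suc 0) L \<Omega>" and st: "stable_pair a L" and x0: "x\<^sub>0 \<in> \<Omega>"
  shows "(transport a L has_derivative J (transport (lift_coeff a) (lift_source a L) x\<^sub>0)) (at x\<^sub>0)"
proof -
  note a = Ck_on_imp_continuous_on[OF aC] and L = Ck_on_imp_continuous_on[OF LC]
  have la: "continuous_on \<Omega> (lift_coeff a)"
    by (rule Ck_on_imp_continuous_on[OF Ck_on_lift_coeff[OF aC]])
  have w: "continuous_on \<Omega> (transport a L)" by (rule continuous_on_transport[OF a L st])
  have lL: "continuous_on \<Omega> (lift_source a L)"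
    by (rule Ck_on_imp_continuous_on[OF Ck_on_lift_source[OF aC LC]]) (simp add: w)
  note lst = stable_pair_lift[OF a lL st]
  define w where "w = transport a L"
  define D where "D = (\<lambda>x. J (transport (lift_coeff a) (lift_source a L) x))"
  have wc: "continuous_on \<Omega> w" unfolding w_def by (rule continuous_on_transport[OF a L st])
  have Dc: "continuous_on \<Omega> D"
    unfolding D_def
    by (rule bounded_linear.continuous_on[OF blinfun.bounded_linear_right continuous_on_transport[OF la lL lst]])
  have w_der: "((\<lambda>t. w (X x t)) has_vector_derivative a (X x t) (w (X x t)) - L (X x t)) (at t within {0..})"
    if "x \<in> \<Omega>" "0 \<le> t" for x t
    unfolding w_def by (rule transport_along_flow[OF a L st that])
  have D_der: "((\<lambda>t. D (X x t)) has_vector_derivative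
      ((a (X x t) o\<^sub>L D (X x t)) - (D (X x t) o\<^sub>L bderiv F (X x t)))
      - (bderiv L (X x t) - (blinfun.prod_left (w (X x t)) o\<^sub>L bderiv a (X x t)))) (at t within {0..})"
    if "x \<in> \<Omega>" "0 \<le> t" for x t
    using bounded_linear.has_vector_derivative[OF blinfun.bounded_linear_right transport_along_flow[OF la lL lst that], of J]
    by (simp add: D_def w_def lift_source_def lift_coeff_def blinfun.diff_right blinfun.diff_left JK)
  obtain r C \<mu> S where dec: "locally_decaying x\<^sub>0 r C \<mu> S" using locally_decaying_exists[OF x0] by blast
  then have r: "0 < r" "0 < C" "0 < \<mu>" "compact S" "S \<subseteq> \<Omega>" "ball x\<^sub>0 r \<subseteq> \<Omega>" "x\<^sub>0 \<in> ball x\<^sub>0 r"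
    by (auto simp: locally_decaying_def)
  have inS: "X x\<^sub>0 t \<in> S" if "0 \<le> t" for t using dec r(7) that unfolding locally_decaying_def by blast
  have bounded_S: "\<exists>M>0. \<forall>y\<in>S. norm (G y) \<le> M" if "continuous_on \<Omega> G" for G :: "'a \<Rightarrow> 'z::real_normed_vector"
    using that r compact_imp_bounded[OF compact_continuous_image[OF continuous_on_subset[OF that r(5)] r(4)]]
    unfolding bounded_pos by auto
  obtain Mw where Mw: "0 < Mw" "\<And>y. y \<in> S \<Longrightarrow> norm (w y) \<le> Mw" using bounded_S[OF wc] by blast
  obtain MD where MD: "0 < MD" "\<And>y. y \<in> S \<Longrightarrow> norm (D y) \<le> MD" using bounded_S[OF Dc] by blast
  obtain Ma where Ma: "0 < Ma" "\<And>y. y \<in> S \<Longrightarrow> norm (bderiv a y) \<le> Ma"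
    using bounded_S[OF Ck_on_imp_continuous_on[OF Ck_on_bderiv[OF open_dom aC]]] by blast
  obtain r1 C1 \<mu>1 where r1: "0 < r1" "0 < C1" "0 < \<mu>1" "ball x\<^sub>0 r1 \<subseteq> \<Omega>"
    and Phi_le: "\<And>x t. x \<in> ball x\<^sub>0 r1 \<Longrightarrow> 0 \<le> t \<Longrightarrow> norm (Phi a x t) \<le> C1"
    and "\<And>x t. x \<in> ball x\<^sub>0 r1 \<Longrightarrow> 0 \<le> t \<Longrightarrow> norm (Phi a x t (L (X x t))) \<le> C1 * exp (- \<mu>1 * t)"
    by (rule stable_pairE[OF st x0]) (rule that)
  have F_C: "Ck_on (Suc 0) F \<Omega>" by (rule F_C1)
  \<comment> \<open>The summand 2 covers the error term of \<open>L\<close> and the bound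
    \<open>k \<le> 1\<close> in the product of two differences.\<close>
  define Q where "Q = Mw + Ma + MD + 2"
  have Q: "0 < Q" using Mw MD Ma by (simp add: Q_def)
  \<comment> \<open>The linearization error \<open>p\<close> is followed along two neighbouring trajectories. It solves a linear
    equation with a small right-hand side and vanishes at infinity, so it is small at time 0.\<close>
  have main: "\<exists>d>0. \<forall>z. norm (z - x\<^sub>0) < d \<longrightarrow> norm (w z - w x\<^sub>0 - D x\<^sub>0 (z - x\<^sub>0)) \<le> \<epsilon> * norm (z - x\<^sub>0)"
    if \<epsilon>: "0 < \<epsilon>" for \<epsilon>
  proof -
    \<comment> \<open>Makes the integral of the right-hand side over all times at most
      \<open>\<epsilon> * norm (z - x\<^sub>0)\<close>.\<close>
    define k where "k = min 1 (\<epsilon> * \<mu> / (C1 * Q * C))"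
    have k: "0 < k" "k \<le> 1" "k * (C1 * Q * C) \<le> \<epsilon> * \<mu>"
    proof -
      have P: "0 < C1 * Q * C" using r r1 Q by simp
      then show "0 < k" "k \<le> 1" using \<epsilon> r by (auto simp: k_def)
      have "k \<le> \<epsilon> * \<mu> / (C1 * Q * C)" by (simp add: k_def)
      then show "k * (C1 * Q * C) \<le> \<epsilon> * \<mu>" using P by (simp add: pos_le_divide_eq)
    qed
    obtain da where da: "0 < da" "\<And>x t. x \<in> ball x\<^sub>0 da \<Longrightarrow> 0 \<le> t \<Longrightarrow>
      norm (a (X x t) - a (X x\<^sub>0 t) - bderiv a (X x\<^sub>0 t) (X x t - X x\<^sub>0 t)) \<le> k * norm (X x t - X x\<^sub>0 t)"
      using X_uniform_linearization[OF aC x0 k(1)] by blast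
    obtain dL where dL: "0 < dL" "\<And>x t. x \<in> ball x\<^sub>0 dL \<Longrightarrow> 0 \<le> t \<Longrightarrow>
      norm (L (X x t) - L (X x\<^sub>0 t) - bderiv L (X x\<^sub>0 t) (X x t - X x\<^sub>0 t)) \<le> k * norm (X x t - X x\<^sub>0 t)"
      using X_uniform_linearization[OF LC x0 k(1)] by blast
    obtain dF where dF: "0 < dF" "\<And>x t. x \<in> ball x\<^sub>0 dF \<Longrightarrow> 0 \<le> t \<Longrightarrow>
      norm (F (X x t) - F (X x\<^sub>0 t) - bderiv F (X x\<^sub>0 t) (X x t - X x\<^sub>0 t)) \<le> k * norm (X x t - X x\<^sub>0 t)"
      using X_uniform_linearization[OF F_C x0 k(1)] by blast
    obtain dw where dw: "0 < dw" "\<And>x t. x \<in> ball x\<^sub>0 dw \<Longrightarrow> 0 \<le> t \<Longrightarrow> dist (w (X x t)) (w (X x\<^sub>0 t)) < k"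
      using X_uniformly_close[OF wc x0 k(1)] by blast
    define d where "d = min (min (min da dL) (min dF dw)) r"
    show ?thesis
    proof (intro exI[of _ d] conjI allI impI)
      show "0 < d" using da(1) dL(1) dF(1) dw(1) r by (simp add: d_def)
      fix z assume z: "norm (z - x\<^sub>0) < d"
      then have zb: "z \<in> ball x\<^sub>0 da" "z \<in> ball x\<^sub>0 dL" "z \<in> ball x\<^sub>0 dF" "z \<in> ball x\<^sub>0 dw" "z \<in> ball x\<^sub>0 r"
        by (auto simp: d_def dist_norm norm_minus_commute)
      then have zO: "z \<in> \<Omega>" using r by blast
      define \<delta> where "\<delta> = (\<lambda>t. X z t - X x\<^sub>0 t)"
      define p where "p = (\<lambda>t. w (X z t) - w (X x\<^sub>0 t) - D (X x\<^sub>0 t) (\<delta> t))"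
      define q where "q = (\<lambda>t. Phi a x\<^sub>0 t (p t))"
      \<comment> \<open>The linearization errors of \<open>a\<close>, \<open>L\<close> and
        \<open>F\<close>, plus a product of two differences. In the product, the difference of
        \<open>a\<close> is linearly bounded in \<open>\<delta>\<close>; for the other factor
        continuity of \<open>w\<close> is enough, since \<open>w\<close> is not yet known to be
        Lipschitz.\<close>
      define e where "e = (\<lambda>t. (a (X z t) - a (X x\<^sub>0 t) - bderiv a (X x\<^sub>0 t) (\<delta> t)) (w (X x\<^sub>0 t))
        + (a (X z t) - a (X x\<^sub>0 t)) (w (X z t) - w (X x\<^sub>0 t))
        - (L (X z t) - L (X x\<^sub>0 t) - bderiv L (X x\<^sub>0 t) (\<delta> t))
        - D (X x\<^sub>0 t) (F (X z t) - F (X x\<^sub>0 t) - bderiv F (X x\<^sub>0 t) (\<delta> t)))"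
      have \<delta>_le: "norm (\<delta> t) \<le> C * exp (- \<mu> * t) * norm (z - x\<^sub>0)" if "0 \<le> t" for t
        using dec zb(5) r(7) that unfolding locally_decaying_def \<delta>_def by blast
      have p_der: "(p has_vector_derivative a (X x\<^sub>0 t) (p t) + e t) (at t within {0..})" if t: "0 \<le> t" for t
      proof -
        have "(\<delta> has_vector_derivative F (X z t) - F (X x\<^sub>0 t)) (at t within {0..})"
          unfolding \<delta>_def using zO x0 t by (intro has_vector_derivative_diff X_der)
        from has_vector_derivative_diff[OF has_vector_derivative_diff[OF w_der[OF zO t] w_der[OF x0 t]]
            apply_has_vector_derivative[OF D_der[OF x0 t] this]]
        show ?thesis
          unfolding p_def
          by (rule has_vector_derivative_eq_rhs) (simp add: e_def p_def blinfun.bilinear_simps algebra_simps)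
      qed
      have q_der: "(q has_vector_derivative Phi a x\<^sub>0 t (e t)) (at t within {0..})" if t: "0 \<le> t" for t
        using apply_has_vector_derivative[OF Phi_der[OF a x0 t] p_der[OF t]]
        by (simp add: q_def blinfun.bilinear_simps)
      have e_le: "norm (e t) \<le> k * Q * norm (\<delta> t)" if t: "0 \<le> t" for t
      proof -
        note S = inS[OF t]
        let ?A = "a (X z t) - a (X x\<^sub>0 t) - bderiv a (X x\<^sub>0 t) (\<delta> t)"
        have A: "norm ?A \<le> k * norm (\<delta> t)" using da(2)[OF zb(1) t] by (simp add: \<delta>_def)
        have "norm (bderiv a (X x\<^sub>0 t) (\<delta> t)) \<le> Ma * norm (\<delta> t)"
          using norm_blinfun[of "bderiv a (X x\<^sub>0 t)" "\<delta> t"] mult_right_mono[OF Ma(2)[OF S], of "norm (\<delta> t)"] by simp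
        then have A2: "norm (a (X z t) - a (X x\<^sub>0 t)) \<le> (k + Ma) * norm (\<delta> t)"
          using A norm_triangle_ineq[of ?A "bderiv a (X x\<^sub>0 t) (\<delta> t)"] by (simp add: algebra_simps)
        have 1: "norm (?A (w (X x\<^sub>0 t))) \<le> k * norm (\<delta> t) * Mw"
          using norm_blinfun[of ?A "w (X x\<^sub>0 t)"] mult_mono[OF A Mw(2)[OF S]] k by simp
        have W: "norm (w (X z t) - w (X x\<^sub>0 t)) \<le> k" using dw(2)[OF zb(4) t] by (simp add: dist_norm)
        have 2: "norm ((a (X z t) - a (X x\<^sub>0 t)) (w (X z t) - w (X x\<^sub>0 t))) \<le> (k + Ma) * norm (\<delta> t) * k"
          using norm_blinfun[of "a (X z t) - a (X x\<^sub>0 t)" "w (X z t) - w (X x\<^sub>0 t)"] mult_mono[OF A2 W] k Ma by simp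
        have 3: "norm (L (X z t) - L (X x\<^sub>0 t) - bderiv L (X x\<^sub>0 t) (\<delta> t)) \<le> k * norm (\<delta> t)"
          using dL(2)[OF zb(2) t] by (simp add: \<delta>_def)
        let ?f = "F (X z t) - F (X x\<^sub>0 t) - bderiv F (X x\<^sub>0 t) (\<delta> t)"
        have f: "norm ?f \<le> k * norm (\<delta> t)" using dF(2)[OF zb(3) t] by (simp add: \<delta>_def)
        have 4: "norm (D (X x\<^sub>0 t) ?f) \<le> MD * (k * norm (\<delta> t))"
          using norm_blinfun[of "D (X x\<^sub>0 t)" ?f] mult_mono[OF MD(2)[OF S] f] MD(1) by simp
        have "norm (e t) \<le> k * norm (\<delta> t) * Mw + (k + Ma) * norm (\<delta> t) * k + k * norm (\<delta> t) + MD * (k * norm (\<delta> t))"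
          unfolding e_def by (intro order_trans[OF norm_triangle_ineq4] order_trans[OF norm_triangle_ineq] add_mono 1 2 3 4)
        also have "\<dots> = k * (Mw + (k + Ma) + 1 + MD) * norm (\<delta> t)" by (simp add: algebra_simps)
        also have "\<dots> \<le> k * Q * norm (\<delta> t)"
          using k by (intro mult_right_mono mult_left_mono) (auto simp: Q_def)
        finally show ?thesis .
      qed
      have "norm (Phi a x\<^sub>0 t (e t)) \<le> (C1 * (k * Q * (C * norm (z - x\<^sub>0)))) * exp (- \<mu> * t)" if t: "0 \<le> t" for t
      proof -
        have "norm (Phi a x\<^sub>0 t (e t)) \<le> norm (Phi a x\<^sub>0 t) * norm (e t)" by (rule norm_blinfun)
        also have "\<dots> \<le> C1 * (k * Q * (C * exp (- \<mu> * t) * norm (z - x\<^sub>0)))"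
          using Phi_le[of x\<^sub>0 t] r1 t k Q
          by (intro mult_mono order_trans[OF e_le[OF t] mult_left_mono[OF \<delta>_le[OF t]]]) auto
        also have "\<dots> = (C1 * (k * Q * (C * norm (z - x\<^sub>0)))) * exp (- \<mu> * t)" by (simp add: mult_ac)
        finally show ?thesis .
      qed
      then have q_le: "norm (q t - q 0) \<le> C1 * (k * Q * (C * norm (z - x\<^sub>0))) / (- \<mu>) * exp (- \<mu> * t)
          - C1 * (k * Q * (C * norm (z - x\<^sub>0))) / (- \<mu>) * exp (- \<mu> * 0)" if "0 \<le> t" for t
        by (intro exp_derivative_norm_le[where f' = "\<lambda>t. Phi a x\<^sub>0 t (e t)"] q_der) (use r that in auto)
      have q_bnd: "norm (q t - q 0) \<le> \<epsilon> * norm (z - x\<^sub>0)" if "0 \<le> t" for t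
      proof -
        have "0 \<le> C1 * (k * Q * (C * norm (z - x\<^sub>0))) / \<mu> * exp (- \<mu> * t)"
          using r r1 k Q by simp
        with q_le[OF that] have "norm (q t - q 0) \<le> C1 * (k * Q * (C * norm (z - x\<^sub>0))) / \<mu>" by simp
        also have "\<dots> = (k * (C1 * Q * C)) / \<mu> * norm (z - x\<^sub>0)" by simp
        also have "\<dots> \<le> \<epsilon> * norm (z - x\<^sub>0)"
          using k(3) r(3) by (intro mult_right_mono) (simp_all add: pos_divide_le_eq)
        finally show ?thesis .
      qed
      \<comment> \<open>Both trajectories tend to \<open>0\<close>, where \<open>w\<close> and
        \<open>D\<close> are continuous; this is the boundary condition at infinity.\<close>
      have "(p \<longlongrightarrow> w 0 - w 0 - D 0 (0 - 0)) at_top"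
      proof -
        have "isCont w 0" "isCont D 0"
          using wc Dc open_dom zero_in_dom by (auto simp: continuous_on_eq_continuous_at)
        then show ?thesis
          unfolding p_def \<delta>_def
          by (intro tendsto_diff blinfun.tendsto isCont_tendsto_compose[of _ w] isCont_tendsto_compose[of _ D]
              X_lim zO x0)
      qed
      then have "(p \<longlongrightarrow> 0) at_top" by (simp add: blinfun.zero_right)
      from tendsto_mult_left[OF tendsto_norm[OF this], of C1]
      have C1p: "((\<lambda>t. C1 * norm (p t)) \<longlongrightarrow> 0) at_top" by simp
      have "(q \<longlongrightarrow> 0) at_top"
      proof (rule Lim_null_comparison[OF _ C1p])
        show "\<forall>\<^sub>F t in at_top. norm (q t) \<le> C1 * norm (p t)"
          using eventually_ge_at_top[of 0]
        proof eventually_elim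
          case (elim t)
          then show ?case
            using Phi_le[of x\<^sub>0 t] r1(1) mult_right_mono[of "norm (Phi a x\<^sub>0 t)" C1 "norm (p t)"]
              norm_blinfun[of "Phi a x\<^sub>0 t" "p t"] by (simp add: q_def)
        qed
      qed
      then have "((\<lambda>t. norm (q t - q 0)) \<longlongrightarrow> norm (0 - q 0)) at_top" by (intro tendsto_intros)
      then have "norm (0 - q 0) \<le> \<epsilon> * norm (z - x\<^sub>0)"
        by (rule tendsto_upperbound[OF _ eventually_mono[OF eventually_ge_at_top[of 0] q_bnd]]) auto
      then have "norm (q 0) \<le> \<epsilon> * norm (z - x\<^sub>0)" by simp
      then show "norm (w z - w x\<^sub>0 - D x\<^sub>0 (z - x\<^sub>0)) \<le> \<epsilon> * norm (z - x\<^sub>0)"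
        by (simp add: q_def p_def \<delta>_def Phi_zero[OF a x0] X_zero zO x0)
    qed
  qed
  have "(w has_derivative D x\<^sub>0) (at x\<^sub>0)"
    unfolding has_derivative_at_alt using main blinfun.bounded_linear_right by blast
  then show ?thesis by (simp add: w_def D_def)
qed

text \<open>The induction hypothesis is used twice: for the same pair, which makes the lifted source
  of class \<open>k\<close>, and for the lifted pair, whose transport is the derivative. Both
  \<open>a\<close> and \<open>L\<close> vary in the induction while their types do not.\<close>

lemma Ck_on_transport:
  fixes a :: "'a \<Rightarrow> 'e \<Rightarrow>\<^sub>L 'e"
  assumes "smooth_on a \<Omega>" "Ck_on k L \<Omega>" "stable_pair a L"
  shows "Ck_on k (transport a L) \<Omega>"
  using assms
proof (induction k arbitrary: a L)
  case 0
  show ?case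
    using continuous_on_transport[OF Ck_on_imp_continuous_on[OF smooth_onD[OF 0(1)]]
        Ck_on_imp_continuous_on[OF 0(2)] 0(3)] by simp
next
  case (Suc k)
  note a = smooth_onD[OF Suc.prems(1)]
  have w: "Ck_on k (transport a L) \<Omega>"
    by (rule Suc.IH[OF Suc.prems(1) Ck_on_SucD[OF Suc.prems(2)] Suc.prems(3)])
  have source: "Ck_on k (lift_source a L) \<Omega>"
    by (rule Ck_on_lift_source[OF a Suc.prems(2) w])
  have "smooth_on (lift_coeff a) \<Omega>"
    using Ck_on_lift_coeff[OF a] by (simp add: smooth_on_def)
  moreover have "stable_pair (lift_coeff a) (lift_source a L)"
    by (rule stable_pair_lift[OF Ck_on_imp_continuous_on[OF a] Ck_on_imp_continuous_on[OF source] Suc.prems(3)])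
  ultimately have "Ck_on k (transport (lift_coeff a) (lift_source a L)) \<Omega>"
    using source by (intro Suc.IH)
  then have J: "Ck_on k (\<lambda>x. J (transport (lift_coeff a) (lift_source a L) x)) \<Omega>"
    by (rule Ck_on_bounded_linear[OF blinfun.bounded_linear_right open_dom])
  have "Ck_on (Suc 0) L \<Omega>"
    using Ck_on_le[OF Suc.prems(2), of "Suc 0"] by (simp del: Ck_on.simps)
  note D = this
  show ?case
    by (rule Ck_on_SucI[OF open_dom transport_has_derivative[OF a D Suc.prems(3)]]) (assumption, rule J)
qed

end

end

section \<open>Value functions\<close>

text \<open>
  The iteration needs one Banach space isomorphic to its own space of derivatives, since the type of
  the \<open>k\<close>-th derivative cannot depend on \<open>k\<close>. Bounded sequences serve; their Banach space structure
  in the library presupposes a metric on the index type.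
\<close>

instantiation nat :: metric_space
begin

definition dist_nat :: "nat \<Rightarrow> nat \<Rightarrow> real" where "dist_nat m n = \<bar>real m - real n\<bar>"

definition uniformity_nat :: "(nat \<times> nat) filter"
  where "uniformity_nat = (INF e\<in>{0<..}. principal {(x, y). dist x y < e})"

instance
proof
  show "open U = (\<forall>x\<in>U. \<forall>\<^sub>F (x', y) in uniformity. x' = x \<longrightarrow> y \<in> U)" for U :: "nat set"
  proof -
    have "\<forall>\<^sub>F (x', y) in uniformity. x' = x \<longrightarrow> y \<in> U" if "x \<in> U" for x
    proof -
      \<comment> \<open>Balls of radius 1 are singletons, so the uniformity of this metric induces
        the discrete topology already present on \<open>nat\<close>.\<close>
      have "\<forall>\<^sub>F p in principal {(x, y). dist x y < (1::real)}. case p of (x', y) \<Rightarrow> x' = x \<longrightarrow> y \<in> U"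
      proof -
        have "y = x" if "\<bar>real x - real y\<bar> < 1" for y
          using that nat_less_real_le[of x y] nat_less_real_le[of y x] by linarith
        with that show ?thesis by (auto simp: eventually_principal dist_nat_def)
      qed
      then show ?thesis
        unfolding uniformity_nat_def
        by (rule filter_leD[OF INF_lower, rotated]) simp
    qed
    then show ?thesis by (simp add: open_discrete)
  qed
qed (auto simp: dist_nat_def uniformity_nat_def)

end

instance bcontfun :: (metric_space, banach) banach ..

lemma apply_Bcontfun_nat:
  fixes f :: "nat \<Rightarrow> real"
  assumes "\<And>m. norm (f m) \<le> C"
  shows "apply_bcontfun (Bcontfun f) = f"
  by (rule Bcontfun_inverse, rule bcontfun_normI[OF _ assms]) simp

lemma reindex_bounded_linear:
  fixes \<sigma> :: "nat \<Rightarrow> nat"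
  defines "S \<equiv> (\<lambda>e :: nat \<Rightarrow>\<^sub>C real. Bcontfun (\<lambda>m. e (\<sigma> m)))"
  shows "bounded_linear S" "apply_bcontfun (S e) m = e (\<sigma> m)"
proof -
  have S: "apply_bcontfun (S e) = (\<lambda>m. e (\<sigma> m))" for e
    unfolding S_def by (rule apply_Bcontfun_nat[OF norm_bounded])
  then show "apply_bcontfun (S e) m = e (\<sigma> m)" by simp
  show "bounded_linear S"
  proof (rule bounded_linear_intro[where K = 1])
    show "norm (S e) \<le> norm e * 1" for e
      by (rule norm_bound) (simp add: S norm_bounded[of e, simplified])
  qed (auto intro!: bcontfun_eqI simp: S)
qed

text \<open>A linear map on a Euclidean space is given by its values on the basis, here by finitely
  many bounded sequences; a bijection between \<open>Basis \<times> UNIV\<close> and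
  \<open>nat\<close> interleaves them into a single one.\<close>

lemma bounded_sequences_absorb_derivatives:
  "\<exists>(J :: (nat \<Rightarrow>\<^sub>C real) \<Rightarrow>\<^sub>L ('a::euclidean_space \<Rightarrow>\<^sub>L (nat \<Rightarrow>\<^sub>C real))) K.
    (\<forall>A. J (blinfun_apply K A) = A) \<and> (\<forall>e. K (J e) = e)"
proof -
  let ?I = "(Basis :: 'a set) \<times> (UNIV :: nat set)"
  have cI: "countable ?I" by (simp add: countable_finite)
  have iI: "infinite ?I" using nonempty_Basis by (simp add: finite_cartesian_product_iff)
  define enc where "enc = to_nat_on ?I"
  define dec where "dec = from_nat_into ?I"
  have dec_enc: "dec (enc (b, m)) = (b, m)" if "b \<in> Basis" for b m
    unfolding dec_def enc_def using cI that by (intro from_nat_into_to_nat_on) auto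
  have enc_dec: "enc (dec j) = j" for j
    unfolding dec_def enc_def using cI iI by (rule to_nat_on_from_nat_into_infinite)
  have dec_in: "fst (dec j) \<in> Basis" for j
    using from_nat_into[of ?I j] iI unfolding dec_def by (metis SigmaE fst_conv finite.emptyI)
  \<comment> \<open>Interleaving: entry \<open>j\<close> is read off at the basis vector and the
    index that \<open>j\<close> encodes.\<close>
  define kk where "kk = (\<lambda>(A :: 'a \<Rightarrow>\<^sub>L (nat \<Rightarrow>\<^sub>C real)) j. apply_bcontfun (A (fst (dec j))) (snd (dec j)))"
  have kk_le: "norm (kk A j) \<le> norm A" for A j
  proof -
    have "norm (kk A j) \<le> norm (A (fst (dec j)))" unfolding kk_def by (rule norm_bounded)
    also have "\<dots> \<le> norm A * norm (fst (dec j))" by (rule norm_blinfun)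
    finally show ?thesis using dec_in by simp
  qed
  have kk: "apply_bcontfun (Bcontfun (kk A)) = kk A" for A
    by (rule apply_Bcontfun_nat[OF kk_le])
  have "bounded_linear (\<lambda>A. Bcontfun (kk A))"
  proof (rule bounded_linear_intro[where K = 1])
    show "norm (Bcontfun (kk A)) \<le> norm A * 1" for A
      by (rule norm_bound) (use kk_le[of A] in \<open>simp add: kk\<close>)
  qed (auto intro!: bcontfun_eqI simp: kk, auto simp: kk_def blinfun.bilinear_simps)
  then have K: "blinfun_apply (Blinfun (\<lambda>A. Bcontfun (kk A))) = (\<lambda>A. Bcontfun (kk A))"
    by (rule bounded_linear_Blinfun_apply)
  \<comment> \<open>The block of \<open>e\<close> that belongs to the basis vector
    \<open>b\<close>.\<close>
  define S where "S = (\<lambda>b (e :: nat \<Rightarrow>\<^sub>C real). Bcontfun (\<lambda>m. e (enc (b, m))))"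
  have S: "bounded_linear (S b)" "apply_bcontfun (S b e) m = e (enc (b, m))" for b e m
    using reindex_bounded_linear[where \<sigma> = "\<lambda>m. enc (b, m)"] by (simp_all add: S_def)
  define jj where "jj = (\<lambda>e. \<Sum>b\<in>(Basis :: 'a set). blinfun_scaleR_left (S b e) o\<^sub>L blinfun_inner_right b)"
  have "bounded_linear jj"
    unfolding jj_def
    by (intro bounded_linear_sum bounded_linear_compose[OF blinfun_compose.bounded_linear_left]
        bounded_linear_compose[OF bounded_linear_blinfun_scaleR_left] S(1))
  then have J: "blinfun_apply (Blinfun jj) = jj" by (rule bounded_linear_Blinfun_apply)
  have jj: "jj e d = (\<Sum>b\<in>Basis. (b \<bullet> d) *\<^sub>R S b e)" for e d
    by (simp add: jj_def blinfun.sum_left)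
  have jj_Basis: "jj e b = S b e" if "b \<in> Basis" for e b
    using that by (simp add: jj inner_Basis if_distrib[of "\<lambda>r. r *\<^sub>R _"] sum.delta cong: if_cong)
  have 1: "jj (Bcontfun (kk A)) = A" for A
  proof (rule blinfun_euclidean_eqI)
    fix b :: 'a assume b: "b \<in> Basis"
    show "jj (Bcontfun (kk A)) b = A b"
      unfolding jj_Basis[OF b] by (rule bcontfun_eqI) (simp add: S kk, simp add: kk_def dec_enc[OF b])
  qed
  have 2: "Bcontfun (kk (jj e)) = e" for e
    by (rule bcontfun_eqI) (simp add: kk, simp add: kk_def jj_Basis[OF dec_in] S enc_dec)
  show ?thesis
    by (intro exI[of _ "Blinfun jj"] exI[of _ "Blinfun (\<lambda>A. Bcontfun (kk A))"]) (simp add: J K 1 2)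
qed

lemma has_real_derivative_along_curve:
  fixes v :: "'a::real_normed_vector \<Rightarrow> real"
  assumes "Ck_on (Suc 0) v S" "\<phi> t \<in> S" "(\<phi> has_vector_derivative \<phi>') (at t within T)"
  shows "((\<lambda>t. v (\<phi> t)) has_real_derivative bderiv v (\<phi> t) \<phi>') (at t within T)"
proof -
  have "(\<phi> has_derivative (\<lambda>h. h *\<^sub>R \<phi>')) (at t within T)"
    using assms(3) by (simp add: has_vector_derivative_def)
  from has_derivative_compose[OF this has_derivative_bderiv[OF assms(1,2)]]
  have "((\<lambda>t. v (\<phi> t)) has_derivative (\<lambda>h. h * bderiv v (\<phi> t) \<phi>')) (at t within T)"
    by (simp add: blinfun.scaleR_right)
  then show ?thesis
    by (simp add: has_field_derivative_def mult_commute_abs)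
qed

section \<open>Existence, uniqueness and positivity of the value function\<close>

context stable_flow
begin

lemma X_at_zero: "0 \<le> t \<Longrightarrow> X 0 t = 0"
proof -
  assume t: "0 \<le> t"
  from X_exp obtain \<epsilon> C \<nu> where "0 < \<epsilon>"
    "\<forall>x\<in>ball 0 \<epsilon>. \<forall>t\<ge>0. norm (X x t) \<le> C * exp (- \<nu> * t) * norm x" by blast
  then have "norm (X 0 t) \<le> C * exp (- \<nu> * t) * norm (0::'a)"
    using t by (metis centre_in_ball)
  then show ?thesis by simp
qed

lemma along_flow_der:
  "Ck_on (Suc 0) v \<Omega> \<Longrightarrow> x \<in> \<Omega> \<Longrightarrow> 0 \<le> t \<Longrightarrow>
    ((\<lambda>t. v (X x t)) has_real_derivative bderiv v (X x t) (F (X x t))) (at t within {0..})"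
  by (rule has_real_derivative_along_curve[OF _ X_in X_der])

text \<open>The scalar problem is embedded into sequences by a fixed vector \<open>e0\<close> and
  recovered from coordinate \<open>0\<close>, so that all derivatives stay in one space. The pair is
  stable because the cost vanishes at \<open>0\<close> and is bounded by a multiple of the norm
  along exponentially decaying trajectories.\<close>

lemma smooth_value_exists:
  fixes l :: "'a \<Rightarrow> real"
  assumes l: "smooth_on l \<Omega>" and l0: "l 0 = 0"
  shows "\<exists>v. smooth_on v \<Omega> \<and> v 0 = 0 \<and> (\<forall>x\<in>\<Omega>. bderiv v x (F x) = - l x)"
proof -
  obtain J :: "(nat \<Rightarrow>\<^sub>C real) \<Rightarrow>\<^sub>L ('a \<Rightarrow>\<^sub>L (nat \<Rightarrow>\<^sub>C real))" and K
    where JK: "\<And>A. J (blinfun_apply K A) = A" and KJ: "\<And>e. K (J e) = e"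
    using bounded_sequences_absorb_derivatives by blast
  define a where "a = (\<lambda>_ :: 'a. 0 :: (nat \<Rightarrow>\<^sub>C real) \<Rightarrow>\<^sub>L (nat \<Rightarrow>\<^sub>C real))"
  define e0 where "e0 = (const_bcontfun 1 :: nat \<Rightarrow>\<^sub>C real)"
  define L where "L = (\<lambda>x. l x *\<^sub>R e0)"
  have a: "smooth_on a \<Omega>" unfolding a_def smooth_on_def using Ck_on_const by blast
  have ac: "continuous_on \<Omega> a" by (simp add: a_def)
  have l1: "Ck_on (Suc 0) l \<Omega>" by (rule smooth_onD[OF l])
  have L: "Ck_on k L \<Omega>" for k
    unfolding L_def by (rule Ck_on_bounded_linear[OF bounded_linear_scaleR_left open_dom smooth_onD[OF l]])
  have Phi: "Phi a x t = id_blinfun" if "x \<in> \<Omega>" "0 \<le> t" for x t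
  proof -
    have "id_blinfun = id_blinfun o\<^sub>L Phi a x t"
      by (rule fundamental_pair_adjoint_solution[OF fundamental_pair_evolution[OF ac that(1)] _ that(2)])
        (simp add: a_def)
    then show ?thesis by simp
  qed
  have norm_e0: "norm e0 \<le> 1" unfolding e0_def by (rule norm_bound) (simp add: const_bcontfun.rep_eq)
  have "stable_pair a L"
    unfolding stable_pair_def
  proof
    fix x\<^sub>0 assume x0: "x\<^sub>0 \<in> \<Omega>"
    obtain r C \<mu> S where dec: "locally_decaying x\<^sub>0 r C \<mu> S" using locally_decaying_exists[OF x0] by blast
    then have r: "0 < r" "0 < C" "0 < \<mu>" "compact S" "S \<subseteq> \<Omega>" "ball x\<^sub>0 r \<subseteq> \<Omega>"
      by (auto simp: locally_decaying_def)
    have "continuous_on S l" using Ck_on_imp_continuous_on[OF l1] r(5) by (rule continuous_on_subset)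
    then have "bounded (l ` S)" by (intro compact_imp_bounded compact_continuous_image r(4))
    then obtain M where M: "0 < M" "\<And>y. y \<in> S \<Longrightarrow> norm (l y) \<le> M" unfolding bounded_pos by blast
    have "(l has_derivative bderiv l 0) (at 0)" by (rule has_derivative_bderiv[OF l1 zero_in_dom])
    then obtain d where d: "0 < d" "\<And>y. norm y < d \<Longrightarrow> norm (l y - bderiv l 0 y) \<le> 1 * norm y"
      unfolding has_derivative_at_alt by (auto simp: l0 dest!: spec[of _ 1])
    \<comment> \<open>Near \<open>0\<close> the differentiability of \<open>l\<close> gives the
      linear bound; from radius \<open>d\<close> on, boundedness on \<open>S\<close> does.\<close>
    define N where "N = max (norm (bderiv l 0) + 1) (M / d)"
    have N: "0 < N" using M d by (simp add: N_def less_max_iff_disj)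
    have lip: "norm (l y) \<le> N * norm y" if "y \<in> S" for y
    proof (cases "norm y < d")
      case True
      have "norm (l y) \<le> norm (l y - bderiv l 0 y) + norm (bderiv l 0 y)"
        by (metis add.commute diff_add_cancel norm_triangle_ineq)
      also have "\<dots> \<le> norm y + norm (bderiv l 0) * norm y"
        using d(2)[OF True] norm_blinfun[of "bderiv l 0" y] by simp
      also have "\<dots> = (norm (bderiv l 0) + 1) * norm y" by (simp add: algebra_simps)
      also have "\<dots> \<le> N * norm y" by (rule mult_right_mono) (auto simp: N_def)
      finally show ?thesis .
    next
      case False
      have "M = M / d * d" using d by simp
      also have "\<dots> \<le> N * norm y"
        by (rule mult_mono) (use False d M in \<open>auto simp: N_def le_max_iff_disj\<close>)
      finally show ?thesis using M(2)[OF that] by simp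
    qed
    have "\<forall>x\<in>ball x\<^sub>0 r \<inter> \<Omega>. \<forall>t\<ge>0. norm (Phi a x t) \<le> 1 + N * C \<and>
        norm (Phi a x t (L (X x t))) \<le> (1 + N * C) * exp (- \<mu> * t)"
    proof (intro ballI allI impI conjI)
      fix x and t :: real assume x: "x \<in> ball x\<^sub>0 r \<inter> \<Omega>" and t: "0 \<le> t"
      have NC: "0 \<le> N * C" using N r by simp
      have "norm (Phi a x t) \<le> 1" using Phi[of x t] x t norm_blinfun_id_le by auto
      then show "norm (Phi a x t) \<le> 1 + N * C" using NC by linarith
      have X: "X x t \<in> S" "norm (X x t) \<le> C * exp (- \<mu> * t)"
        using dec x t unfolding locally_decaying_def by blast+
      have "norm (Phi a x t (L (X x t))) \<le> norm (l (X x t)) * norm e0"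
        using Phi[of x t] x t by (simp add: L_def)
      also have "\<dots> \<le> norm (l (X x t)) * 1" by (rule mult_left_mono[OF norm_e0]) simp
      also have "\<dots> \<le> N * (C * exp (- \<mu> * t))"
        using order_trans[OF lip[OF X(1)] mult_left_mono[OF X(2), of N]] N by simp
      also have "\<dots> \<le> (1 + N * C) * exp (- \<mu> * t)" by (simp add: algebra_simps)
      finally show "norm (Phi a x t (L (X x t))) \<le> (1 + N * C) * exp (- \<mu> * t)" .
    qed
    moreover have "0 < 1 + N * C" using N r by (simp add: add_pos_pos)
    ultimately show "\<exists>r>0. \<exists>C>0. \<exists>\<mu>>0. \<forall>x\<in>ball x\<^sub>0 r \<inter> \<Omega>. \<forall>t\<ge>0. norm (Phi a x t) \<le> C \<and>
        norm (Phi a x t (L (X x t))) \<le> C * exp (- \<mu> * t)"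
      using r by blast
  qed
  note st = this
  define w where "w = transport a L"
  define v where "v = (\<lambda>x. apply_bcontfun (w x) 0)"
  have ev: "bounded_linear (\<lambda>e :: nat \<Rightarrow>\<^sub>C real. apply_bcontfun e 0)"
  proof (rule bounded_linear_intro[where K = 1])
    show "norm (apply_bcontfun e 0) \<le> norm e * 1" for e :: "nat \<Rightarrow>\<^sub>C real"
      using norm_bounded[of e 0] by simp
  qed auto
  have w: "Ck_on k w \<Omega>" for k
    unfolding w_def by (rule Ck_on_transport[OF JK KJ a L st])
  have v: "smooth_on v \<Omega>"
    unfolding smooth_on_def v_def using Ck_on_bounded_linear[OF ev open_dom w] by blast
  have w_der: "((\<lambda>s. w (X x s)) has_vector_derivative - L (X x t)) (at t within {0..})"
    if "x \<in> \<Omega>" "0 \<le> t" for x t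
    using transport_along_flow[OF ac Ck_on_imp_continuous_on[OF L[of 0]] st that] by (simp add: w_def a_def)
  \<comment> \<open>The derivative of \<open>v\<close> along the trajectory at time \<open>0\<close>
    is computed twice: by the chain rule and from the transport equation.\<close>
  have "bderiv v x (F x) = - l x" if x: "x \<in> \<Omega>" for x
  proof (rule vector_derivative_unique_within[of 0 "{0..}" "\<lambda>t. v (X x t)"])
    show "at (0::real) within {0..} \<noteq> bot"
      using at_within_atLeast_eq[of 0 1] by (simp add: at_within_Icc_at_right)
    show "((\<lambda>t. v (X x t)) has_vector_derivative bderiv v x (F x)) (at 0 within {0..})"
      using along_flow_der[OF smooth_onD[OF v] x order_refl]
      by (simp add: X_zero x has_real_derivative_iff_has_vector_derivative)
    show "((\<lambda>t. v (X x t)) has_vector_derivative - l x) (at 0 within {0..})"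
      using bounded_linear.has_vector_derivative[OF ev w_der[OF x order_refl]]
      by (simp add: v_def L_def X_zero x e0_def const_bcontfun.rep_eq)
  qed
  moreover have "v 0 = 0"
  proof -
    have "integral {0..s} (integrand a L 0) = integral {0..s} (\<lambda>_. 0)" for s
      by (rule integral_cong) (simp add: integrand_def L_def X_at_zero l0 blinfun.zero_right)
    then have "w 0 = lim (\<lambda>n. 0)" by (simp add: w_def transport_def)
    then show ?thesis by (simp add: v_def)
  qed
  ultimately show ?thesis using v by blast
qed

text \<open>The difference of two solutions is constant along each trajectory and tends to its value
  at \<open>0\<close>.\<close>

lemma value_unique:
  fixes v w :: "'a \<Rightarrow> real"
  assumes v: "Ck_on (Suc 0) v \<Omega>" and w: "Ck_on (Suc 0) w \<Omega>" and "v 0 = w 0"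
    and eq: "\<And>x. x \<in> \<Omega> \<Longrightarrow> bderiv v x (F x) = bderiv w x (F x)" and x: "x \<in> \<Omega>"
  shows "v x = w x"
proof -
  have "v (X x t) - w (X x t) = v (X x 0) - w (X x 0)" if "0 \<le> t" for t
  proof (rule has_vector_derivative_zero_const[OF _ that, where f = "\<lambda>t. v (X x t) - w (X x t)"])
    fix t :: real assume t: "0 \<le> t"
    show "((\<lambda>t. v (X x t) - w (X x t)) has_vector_derivative 0) (at t within {0..})"
      using DERIV_diff[OF along_flow_der[OF v x t] along_flow_der[OF w x t]] eq[OF X_in[OF x t]]
      by (simp add: has_real_derivative_iff_has_vector_derivative)
  qed
  then have const: "v (X x t) - w (X x t) = v x - w x" if "0 \<le> t" for t
    using that x by (simp add: X_zero)
  have cont: "isCont v 0" "isCont w 0"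
    using Ck_on_imp_continuous_on[OF v] Ck_on_imp_continuous_on[OF w] open_dom zero_in_dom
    by (auto simp: continuous_on_eq_continuous_at)
  have "((\<lambda>t. v (X x t) - w (X x t)) \<longlongrightarrow> v 0 - w 0) at_top"
    by (intro tendsto_diff isCont_tendsto_compose[OF cont(1)] isCont_tendsto_compose[OF cont(2)] X_lim x)
  then have "((\<lambda>t::real. v x - w x) \<longlongrightarrow> v 0 - w 0) at_top"
    by (rule Lim_transform_eventually) (use eventually_ge_at_top[of 0] in eventually_elim, rule const)
  then have "v x - w x = v 0 - w 0"
    by (simp add: tendsto_const_iff)
  then show ?thesis using assms(3) by simp
qed

context
  fixes v l :: "'a \<Rightarrow> real"
  assumes v: "Ck_on (Suc 0) v \<Omega>" and v0: "v 0 = 0"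
    and veq: "\<And>x. x \<in> \<Omega> \<Longrightarrow> bderiv v x (F x) = - l x"
    and lpos: "\<And>x. x \<in> \<Omega> \<Longrightarrow> x \<noteq> 0 \<Longrightarrow> 0 < l x" and l0: "l 0 = 0"
begin

lemma value_decreasing:
  assumes x: "x \<in> \<Omega>" and t: "0 \<le> t"
  shows "v (X x t) \<le> v x"
proof -
  have l: "0 \<le> l y" if "y \<in> \<Omega>" for y using lpos[OF that] l0 by (cases "y = 0") auto
  have "(\<lambda>t. v (X x t)) t \<le> (\<lambda>t. v (X x t)) 0"
  proof (rule DERIV_nonpos_imp_decreasing_open[OF t])
    fix s assume s: "0 < s" "s < t"
    have "((\<lambda>t. v (X x t)) has_real_derivative bderiv v (X x s) (F (X x s))) (at s within {0..t})"
      by (rule DERIV_subset[OF along_flow_der[OF v x]]) (use s in auto)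
    then show "\<exists>y. ((\<lambda>t. v (X x t)) has_real_derivative y) (at s) \<and> y \<le> 0"
      using s veq[OF X_in[OF x, of s]] l[OF X_in[OF x, of s]] by (auto simp: at_within_Icc_interior)
  next
    show "continuous_on {0..t} (\<lambda>t. v (X x t))"
      by (rule continuous_on_subset[OF continuous_on_along[OF Ck_on_imp_continuous_on[OF v] x]]) auto
  qed
  then show ?thesis by (simp add: X_zero x)
qed

lemma value_nonneg:
  assumes x: "x \<in> \<Omega>"
  shows "0 \<le> v x"
proof -
  have "isCont v 0"
    using Ck_on_imp_continuous_on[OF v] open_dom zero_in_dom by (auto simp: continuous_on_eq_continuous_at)
  from isCont_tendsto_compose[OF this X_lim[OF x]] have "((\<lambda>t. v (X x t)) \<longlongrightarrow> 0) at_top"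
    by (simp add: v0)
  then show ?thesis
    by (rule tendsto_upperbound[OF _ eventually_mono[OF eventually_ge_at_top[of 0] value_decreasing[OF x]]]) auto
qed

text \<open>If \<open>v\<close> vanished at \<open>x\<close>, it would vanish along the whole
  trajectory, being nonnegative and nonincreasing there; its derivative at time \<open>0\<close>
  would then make the cost at \<open>x\<close> zero.\<close>

lemma value_pos:
  assumes x: "x \<in> \<Omega>" "x \<noteq> 0"
  shows "0 < v x"
proof (rule ccontr)
  assume "\<not> 0 < v x"
  then have vx: "v x = 0" using value_nonneg[OF x(1)] by simp
  have zero: "v (X x t) = 0" if "t \<in> {0..}" for t
    using value_decreasing[OF x(1), of t] value_nonneg[OF X_in[OF x(1)], of t] that vx by auto
  have "- l x = 0"
  proof (rule vector_derivative_unique_within[of 0 "{0..}" "\<lambda>t. v (X x t)"])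
    show "at (0::real) within {0..} \<noteq> bot"
      using at_within_atLeast_eq[of 0 1] by (simp add: at_within_Icc_at_right)
    show "((\<lambda>t. v (X x t)) has_vector_derivative - l x) (at 0 within {0..})"
      using along_flow_der[OF v x(1) order_refl] veq[OF x(1)]
      by (simp add: X_zero x has_real_derivative_iff_has_vector_derivative)
    show "((\<lambda>t. v (X x t)) has_vector_derivative 0) (at 0 within {0..})"
      by (rule has_vector_derivative_transform[OF _ zero has_vector_derivative_const]) auto
  qed
  then show False using lpos[OF x] by simp
qed

text \<open>Nothing is known about \<open>v\<close> near the boundary of the domain. But a
  trajectory that starts outside a small sphere must cross it on the way to \<open>0\<close>, and
  \<open>v\<close> does not increase along it; so the minimum over the sphere bounds all values
  outside from below.\<close>

lemma value_sublevel_small: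
  assumes "0 < \<rho>"
  obtains c where "0 < c" "\<And>x. x \<in> \<Omega> \<Longrightarrow> v x < c \<Longrightarrow> norm x < \<rho>"
proof -
  obtain \<rho>' where \<rho>': "0 < \<rho>'" "cball 0 \<rho>' \<subseteq> \<Omega>"
    using open_dom zero_in_dom open_contains_cball by blast
  define s where "s = min \<rho> \<rho>'"
  have s: "0 < s" "s \<le> \<rho>" "cball 0 s \<subseteq> \<Omega>" using assms \<rho>' by (auto simp: s_def)
  then have sub: "sphere 0 s \<subseteq> \<Omega>" by (auto simp: subset_iff)
  have "sphere (0::'a) s \<noteq> {}" using s(1) by simp
  moreover have "continuous_on (sphere 0 s) v"
    using Ck_on_imp_continuous_on[OF v] sub by (rule continuous_on_subset)
  ultimately obtain y where y: "y \<in> sphere 0 s" "\<And>z. z \<in> sphere 0 s \<Longrightarrow> v y \<le> v z"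
    using continuous_attains_inf[of "sphere 0 s" v] by auto
  have "0 < v y" using y(1) s sub by (intro value_pos) auto
  moreover have "norm x < \<rho>" if x: "x \<in> \<Omega>" "v x < v y" for x
  proof (rule ccontr)
    assume "\<not> norm x < \<rho>"
    then have big: "s \<le> norm (X x 0)" using s by (simp add: X_zero x)
    have "((\<lambda>t. norm (X x t)) \<longlongrightarrow> 0) at_top" using tendsto_norm[OF X_lim[OF x(1)]] by simp
    then have "\<forall>\<^sub>F t in at_top. norm (X x t) < s" by (rule order_tendstoD) (rule s)
    then have "\<forall>\<^sub>F t in at_top. 0 \<le> t \<and> norm (X x t) < s"
      using eventually_ge_at_top by (rule eventually_conj[rotated])
    then obtain T where T: "0 \<le> T" "norm (X x T) < s" by (auto dest!: eventually_happens)
    have "continuous_on {0..T} (\<lambda>t. norm (X x t))"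
      using continuous_on_norm[OF X_continuous[OF x(1)]] by (rule continuous_on_subset) auto
    then obtain t where t: "0 \<le> t" "t \<le> T" "norm (X x t) = s"
      using IVT2'[of "\<lambda>t. norm (X x t)" T s 0] big T by auto
    then have "v y \<le> v (X x t)" by (intro y(2)) simp
    also have "\<dots> \<le> v x" by (rule value_decreasing[OF x(1) t(1)])
    finally show False using x(2) by simp
  qed
  ultimately show ?thesis by (rule that)
qed

end

end

section \<open>Lyapunov functions for a perturbed vector field\<close>

text \<open>A cut-off at distance \<open>e\<close> from \<open>K\<close> makes the field globally
  Lipschitz, so that solutions exist for all times before it is known that they stay in
  \<open>K\<close>.\<close>

lemma lipschitz_extension:
  fixes F :: "'a::euclidean_space \<Rightarrow> 'a"
  assumes "open \<Omega>" "Ck_on 1 F \<Omega>" "compact K" "K \<subseteq> \<Omega>"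
  shows "\<exists>G k. (\<forall>x\<in>K. G x = F x) \<and> k-lipschitz_on UNIV G"
proof (cases "K = {}")
  case True
  then show ?thesis by (intro exI[of _ "\<lambda>_. 0"] exI[of _ 0]) (simp add: lipschitz_on_def)
next
  case False
  obtain e where e: "0 < e" "(\<Union>x\<in>K. cball x e) \<subseteq> \<Omega>"
    using compact_subset_open_imp_cball_epsilon_subset[OF assms(3,1,4)] by blast
  define K1 where "K1 = (\<Union>x\<in>K. cball x e)"
  have K1: "compact K1" "K1 \<subseteq> \<Omega>"
    using compact_minkowski_sum_cball[OF assms(3)] e by (auto simp: K1_def)
  obtain L where L: "0 \<le> L" "L-lipschitz_on K1 F"
    using C1_lipschitz_on_compact[OF assms(1,2) K1] by blast
  have "continuous_on K1 F" using L(2) by (rule lipschitz_on_continuous_on)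
  then have "bounded (F ` K1)" by (intro compact_imp_bounded compact_continuous_image K1(1))
  then obtain M where M: "0 < M" "\<And>y. y \<in> K1 \<Longrightarrow> norm (F y) \<le> M" unfolding bounded_pos by blast
  define \<theta> where "\<theta> = (\<lambda>x. max 0 (1 - infdist x K / e))"
  have \<theta>_lip: "\<bar>\<theta> x - \<theta> z\<bar> \<le> dist x z / e" for x z
  proof -
    have "\<bar>infdist x K - infdist z K\<bar> \<le> dist x z"
      using infdist_triangle[of x K z] infdist_triangle[of z K x] by (simp add: dist_commute abs_le_iff)
    then have "\<bar>infdist x K / e - infdist z K / e\<bar> \<le> dist x z / e"
      using e(1) by (simp add: divide_right_mono flip: diff_divide_distrib)
    then show ?thesis by (auto simp: \<theta>_def max_def)
  qed
  have \<theta>_01: "0 \<le> \<theta> x" "\<theta> x \<le> 1" for x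
    using infdist_nonneg[of x K] e(1) by (auto simp: \<theta>_def)
  have \<theta>_out: "\<theta> x = 0" if "x \<notin> K1" for x
  proof -
    obtain y where "y \<in> K" "infdist x K = dist x y"
      using infdist_attains_inf[OF compact_imp_closed[OF assms(3)] False] by blast
    then have "e < infdist x K" using that by (force simp: K1_def dist_commute)
    then show ?thesis using e(1) by (simp add: \<theta>_def)
  qed
  define G where "G = (\<lambda>x. \<theta> x *\<^sub>R F x)"
  \<comment> \<open>The difference is split so that the increment of the cut-off meets
    \<open>F x\<close>, which is bounded for \<open>x\<close> near \<open>K\<close>; a difference of
    values of \<open>F\<close> occurs only if \<open>z\<close> is near \<open>K\<close> as
    well.\<close>
  have one: "norm (G x - G z) \<le> (M / e + L) * dist x z" if x: "x \<in> K1" for x z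
  proof (cases "z \<in> K1")
    case True
    have "G x - G z = (\<theta> x - \<theta> z) *\<^sub>R F x + \<theta> z *\<^sub>R (F x - F z)"
      by (simp add: G_def algebra_simps)
    then have "norm (G x - G z) \<le> \<bar>\<theta> x - \<theta> z\<bar> * norm (F x) + \<theta> z * norm (F x - F z)"
      using norm_triangle_ineq[of "(\<theta> x - \<theta> z) *\<^sub>R F x" "\<theta> z *\<^sub>R (F x - F z)"] \<theta>_01 by simp
    also have "\<dots> \<le> (dist x z / e) * M + 1 * (L * dist x z)"
      using \<theta>_lip M x \<theta>_01 L lipschitz_onD[OF L(2) x True] e(1)
      by (intro add_mono mult_mono) (auto simp: dist_norm)
    finally show ?thesis by (simp add: algebra_simps)
  next
    case False
    have "norm (G x - G z) = \<bar>\<theta> x - \<theta> z\<bar> * norm (F x)"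
      using \<theta>_out[OF False] \<theta>_01 by (simp add: G_def)
    also have "\<dots> \<le> (dist x z / e) * M"
      using \<theta>_lip M x e(1) by (intro mult_mono) auto
    also have "\<dots> \<le> (M / e + L) * dist x z"
      using L(1) by (simp add: algebra_simps)
    finally show ?thesis .
  qed
  have "(M / e + L)-lipschitz_on UNIV G"
  proof (rule lipschitz_onI)
    show "0 \<le> M / e + L" using M L e by simp
    fix x z
    consider "x \<in> K1" | "z \<in> K1" | "x \<notin> K1" "z \<notin> K1" by blast
    then show "dist (G x) (G z) \<le> (M / e + L) * dist x z"
    proof cases
      case 1 then show ?thesis using one[of x z] by (simp add: dist_norm)
    next
      case 2 then show ?thesis using one[of z x] by (simp add: dist_norm norm_minus_commute)
    next
      case 3
      then have "G x = 0" "G z = 0" using \<theta>_out by (simp_all add: G_def)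
      then show ?thesis using M L e by simp
    qed
  qed
  moreover have "G x = F x" if "x \<in> K" for x
    using that by (simp add: G_def \<theta>_def)
  ultimately show ?thesis by blast
qed

lemma lyapunov_decreasing:
  fixes v :: "'a::euclidean_space \<Rightarrow> real"
  assumes v: "Ck_on (Suc 0) v \<Omega>"
    and \<phi>: "\<And>t. 0 \<le> t \<Longrightarrow> t \<le> T \<Longrightarrow> \<phi> t \<in> \<Omega>" "continuous_on {0..T} \<phi>"
    and der: "\<And>t. 0 < t \<Longrightarrow> t < T \<Longrightarrow> (\<phi> has_vector_derivative \<phi>' t) (at t)"
    and le: "\<And>t. 0 < t \<Longrightarrow> t < T \<Longrightarrow> bderiv v (\<phi> t) (\<phi>' t) \<le> - m"
    and T: "0 \<le> T"
  shows "v (\<phi> T) \<le> v (\<phi> 0) - m * T"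
proof -
  have "(\<lambda>t. v (\<phi> t) + m * t) T \<le> (\<lambda>t. v (\<phi> t) + m * t) 0"
  proof (rule DERIV_nonpos_imp_decreasing_open[OF T])
    fix s assume s: "0 < s" "s < T"
    have "((\<lambda>t. v (\<phi> t) + m * t) has_real_derivative bderiv v (\<phi> s) (\<phi>' s) + m) (at s)"
      using has_real_derivative_along_curve[OF v _ der[OF s]] \<phi>(1)[of s] s
      by (auto intro!: derivative_eq_intros)
    then show "\<exists>y. ((\<lambda>t. v (\<phi> t) + m * t) has_real_derivative y) (at s) \<and> y \<le> 0"
      using le[OF s] by (intro exI[of _ "bderiv v (\<phi> s) (\<phi>' s) + m"]) simp
  next
    show "continuous_on {0..T} (\<lambda>t. v (\<phi> t) + m * t)"
      by (intro continuous_intros continuous_on_compose2[OF Ck_on_imp_continuous_on[OF v] \<phi>(2)])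
        (use \<phi>(1) in auto)
  qed
  then show ?thesis by simp
qed

text \<open>The extended field has a global solution. At a first exit time the state is in
  \<open>closure S\<close>, hence still in the domain of \<open>v\<close>, and \<open>v\<close> has
  not increased up to then; so the state is in \<open>S\<close> after all. Thus the solution never
  sees where the extension differs from \<open>F\<close>.\<close>

lemma trapped_solution:
  fixes v :: "'a::euclidean_space \<Rightarrow> real"
  assumes \<Omega>: "open \<Omega>" and F: "Ck_on 1 F \<Omega>" and v: "Ck_on (Suc 0) v \<Omega>"
    and S: "S = {x\<in>\<Omega>. v x < c}" "compact (closure S)" "closure S \<subseteq> \<Omega>"
    and le: "\<And>x. x \<in> \<Omega> \<Longrightarrow> bderiv v x (F x) \<le> 0" and x: "x \<in> S"
  shows "\<exists>\<phi>. \<phi> 0 = x \<and> (\<forall>t\<ge>0. \<phi> t \<in> S \<and> (\<phi> has_vector_derivative F (\<phi> t)) (at t within {0..}))"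
proof -
  obtain G k where G: "\<And>x. x \<in> closure S \<Longrightarrow> G x = F x" "k-lipschitz_on UNIV G"
    using lipschitz_extension[OF \<Omega> F S(2,3)] by blast
  have "\<exists>\<phi>. \<phi> 0 = x \<and> (\<forall>t\<ge>0. (\<phi> has_vector_derivative G (\<phi> t)) (at t within {0..}))"
  proof (rule picard_lindeloef_global[where k = k and M = "norm (G 0)" and G = "\<lambda>_. G"])
    show "continuous_on ({0..} \<times> UNIV) (\<lambda>(t :: real, y). G y)"
      using continuous_on_compose2[OF lipschitz_on_continuous_on[OF G(2)] continuous_on_snd[OF continuous_on_id]]
      by (simp add: split_beta)
    show "norm (G y - G z) \<le> k * norm (y - z)" for y z
      using lipschitz_onD[OF G(2), of y z] by (simp add: dist_norm)
  qed simp
  then obtain \<phi> where \<phi>: "\<phi> 0 = x" "\<And>t. 0 \<le> t \<Longrightarrow> (\<phi> has_vector_derivative G (\<phi> t)) (at t within {0..})"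
    by blast
  have cont: "continuous_on {0..} \<phi>"
    by (rule has_vector_derivative_imp_continuous_on[where f' = "\<lambda>t. G (\<phi> t)"]) (use \<phi> in auto)
  have S_open: "open S"
    unfolding S(1) using continuous_open_preimage[OF Ck_on_imp_continuous_on[OF v] \<Omega> open_lessThan[of c]]
    by (simp add: vimage_def Int_def conj_commute)
  have in_S: "\<phi> t \<in> S" if "0 \<le> t" for t
  proof (rule stays_in_open[OF continuous_on_subset[OF cont] S_open, where T = t])
    fix s assume s: "0 < s" "s \<le> t" and before: "\<And>\<tau>. 0 \<le> \<tau> \<Longrightarrow> \<tau> < s \<Longrightarrow> \<phi> \<tau> \<in> S"
    \<comment> \<open>The state is a limit of earlier ones; at this point the closure of the
      sublevel set, not just the set, has to lie in \<open>\<Omega>\<close>.\<close>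
    have "\<phi> s \<in> closure S"
    proof -
      have "(\<phi> \<longlongrightarrow> \<phi> s) (at s within {0..s})"
        using continuous_on_subset[OF cont, of "{0..s}"] s(1) by (auto simp: continuous_on_def)
      then have "(\<phi> \<longlongrightarrow> \<phi> s) (at s within {0..<s})"
        by (rule tendsto_within_subset) auto
      moreover have "at s within {0..<s} \<noteq> bot"
        using s(1) islimpt_greaterThanLessThan2[of 0 s] islimpt_subset[of s "{0<..<s}" "{0..<s}"]
        by (auto simp: trivial_limit_within)
      moreover have "\<forall>\<^sub>F \<tau> in at s within {0..<s}. \<phi> \<tau> \<in> closure S"
        unfolding eventually_at_filter using before closure_subset by (auto intro!: always_eventually)
      ultimately show ?thesis by (intro Lim_in_closed_set[OF closed_closure])
    qed
    then have sO: "\<phi> s \<in> \<Omega>" using S(3) by blast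
    have in_dom: "\<phi> \<tau> \<in> \<Omega>" if "0 \<le> \<tau>" "\<tau> \<le> s" for \<tau>
      using sO before[of \<tau>] that by (cases "\<tau> = s") (auto simp: S(1))
    have "v (\<phi> s) \<le> v (\<phi> 0) - 0 * s"
    proof (rule lyapunov_decreasing[OF v])
      fix \<tau> assume \<tau>: "0 < \<tau>" "\<tau> < s"
      have "(\<phi> has_vector_derivative G (\<phi> \<tau>)) (at \<tau> within {0..s})"
        by (rule has_vector_derivative_within_subset[OF \<phi>(2)]) (use \<tau> in auto)
      then show "(\<phi> has_vector_derivative G (\<phi> \<tau>)) (at \<tau>)"
        using \<tau> by (simp add: at_within_Icc_interior)
      have "\<phi> \<tau> \<in> S" using before \<tau> by simp
      then show "bderiv v (\<phi> \<tau>) (G (\<phi> \<tau>)) \<le> - 0"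
        using G(1)[of "\<phi> \<tau>"] le[of "\<phi> \<tau>"] closure_subset[of S] by (auto simp: S(1))
    qed (use in_dom s cont in \<open>auto elim: continuous_on_subset\<close>)
    then show "\<phi> s \<in> S" using sO x \<phi>(1) by (simp add: S(1))
  qed (use that x \<phi>(1) in auto)
  then show ?thesis
    using \<phi> G(1) closure_subset[of S] by (intro exI[of _ \<phi>]) (auto simp: subset_iff)
qed

context stable_flow
begin

text \<open>In the application \<open>d y\<close> is the norm of the difference of the two
  controllers at \<open>y\<close>. The change of the field is linear in it, whereas the decay of
  \<open>v\<close> is quadratic, so Young's inequality balances the two.\<close>

lemma perturbed_exponential_stability:
  fixes v d :: "'a \<Rightarrow> real" and F' :: "'a \<Rightarrow> 'a"
  assumes v: "Ck_on (Suc (Suc 0)) v \<Omega>" and v0: "v 0 = 0" and vpos: "\<And>y. y \<in> \<Omega> \<Longrightarrow> 0 \<le> v y"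
    and F': "0 < \<rho>\<^sub>0" "\<And>y. y \<in> \<Omega> \<Longrightarrow> norm y \<le> \<rho>\<^sub>0 \<Longrightarrow> norm (F' y - F y) \<le> N * d y" "0 < N" "\<And>y. 0 \<le> d y"
    and dec: "0 < l" "\<And>y. y \<in> \<Omega> \<Longrightarrow> bderiv v y (F' y) \<le> - l * (d y)\<^sup>2"
  shows "\<exists>\<epsilon>>0. \<exists>C>0. \<exists>\<nu>>0. ball 0 \<epsilon> \<subseteq> \<Omega> \<and>
    (\<forall>\<phi>. (\<forall>t\<ge>0. \<phi> t \<in> \<Omega> \<and> (\<phi> has_vector_derivative F' (\<phi> t)) (at t within {0..})) \<longrightarrow>
      \<phi> 0 \<in> ball 0 \<epsilon> \<longrightarrow> (\<forall>t\<ge>0. norm (\<phi> t) \<le> C * exp (- \<nu> * t) * norm (\<phi> 0)))"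
proof -
  obtain B \<epsilon> \<mu> \<rho> where B: "bounded_bilinear B" and sym: "\<And>y z. B y z = (B z y :: real)"
    and pos: "0 < \<epsilon>" "0 < \<mu>" "0 < \<rho>" and \<rho>: "cball 0 \<rho> \<subseteq> \<Omega>"
    and low: "\<And>y. \<epsilon> * (norm y)\<^sup>2 \<le> B y y"
    and D: "\<And>x y. x \<in> cball 0 \<rho> \<Longrightarrow> B (bderiv F x y) y \<le> - \<mu> * B y y"
    and con: "\<And>x z. x \<in> cball 0 \<rho> \<Longrightarrow> z \<in> cball 0 \<rho> \<Longrightarrow> B (F x - F z) (x - z) \<le> - \<mu> * B (x - z) (x - z)"
    by (rule quadratic_contraction) (rule that)
  interpret B: bounded_bilinear B by (rule B)
  obtain M where M: "\<And>y z. norm (B y z) \<le> norm y * norm z * M" "0 < M"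
    using B.pos_bounded by metis
  have v1: "Ck_on (Suc 0) v \<Omega>" by (rule Ck_on_SucD[OF v])
  have "Ck_on (Suc 0) (bderiv v) \<Omega>" by (rule Ck_on_bderiv[OF open_dom v])
  from has_derivative_bderiv[OF this zero_in_dom]
  obtain r2 where r2: "0 < r2" "\<And>y. norm y < r2 \<Longrightarrow>
      norm (bderiv v y - bderiv v 0 - bderiv (bderiv v) 0 y) \<le> 1 * norm y"
    unfolding has_derivative_at_alt by (auto dest!: spec[of _ 1])
  \<comment> \<open>\<open>v\<close> is nonnegative and vanishes at \<open>0\<close>, so its
    derivative vanishes there and \<open>v\<close> is at most quadratic near
    \<open>0\<close>.\<close>
  have grad0: "bderiv v 0 = 0"
  proof -
    have "blinfun_apply (bderiv v 0) = (\<lambda>h. 0)"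
    proof (rule has_derivative_local_min[OF has_derivative_bderiv[OF v1 zero_in_dom]])
      show "\<forall>\<^sub>F y in at 0. v 0 \<le> v y"
        using eventually_at_in_open[OF open_dom zero_in_dom]
        by eventually_elim (simp add: v0 vpos)
    qed
    then show ?thesis by (intro blinfun_eqI) simp
  qed
  define Nv where "Nv = 1 + norm (bderiv (bderiv v) 0)"
  have grad_le: "norm (bderiv v y) \<le> Nv * norm y" if "norm y < r2" for y
  proof -
    have "norm (bderiv v y) \<le> norm (bderiv v y - bderiv (bderiv v) 0 y) + norm (bderiv (bderiv v) 0 y)"
      by (metis add.commute diff_add_cancel norm_triangle_ineq)
    also have "\<dots> \<le> norm y + norm (bderiv (bderiv v) 0) * norm y"
      using r2(2)[OF that] norm_blinfun[of "bderiv (bderiv v) 0" y] by (simp add: grad0)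
    finally show ?thesis by (simp add: Nv_def algebra_simps)
  qed
  define r where "r = min (min (r2 / 2) \<rho>) \<rho>\<^sub>0"
  have r: "0 < r" "r < r2" "r \<le> \<rho>" "r \<le> \<rho>\<^sub>0" "cball 0 r \<subseteq> \<Omega>"
    using r2(1) pos F'(1) \<rho> by (auto simp: r_def)
  have v_le: "v y \<le> Nv * (norm y)\<^sup>2" if y: "norm y \<le> r" for y
  proof -
    have "norm (v y - v 0) \<le> (Nv * norm y) * norm (y - 0)"
    proof (rule differentiable_bound[where S = "cball 0 (norm y)" and f' = "\<lambda>z. bderiv v z"])
      fix z :: 'a assume z: "z \<in> cball 0 (norm y)"
      then have "z \<in> cball 0 r" using y by auto
      then have "z \<in> \<Omega>" using r(5) by blast
      from has_derivative_bderiv[OF v1 this]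
      show "(v has_derivative bderiv v z) (at z within cball 0 (norm y))" by (rule has_derivative_at_withinI)
      have "norm (bderiv v z) \<le> Nv * norm z" using z y r by (intro grad_le) auto
      also have "\<dots> \<le> Nv * norm y" using z by (intro mult_left_mono) (auto simp: Nv_def)
      finally show "onorm (bderiv v z) \<le> Nv * norm y" by (simp add: norm_blinfun.rep_eq)
    qed auto
    then show ?thesis by (simp add: v0 power2_eq_square abs_le_iff)
  qed
  define s where "s = \<mu> * \<epsilon>"
  have s: "0 < s" using pos by (simp add: s_def)
  \<comment> \<open>The value for which Young's inequality for the cross term
    \<open>2 * (N * d y * norm y * M)\<close> leaves \<open>s * (norm y)\<^sup>2\<close>, which half
    of the decay of \<open>B\<close> covers.\<close>
  define \<kappa> where "\<kappa> = (M * N)\<^sup>2 / (s * l)"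
  have \<kappa>: "0 < \<kappa>" using M(2) F'(3) s dec(1) by (simp add: \<kappa>_def)
  \<comment> \<open>\<open>v\<close> alone need not dominate a quadratic: the cost may be flat at 0.\<close>
  define W where "W = (\<lambda>y. B y y + \<kappa> * v y)"
  \<comment> \<open>The summand \<open>\<epsilon>\<close> ensures
    \<open>\<epsilon> \<le> Cw\<close>, so that \<open>\<epsilon>'\<close> below does not exceed
    \<open>r\<close>.\<close>
  define Cw where "Cw = M + \<kappa> * Nv + \<epsilon>"
  have Nv: "0 < Nv" by (simp add: Nv_def add_pos_nonneg)
  have Cw: "0 < Cw" "\<epsilon> \<le> Cw" using M(2) \<kappa> Nv pos by (auto simp: Cw_def add_pos_pos)
  have W_up: "W y \<le> Cw * (norm y)\<^sup>2" if "norm y \<le> r" for y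
  proof -
    have "B y y \<le> M * (norm y)\<^sup>2" using M(1)[of y y] by (simp add: power2_eq_square mult_ac)
    moreover have "\<kappa> * v y \<le> \<kappa> * (Nv * (norm y)\<^sup>2)"
      using v_le[OF that] \<kappa> by (intro mult_left_mono) auto
    moreover have "0 \<le> \<epsilon> * (norm y)\<^sup>2" using pos by simp
    ultimately show ?thesis unfolding W_def Cw_def distrib_right mult.assoc by linarith
  qed
  have W_low: "\<epsilon> * (norm y)\<^sup>2 \<le> W y" if "y \<in> \<Omega>" for y
    using low[of y] vpos[OF that] mult_nonneg_nonneg[of \<kappa> "v y"] \<kappa> unfolding W_def by linarith
  define \<beta> where "\<beta> = s / Cw"
  have \<beta>: "0 < \<beta>" using s Cw by (simp add: \<beta>_def)
  have W_dec: "2 * B (F' y) y + \<kappa> * bderiv v y (F' y) \<le> - \<beta> * W y" if y: "norm y \<le> r" for y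
  proof -
    have "y \<in> cball 0 r" using y by simp
    then have yO: "y \<in> \<Omega>" using r(5) by blast
    have "B (F y) y \<le> - \<mu> * B y y" using con[of y 0] y r pos by (simp add: F_zero)
    moreover have "B (F' y - F y) y \<le> N * d y * norm y * M"
    proof -
      have "B (F' y - F y) y \<le> norm (F' y - F y) * norm y * M" using M(1)[of "F' y - F y" y] by simp
      also have "\<dots> \<le> N * d y * norm y * M"
        using F'(2)[OF yO] y r M(2) by (intro mult_right_mono) auto
      finally show ?thesis .
    qed
    moreover have "2 * (N * d y * norm y * M) \<le> s * (norm y)\<^sup>2 + \<kappa> * l * (d y)\<^sup>2"
    proof -
      have "0 \<le> (s * norm y - M * N * d y)\<^sup>2 / s" using s by simp
      also have "\<dots> = s * (norm y)\<^sup>2 - 2 * (N * d y * norm y * M) + (M * N)\<^sup>2 / s * (d y)\<^sup>2"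
        using s by (simp add: power2_eq_square field_simps)
      also have "(M * N)\<^sup>2 / s = \<kappa> * l" using dec(1) s by (simp add: \<kappa>_def)
      finally show ?thesis by simp
    qed
    moreover have "s * (norm y)\<^sup>2 \<le> \<mu> * B y y"
      using mult_left_mono[OF low, of \<mu> y] pos by (simp add: s_def mult.assoc)
    moreover have "\<kappa> * bderiv v y (F' y) \<le> - (\<kappa> * l * (d y)\<^sup>2)"
      using mult_left_mono[OF dec(2)[OF yO], of \<kappa>] \<kappa> by (simp add: mult.assoc)
    moreover have "\<beta> * W y \<le> s * (norm y)\<^sup>2"
      using mult_left_mono[OF W_up[OF y], of \<beta>] \<beta> Cw by (simp add: \<beta>_def)
    ultimately show ?thesis by (simp add: B.diff_left)
  qed
  \<comment> \<open>Starting in this ball, \<open>W\<close> is below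
    \<open>\<epsilon> * r\<^sup>2\<close>; by \<open>W_low\<close> that level confines the state to
    the ball of radius \<open>r\<close>, where \<open>W_dec\<close> holds.\<close>
  define \<epsilon>' where "\<epsilon>' = r * sqrt (\<epsilon> / Cw)"
  have \<epsilon>'_pos: "0 < \<epsilon>'" using r pos Cw by (simp add: \<epsilon>'_def)
  have \<epsilon>'_sq: "Cw * \<epsilon>'\<^sup>2 = \<epsilon> * r\<^sup>2" using pos Cw by (simp add: \<epsilon>'_def power_mult_distrib)
  have "sqrt (\<epsilon> / Cw) \<le> 1" using pos Cw by simp
  then have \<epsilon>'_r: "\<epsilon>' \<le> r" using r(1) mult_left_mono[of "sqrt (\<epsilon> / Cw)" 1 r] by (simp add: \<epsilon>'_def)
  have main: "norm (\<phi> t) \<le> sqrt (Cw / \<epsilon>) * exp (- (\<beta> / 2) * t) * norm (\<phi> 0)"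
    if \<phi>: "\<forall>t\<ge>0. \<phi> t \<in> \<Omega> \<and> (\<phi> has_vector_derivative F' (\<phi> t)) (at t within {0..})"
      and x: "\<phi> 0 \<in> ball 0 \<epsilon>'" and t: "0 \<le> t" for \<phi> t
  proof -
    have init: "W (\<phi> 0) < \<epsilon> * r\<^sup>2"
    proof -
      have n: "norm (\<phi> 0) < \<epsilon>'" using x by simp
      have "W (\<phi> 0) \<le> Cw * (norm (\<phi> 0))\<^sup>2" using n \<epsilon>'_r by (intro W_up) auto
      also have "\<dots> < Cw * \<epsilon>'\<^sup>2" using n Cw by (intro mult_strict_left_mono power_strict_mono) auto
      finally show ?thesis by (simp add: \<epsilon>'_sq)
    qed
    have W0: "0 \<le> W (\<phi> 0)" using order_trans[OF _ W_low[of "\<phi> 0"], of 0] \<phi> pos by simp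
    have "W (\<phi> t) \<le> W (\<phi> 0) * exp (- \<beta> * t)"
    proof (rule exp_barrier(2)[where T = t and r = "\<epsilon> * r\<^sup>2" and s = "\<lambda>t. W (\<phi> t)" and c = "- \<beta>"])
      fix \<tau> assume \<tau>: "0 \<le> \<tau>" "\<tau> \<le> t"
      then have \<phi>\<tau>: "\<phi> \<tau> \<in> \<Omega>" "(\<phi> has_vector_derivative F' (\<phi> \<tau>)) (at \<tau> within {0..t})"
        using \<phi> by (auto intro: has_vector_derivative_within_subset)
      have "((\<lambda>t. B (\<phi> t) (\<phi> t)) has_real_derivative 2 * B (F' (\<phi> \<tau>)) (\<phi> \<tau>)) (at \<tau> within {0..t})"
        using B.has_vector_derivative[OF \<phi>\<tau>(2) \<phi>\<tau>(2)]
        by (simp add: has_real_derivative_iff_has_vector_derivative sym[of "\<phi> \<tau>" "F' (\<phi> \<tau>)"])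
      from DERIV_add[OF this DERIV_cmult[OF has_real_derivative_along_curve[OF v1 \<phi>\<tau>], of \<kappa>]]
      show "((\<lambda>t. W (\<phi> t)) has_real_derivative 2 * B (F' (\<phi> \<tau>)) (\<phi> \<tau>) + \<kappa> * bderiv v (\<phi> \<tau>) (F' (\<phi> \<tau>)))
          (at \<tau> within {0..t})"
        by (simp add: W_def)
      assume "W (\<phi> \<tau>) < \<epsilon> * r\<^sup>2"
      then have "\<epsilon> * (norm (\<phi> \<tau>))\<^sup>2 < \<epsilon> * r\<^sup>2" using W_low[OF \<phi>\<tau>(1)] by simp
      then have "(norm (\<phi> \<tau>))\<^sup>2 < r\<^sup>2" using pos by simp
      then have "norm (\<phi> \<tau>) < r" by (rule power2_less_imp_less) (use r in simp)
      then show "2 * B (F' (\<phi> \<tau>)) (\<phi> \<tau>) + \<kappa> * bderiv v (\<phi> \<tau>) (F' (\<phi> \<tau>)) \<le> - \<beta> * W (\<phi> \<tau>)"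
        by (intro W_dec) simp
    next
      fix \<tau> assume \<tau>: "0 \<le> \<tau>" "\<tau> \<le> t"
      have "exp (- \<beta> * \<tau>) \<le> 1" using \<beta> \<tau> by simp
      from mult_left_mono[OF this W0] show "W (\<phi> 0) * exp (- \<beta> * \<tau>) < \<epsilon> * r\<^sup>2"
        using init by simp
    qed (use t in auto)
    also have "\<dots> \<le> Cw * (norm (\<phi> 0))\<^sup>2 * exp (- \<beta> * t)"
      using x \<epsilon>'_r by (intro mult_right_mono W_up) auto
    finally have "\<epsilon> * (norm (\<phi> t))\<^sup>2 \<le> Cw * (norm (\<phi> 0))\<^sup>2 * exp (- \<beta> * t)"
      using W_low[of "\<phi> t"] \<phi> t by fastforce
    then have "(norm (\<phi> t))\<^sup>2 \<le> Cw / \<epsilon> * ((norm (\<phi> 0))\<^sup>2 * exp (- \<beta> * t))"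
      using pos by (simp add: pos_le_divide_eq mult_ac)
    also have "\<dots> = (sqrt (Cw / \<epsilon>) * exp (- (\<beta> / 2) * t) * norm (\<phi> 0))\<^sup>2"
    proof -
      have "(exp (- (\<beta> / 2) * t))\<^sup>2 = exp (- \<beta> * t)"
        unfolding exp_double[symmetric] by simp
      then show ?thesis using Cw pos by (simp add: power_mult_distrib mult_ac)
    qed
    finally show ?thesis
      by (rule power2_le_imp_le) (use Cw pos in simp)
  qed
  have "ball 0 \<epsilon>' \<subseteq> \<Omega>" using r(5) \<epsilon>'_r by (auto simp: subset_iff)
  moreover have "0 < sqrt (Cw / \<epsilon>)" "0 < \<beta> / 2" using Cw pos \<beta> by auto
  ultimately show ?thesis using main \<epsilon>'_pos by blast
qed

text \<open>If \<open>v\<close> stayed above a level \<open>c\<close>, the state would remain in a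
  compact set without \<open>0\<close>, on which \<open>h\<close> has a positive minimum, and
  \<open>v\<close> would fall to zero in finite time. Hence \<open>v\<close> enters every sublevel
  set of positive level and stays there.\<close>

lemma lyapunov_convergence:
  fixes v l :: "'a \<Rightarrow> real"
  assumes v: "Ck_on (Suc 0) v \<Omega>" and v0: "v 0 = 0" and vpos: "\<And>y. y \<in> \<Omega> \<Longrightarrow> 0 \<le> v y"
    and small: "\<And>\<rho>. 0 < \<rho> \<Longrightarrow> \<exists>c>0. \<forall>y\<in>\<Omega>. v y < c \<longrightarrow> norm y < \<rho>"
    and h: "continuous_on \<Omega> h" "\<And>y. y \<in> \<Omega> \<Longrightarrow> y \<noteq> 0 \<Longrightarrow> 0 < h y" "h 0 = (0::real)"
    and dec: "\<And>y. y \<in> \<Omega> \<Longrightarrow> bderiv v y (F' y) \<le> - h y"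
    and K: "compact K" "K \<subseteq> \<Omega>"
    and \<phi>: "\<And>t. 0 \<le> t \<Longrightarrow> \<phi> t \<in> K \<and> (\<phi> has_vector_derivative F' (\<phi> t)) (at t within {0..})"
  shows "((\<lambda>t. norm (\<phi> t)) \<longlongrightarrow> 0) at_top"
proof -
  have cont: "continuous_on {0..} \<phi>"
    by (rule has_vector_derivative_imp_continuous_on[where f' = "\<lambda>t. F' (\<phi> t)"]) (use \<phi> in auto)
  have \<phi>O: "\<phi> t \<in> \<Omega>" if "0 \<le> t" for t using \<phi>[OF that] K by blast
  have der_at: "(\<phi> has_vector_derivative F' (\<phi> t)) (at t)" if "0 < t" for t
  proof -
    have "(\<phi> has_vector_derivative F' (\<phi> t)) (at t within {0..t+1})"
      by (rule has_vector_derivative_within_subset[of _ _ _ "{0..}"]) (use \<phi> that in auto)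
    then show ?thesis using that by (simp add: at_within_Icc_interior)
  qed
  have h0: "0 \<le> h y" if "y \<in> \<Omega>" for y using h(2)[OF that] h(3) by (cases "y = 0") auto
  have decr: "v (\<phi> t) \<le> v (\<phi> s) - m * (t - s)"
    if st: "0 \<le> s" "s \<le> t" and m: "\<And>\<tau>. s < \<tau> \<Longrightarrow> \<tau> < t \<Longrightarrow> m \<le> h (\<phi> \<tau>)" for s t m
  proof -
    have "v (\<phi> (s + (t - s))) \<le> v (\<phi> (s + 0)) - m * (t - s)"
    proof (rule lyapunov_decreasing[OF v, where \<phi> = "\<lambda>\<tau>. \<phi> (s + \<tau>)"])
      fix \<tau> assume \<tau>: "0 < \<tau>" "\<tau> < t - s"
      show "((\<lambda>\<tau>. \<phi> (s + \<tau>)) has_vector_derivative F' (\<phi> (s + \<tau>))) (at \<tau>)"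
      proof -
        have "((\<lambda>\<tau>. s + \<tau>) has_vector_derivative 1) (at \<tau>)"
          by (auto intro!: derivative_eq_intros)
        from vector_diff_chain_at[OF this der_at[of "s + \<tau>"]] st \<tau>
        show ?thesis by (simp add: o_def)
      qed
      show "bderiv v (\<phi> (s + \<tau>)) (F' (\<phi> (s + \<tau>))) \<le> - m"
        using dec[OF \<phi>O[of "s + \<tau>"]] m[of "s + \<tau>"] st \<tau> by simp
    next
      show "continuous_on {0..t - s} (\<lambda>\<tau>. \<phi> (s + \<tau>))"
        by (rule continuous_on_compose2[OF cont]) (use st in \<open>auto intro!: continuous_intros\<close>)
    qed (use st \<phi>O in auto)
    then show ?thesis by simp
  qed
  have reach: "\<exists>T\<ge>0. v (\<phi> T) < c" if c: "0 < c" for c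
  proof (rule ccontr)
    assume "\<not> (\<exists>T\<ge>0. v (\<phi> T) < c)"
    then have big: "c \<le> v (\<phi> t)" if "0 \<le> t" for t using that by force
    let ?A = "K \<inter> {y \<in> K. c \<le> v y}"
    have "closed {y \<in> K. c \<le> v y}"
    proof -
      have "continuous_on K v" using Ck_on_imp_continuous_on[OF v] K(2) by (rule continuous_on_subset)
      from continuous_closed_preimage[OF this compact_imp_closed[OF K(1)] closed_atLeast[of c]]
      show ?thesis by (simp add: vimage_def Int_def conj_commute)
    qed
    then have "compact ?A" by (rule compact_Int_closed[OF K(1)])
    moreover have "?A \<noteq> {}" using \<phi>[of 0] big[of 0] by auto
    moreover have "continuous_on ?A h" using h(1) by (rule continuous_on_subset) (use K in auto)
    ultimately obtain y where y: "y \<in> ?A" "\<And>z. z \<in> ?A \<Longrightarrow> h y \<le> h z"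
      using continuous_attains_inf[of ?A h] by auto
    have "y \<noteq> 0" using y(1) c v0 by auto
    then have hy: "0 < h y" using y(1) K by (intro h(2)) auto
    have lin: "v (\<phi> t) \<le> v (\<phi> 0) - h y * t" if "0 \<le> t" for t
    proof -
      have "v (\<phi> t) \<le> v (\<phi> 0) - h y * (t - 0)"
        by (rule decr) (use that \<phi> big in \<open>auto intro!: y(2)\<close>)
      then show ?thesis by simp
    qed
    define t where "t = v (\<phi> 0) / h y"
    have "0 \<le> t" using vpos[OF \<phi>O[of 0]] hy by (simp add: t_def)
    then show False using lin[of t] big[of t] hy c by (simp add: t_def)
  qed
  show ?thesis
  proof (rule tendstoI)
    fix \<rho> :: real assume "0 < \<rho>"
    then obtain c where c: "0 < c" "\<And>y. y \<in> \<Omega> \<Longrightarrow> v y < c \<Longrightarrow> norm y < \<rho>" using small by blast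
    obtain T where T: "0 \<le> T" "v (\<phi> T) < c" using reach[OF c(1)] by blast
    have "norm (\<phi> t) < \<rho>" if "T \<le> t" for t
    proof (rule c(2))
      have "v (\<phi> t) \<le> v (\<phi> T) - 0 * (t - T)"
        by (rule decr) (use T that h0 \<phi>O in auto)
      then show "v (\<phi> t) < c" using T by simp
    qed (use T that \<phi>O in auto)
    then show "\<forall>\<^sub>F t in at_top. dist (norm (\<phi> t)) 0 < \<rho>"
      unfolding eventually_at_top_linorder by auto
  qed
qed

end

section \<open>The policy iteration step\<close>

lemma bounded_bilinear_matrix_vector_mult:
  "bounded_bilinear ((*v) :: real^'m^'n \<Rightarrow> real^'m \<Rightarrow> real^'n)"
  unfolding bilinear_conv_bounded_bilinear[symmetric] bilinear_def
  by (auto intro!: linearI simp: matrix_vector_mult_def vec_eq_iff sum.distrib sum_distrib_left algebra_simps)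

lemma bounded_linear_transpose: "bounded_linear (transpose :: real^'m^'n \<Rightarrow> real^'n^'m)"
  unfolding linear_conv_bounded_linear[symmetric]
  by (auto intro!: linearI simp: transpose_def vec_eq_iff)

lemma blinfun_real_eq_inner:
  fixes A :: "'a::euclidean_space \<Rightarrow>\<^sub>L real"
  shows "A y = y \<bullet> (\<Sum>b\<in>Basis. A b *\<^sub>R b)"
proof -
  have "A y = A (\<Sum>b\<in>Basis. (y \<bullet> b) *\<^sub>R b)" by (simp add: euclidean_representation)
  also have "\<dots> = (\<Sum>b\<in>Basis. (y \<bullet> b) * A b)"
    by (simp only: blinfun.sum_right blinfun.scaleR_right real_scaleR_def)
  finally show ?thesis by (simp add: inner_sum_right mult.commute)
qed

lemma grad_eq:
  assumes "v differentiable (at x)"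
  shows "grad v x = (\<Sum>b\<in>Basis. bderiv v x b *\<^sub>R b)"
proof -
  let ?d = "\<Sum>b\<in>Basis. bderiv v x b *\<^sub>R b"
  have "blinfun_apply (bderiv v x) = (\<lambda>h. h \<bullet> ?d)" by (rule ext) (rule blinfun_real_eq_inner)
  then have G: "GDERIV v x :> ?d"
    using assms by (simp add: gderiv_def bderiv_apply frechet_derivative_works)
  show ?thesis
    unfolding grad_def
  proof (rule the_equality[where P = "\<lambda>d. GDERIV v x :> d", OF G])
    fix d assume "GDERIV v x :> d"
    from has_derivative_unique[OF this[unfolded gderiv_def] G[unfolded gderiv_def]]
    have "(d - ?d) \<bullet> d = (d - ?d) \<bullet> ?d" by (rule fun_cong)
    then have "(d - ?d) \<bullet> (d - ?d) = 0" by (simp only: inner_diff_right diff_self)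
    then show "d = ?d" by simp
  qed
qed

lemma inner_grad: "v differentiable (at x) \<Longrightarrow> y \<bullet> grad v x = bderiv v x y"
  by (simp add: grad_eq flip: blinfun_real_eq_inner)

lemma Ck_on_grad:
  assumes "open S" "Ck_on (Suc k) v S"
  shows "Ck_on k (grad v) S"
proof (rule Ck_on_cong[OF assms(1)])
  show "Ck_on k (\<lambda>x. \<Sum>b\<in>Basis. bderiv v x b *\<^sub>R b) S"
    by (intro Ck_on_sum assms Ck_on_bounded_linear[OF bounded_linear_scaleR_left]
        Ck_on_bounded_linear[OF blinfun.bounded_linear_left] Ck_on_bderiv)
  show "(\<Sum>b\<in>Basis. bderiv v x b *\<^sub>R b) = grad v x" if "x \<in> S" for x
    using grad_eq[of v x] assms(2) that by simp
qed

text \<open>The constant is the minimum of the form over the unit sphere, extended by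
  homogeneity.\<close>

lemma sym_pos_def_coercive:
  fixes R :: "real^'m^'m"
  assumes "sym_pos_def R"
  obtains l where "0 < l" "\<And>y. l * (norm y)\<^sup>2 \<le> y \<bullet> (R *v y)"
proof -
  have cont: "continuous_on (sphere 0 1) (\<lambda>y. y \<bullet> (R *v y))"
    by (intro continuous_intros linear_continuous_on matrix_vector_mul_bounded_linear)
  obtain e where e: "e \<in> sphere (0 :: real^'m) 1" "\<And>y. y \<in> sphere 0 1 \<Longrightarrow> e \<bullet> (R *v e) \<le> y \<bullet> (R *v y)"
    using continuous_attains_inf[OF compact_sphere _ cont] by auto
  let ?l = "e \<bullet> (R *v e)"
  show ?thesis
  proof
    have "e \<noteq> 0" using e(1) by auto
    then show "0 < ?l" using assms by (simp add: sym_pos_def_def)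
    fix y :: "real^'m"
    show "?l * (norm y)\<^sup>2 \<le> y \<bullet> (R *v y)"
    proof (cases "y = 0")
      case False
      let ?y = "inverse (norm y) *\<^sub>R y"
      have "?l \<le> ?y \<bullet> (R *v ?y)" using False by (intro e(2)) simp
      also have "\<dots> = inverse (norm y) * (inverse (norm y) * (y \<bullet> (R *v y)))"
        by (simp add: matrix_vector_mult_scaleR)
      finally show ?thesis using False by (simp add: field_simps power2_eq_square)
    qed simp
  qed
qed

lemma sym_pos_def_invertible:
  fixes R :: "real^'m^'m"
  assumes "sym_pos_def R"
  shows "invertible R"
proof -
  have "y = 0" if "R *v y = 0" for y
    using assms that by (metis inner_zero_right less_irrefl sym_pos_def_def)
  then show ?thesis
    using matrix_left_invertible_ker[of R] invertible_left_inverse by blast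
qed

lemma invertible_matrix_inv_right:
  fixes A :: "real^'n^'m"
  assumes "invertible A"
  shows "A ** matrix_inv A = mat 1"
  using someI_ex[OF assms[unfolded invertible_def]] unfolding matrix_inv_def by blast

lemma sym_pos_def_inner_commute:
  fixes R :: "real^'m^'m"
  assumes "sym_pos_def R"
  shows "a \<bullet> (R *v b) = b \<bullet> (R *v a)"
  using assms by (metis dot_lmul_matrix inner_commute sym_pos_def_def transpose_matrix_vector)

section \<open>One step of the iteration\<close>

context
  fixes f :: "real^'n \<Rightarrow> real^'n" and g :: "real^'n \<Rightarrow> real^'m^'n" and h :: "real^'n \<Rightarrow> real"
    and R :: "real^'m^'m" and u :: "real^'n \<Rightarrow> real^'m" and \<Omega> :: "(real^'n) set"
  assumes data: "data_assumption f g h R" and bounded_dom: "bounded \<Omega>"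
    and u_smooth: "smooth_on u \<Omega>" and adm: "admissible f g u \<Omega>"
begin

definition closed_loop :: "(real^'n \<Rightarrow> real^'m) \<Rightarrow> real^'n \<Rightarrow> real^'n"
  where "closed_loop w x = f x + g x *v w x"

definition running_cost :: "real^'n \<Rightarrow> real"
  where "running_cost x = h x + u x \<bullet> (R *v u x)"

lemma dom: "is_domain \<Omega>" "open \<Omega>" "0 \<in> \<Omega>" "u 0 = 0"
  using adm by (auto simp: admissible_def is_domain_def)

lemma R_pos: "sym_pos_def R" using data by (simp add: data_assumption_def)

lemma Ck_on_data: "Ck_on k f \<Omega>" "Ck_on k g \<Omega>" "Ck_on k h \<Omega>"
  using data Ck_on_subset[OF smooth_onD subset_UNIV] by (auto simp: data_assumption_def)

lemma Ck_on_closed_loop: "Ck_on k w \<Omega> \<Longrightarrow> Ck_on k (closed_loop w) \<Omega>"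
  unfolding closed_loop_def[abs_def]
  by (intro Ck_on_add Ck_on_bilinear[OF bounded_bilinear_matrix_vector_mult] dom(2) Ck_on_data)

lemma smooth_running_cost: "smooth_on running_cost \<Omega>"
  unfolding smooth_on_def running_cost_def[abs_def]
  by (intro allI Ck_on_add Ck_on_bilinear[OF bounded_bilinear_inner] dom(2) Ck_on_data smooth_onD[OF u_smooth]
      Ck_on_bounded_linear[OF matrix_vector_mul_bounded_linear])

lemma quadratic_nonneg: "0 \<le> y \<bullet> (R *v y)"
  using R_pos by (cases "y = 0") (auto simp: sym_pos_def_def intro: less_imp_le)

lemma running_cost_zero: "running_cost 0 = 0"
  using data dom by (simp add: running_cost_def data_assumption_def)

lemma running_cost_pos: "x \<noteq> 0 \<Longrightarrow> 0 < running_cost x"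
  using data quadratic_nonneg[of "u x"] unfolding running_cost_def data_assumption_def
  by (meson add_pos_nonneg)

text \<open>The flow is existentially quantified in \<open>admissible\<close>, so the locale is
  interpreted afresh inside each proof that uses trajectories.\<close>

lemma stable_flow_exists: "\<exists>X. stable_flow (closed_loop u) \<Omega> X"
proof -
  obtain X where flow: "is_closed_loop_flow f g u \<Omega> X"
    and lim: "\<forall>x\<in>\<Omega>. ((\<lambda>t. norm (X x t)) \<longlongrightarrow> 0) at_top"
    and exp: "\<exists>\<epsilon>>0. \<exists>C>0. \<exists>\<nu>>0. ball 0 \<epsilon> \<subseteq> \<Omega> \<and>
        (\<forall>x\<in>ball 0 \<epsilon>. \<forall>t\<ge>0. norm (X x t) \<le> C * exp (- \<nu> * t) * norm x)"
    using adm unfolding admissible_def by blast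
  have sol: "X x 0 = x" "\<And>t. 0 \<le> t \<Longrightarrow> X x t \<in> \<Omega>"
    "\<And>t. 0 \<le> t \<Longrightarrow> (X x has_vector_derivative closed_loop u (X x t)) (at t within {0..})" if "x \<in> \<Omega>" for x
    using flow that by (auto simp: is_closed_loop_flow_def solves_closed_loop_def closed_loop_def)
  have "stable_flow (closed_loop u) \<Omega> X"
  proof
    show "closed_loop u 0 = 0"
      using data dom by (simp add: closed_loop_def data_assumption_def)
    show "smooth_on (closed_loop u) \<Omega>"
      unfolding smooth_on_def using Ck_on_closed_loop[OF smooth_onD[OF u_smooth]] by blast
    show "(X x \<longlongrightarrow> 0) at_top" if "x \<in> \<Omega>" for x
      using lim that by (simp add: tendsto_norm_zero_iff)
  qed (use dom sol exp in auto)
  then show ?thesis by blast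
qed

lemma solves_policy_equation_iff:
  "solves_policy_equation f g h R u \<Omega> v \<longleftrightarrow>
    Ck_on (Suc 0) v \<Omega> \<and> v 0 = 0 \<and> (\<forall>x\<in>\<Omega>. bderiv v x (closed_loop u x) = - running_cost x)"
proof -
  have "(f x + g x *v u x) \<bullet> grad v x + h x + u x \<bullet> (R *v u x) = 0 \<longleftrightarrow>
      bderiv v x (closed_loop u x) = - running_cost x" if "Ck_on (Suc 0) v \<Omega>" "x \<in> \<Omega>" for x
  proof -
    have "v differentiable (at x)" using that by simp
    from inner_grad[OF this, of "closed_loop u x"] show ?thesis
      by (auto simp: closed_loop_def running_cost_def)
  qed
  then show ?thesis unfolding solves_policy_equation_def One_nat_def by blast
qed

lemma policy_equation_smooth_solution:
  "\<exists>v. solves_policy_equation f g h R u \<Omega> v \<and> smooth_on v \<Omega>"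
proof -
  obtain X where "stable_flow (closed_loop u) \<Omega> X" using stable_flow_exists by blast
  then interpret stable_flow "closed_loop u" \<Omega> X .
  show ?thesis
  proof -
    obtain v where "smooth_on v \<Omega>" "v 0 = 0" "\<forall>x\<in>\<Omega>. bderiv v x (closed_loop u x) = - running_cost x"
      using smooth_value_exists[OF smooth_running_cost running_cost_zero] by (elim exE conjE)
    moreover from this(1) have "Ck_on (Suc 0) v \<Omega>" by (rule smooth_onD)
    ultimately show ?thesis unfolding solves_policy_equation_iff by (intro exI[of _ v] conjI)
  qed
qed

lemma policy_equation_unique:
  assumes "solves_policy_equation f g h R u \<Omega> v" "solves_policy_equation f g h R u \<Omega> w" "x \<in> \<Omega>"
  shows "v x = w x"
proof -
  obtain X where "stable_flow (closed_loop u) \<Omega> X" using stable_flow_exists by blast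
  then interpret stable_flow "closed_loop u" \<Omega> X .
  show ?thesis
  proof (rule value_unique[of v w x])
    show "Ck_on (Suc 0) v \<Omega>" "Ck_on (Suc 0) w \<Omega>" "v 0 = w 0"
      using assms unfolding solves_policy_equation_iff by auto
    show "bderiv v y (closed_loop u y) = bderiv w y (closed_loop u y)" if "y \<in> \<Omega>" for y
      using assms that unfolding solves_policy_equation_iff by auto
  qed (rule assms(3))
qed

text \<open>The equation asks for one continuous derivative only; by uniqueness its solution
  coincides with the smooth one on the open domain.\<close>

lemma policy_equation_smooth:
  assumes "solves_policy_equation f g h R u \<Omega> v"
  shows "smooth_on v \<Omega>"
proof -
  obtain w where w: "solves_policy_equation f g h R u \<Omega> w" "smooth_on w \<Omega>"
    using policy_equation_smooth_solution by blast
  show ?thesis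
    unfolding smooth_on_def
    using Ck_on_cong[OF dom(2) policy_equation_unique[OF w(1) assms] smooth_onD[OF w(2)]] by blast
qed

context
  fixes v :: "real^'n \<Rightarrow> real"
  assumes v: "solves_policy_equation f g h R u \<Omega> v"
begin

lemma v_C1: "Ck_on (Suc 0) v \<Omega>" and v_zero: "v 0 = 0"
  and v_eq: "x \<in> \<Omega> \<Longrightarrow> bderiv v x (closed_loop u x) = - running_cost x"
  using v unfolding solves_policy_equation_iff by auto

lemma v_nonneg: "x \<in> \<Omega> \<Longrightarrow> 0 \<le> v x"
proof -
  obtain X where "stable_flow (closed_loop u) \<Omega> X" using stable_flow_exists by blast
  then interpret stable_flow "closed_loop u" \<Omega> X .
  show "x \<in> \<Omega> \<Longrightarrow> 0 \<le> v x"
    by (rule value_nonneg[OF v_C1 v_zero v_eq running_cost_pos running_cost_zero])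
qed

lemma v_sublevel_small:
  assumes "0 < \<rho>"
  shows "\<exists>c>0. \<forall>y\<in>\<Omega>. v y < c \<longrightarrow> norm y < \<rho>"
proof -
  obtain X where "stable_flow (closed_loop u) \<Omega> X" using stable_flow_exists by blast
  then interpret stable_flow "closed_loop u" \<Omega> X .
  obtain c where "0 < c" "\<And>x. x \<in> \<Omega> \<Longrightarrow> v x < c \<Longrightarrow> norm x < \<rho>"
    by (rule value_sublevel_small[OF v_C1 v_zero v_eq running_cost_pos running_cost_zero assms]) (assumption | rule that)+
  then show ?thesis by blast
qed

lemma admissible_levels_nonempty:
  assumes "0 < \<nu>" "\<nu> < 1"
  shows "admissible_levels \<Omega> v \<nu> \<noteq> {}"
proof -
  obtain \<rho> where \<rho>: "0 < \<rho>" "cball 0 \<rho> \<subseteq> \<Omega>" using dom open_contains_cball by blast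
  obtain c where c: "0 < c" "\<forall>y\<in>\<Omega>. v y < c \<longrightarrow> norm y < \<rho>" using v_sublevel_small[OF \<rho>(1)] by blast
  have "{x\<in>\<Omega>. v x < min c (inverse (1 - \<nu>))} \<subseteq> cball 0 \<rho>" using c(2) by (auto simp: less_imp_le)
  then have "closure {x\<in>\<Omega>. v x < min c (inverse (1 - \<nu>))} \<subseteq> cball 0 \<rho>"
    by (rule closure_minimal) (rule closed_cball)
  then have "min c (inverse (1 - \<nu>)) \<in> admissible_levels \<Omega> v \<nu>"
    using \<rho> c assms by (auto simp: admissible_levels_def)
  then show ?thesis by blast
qed

lemma admissible_levels_bdd: "bdd_above (admissible_levels \<Omega> v \<nu>)"
  by (rule bdd_aboveI[of _ "inverse (1 - \<nu>)"]) (auto simp: admissible_levels_def)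

text \<open>The supremum itself may fail to be an admissible level. The factor
  \<open>\<nu> < 1\<close> places the critical level strictly below it, hence below some admissible
  level, whose sublevel set is larger.\<close>

lemma critical_level:
  assumes \<nu>: "\<nu> \<in> {0<..<1}"
  shows "0 < critical_level \<Omega> v \<nu>" "closure {x\<in>\<Omega>. v x < critical_level \<Omega> v \<nu>} \<subseteq> \<Omega>"
proof -
  let ?A = "admissible_levels \<Omega> v \<nu>"
  have ne: "?A \<noteq> {}" using admissible_levels_nonempty \<nu> by auto
  then obtain c where "c \<in> ?A" by blast
  then have "0 < c" "c \<le> Sup ?A"
    using cSup_upper[OF _ admissible_levels_bdd] by (auto simp: admissible_levels_def)
  then have S: "0 < Sup ?A" by simp
  then show "0 < critical_level \<Omega> v \<nu>" using \<nu> by (simp add: critical_level_def)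
  have "critical_level \<Omega> v \<nu> < Sup ?A" using S \<nu> by (simp add: critical_level_def)
  then obtain c' where c': "c' \<in> ?A" "critical_level \<Omega> v \<nu> < c'"
    using less_cSupE[OF _ ne] by blast
  have "closure {x\<in>\<Omega>. v x < critical_level \<Omega> v \<nu>} \<subseteq> closure {x\<in>\<Omega>. v x < c'}"
    using c'(2) by (intro closure_mono) auto
  also have "\<dots> \<subseteq> \<Omega>" using c'(1) by (simp add: admissible_levels_def)
  finally show "closure {x\<in>\<Omega>. v x < critical_level \<Omega> v \<nu>} \<subseteq> \<Omega>" .
qed

lemma next_domain_subset: "next_domain \<Omega> v \<subseteq> \<Omega>"
  by (auto simp: next_domain_def)

lemma is_domain_next_domain: "is_domain (next_domain \<Omega> v)" "0 \<in> next_domain \<Omega> v"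
proof -
  show 0: "0 \<in> next_domain \<Omega> v"
    using critical_level(1)[of "1/2"] dom v_zero by (auto simp: next_domain_def intro!: bexI[of _ "1/2"])
  have "open {x\<in>\<Omega>. v x < c}" for c
    using continuous_open_preimage[OF Ck_on_imp_continuous_on[OF v_C1] dom(2) open_lessThan[of c]]
    by (simp add: vimage_def Int_def conj_commute)
  then have "open (next_domain \<Omega> v)" unfolding next_domain_def by blast
  moreover have "connected (next_domain \<Omega> v)"
  proof -
    obtain X where "stable_flow (closed_loop u) \<Omega> X" using stable_flow_exists by blast
    then interpret stable_flow "closed_loop u" \<Omega> X .
    \<comment> \<open>The trajectory together with its limit \<open>0\<close>: connected, being
      between a connected set and its closure. All these sets share \<open>0\<close>, so their union
      is connected.\<close>
    define A where "A = (\<lambda>x. insert 0 (X x ` {0..}))"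
    have A: "connected (A x)" "x \<in> A x" "A x \<subseteq> next_domain \<Omega> v" if x: "x \<in> next_domain \<Omega> v" for x
    proof -
      have xO: "x \<in> \<Omega>" using x next_domain_subset by blast
      have "0 \<in> closure (X x ` {0..})"
        by (rule Lim_in_closed_set[OF closed_closure eventually_mono[OF eventually_ge_at_top[of 0]] _ X_lim[OF xO]])
          (auto intro: closure_subset[THEN subsetD])
      then show "connected (A x)"
        unfolding A_def
        by (intro connected_intermediate_closure[OF connected_continuous_image[OF X_continuous[OF xO]]])
          (auto intro: closure_subset[THEN subsetD])
      show "x \<in> A x" unfolding A_def using X_zero[OF xO] by (auto intro!: image_eqI[of _ _ 0])
      show "A x \<subseteq> next_domain \<Omega> v"
        unfolding A_def
      proof (intro insert_subsetI 0 image_subsetI)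
        fix t :: real assume "t \<in> {0..}"
        then have t: "0 \<le> t" by simp
        have "v (X x t) \<le> v x"
          by (rule value_decreasing[OF v_C1 v_zero v_eq running_cost_pos running_cost_zero xO t])
        then show "X x t \<in> next_domain \<Omega> v"
          using x X_in[OF xO t] unfolding next_domain_def by force
      qed
    qed
    have "connected (\<Union>x\<in>next_domain \<Omega> v. A x)"
      by (rule connected_Union) (use A in \<open>auto simp: A_def\<close>)
    moreover have "(\<Union>x\<in>next_domain \<Omega> v. A x) = next_domain \<Omega> v" using A by blast
    ultimately show ?thesis by simp
  qed
  ultimately show "is_domain (next_domain \<Omega> v)" using 0 by (auto simp: is_domain_def)
qed

context
  fixes u' :: "real^'n \<Rightarrow> real^'m"
  assumes u': "\<And>x. x \<in> \<Omega> \<Longrightarrow> u' x = - (1 / 2) *\<^sub>R (matrix_inv R *v (transpose (g x) *v grad v x))"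
begin

lemma smooth_improved_policy: "smooth_on u' \<Omega>"
proof -
  have "Ck_on k (\<lambda>x. - (1 / 2) *\<^sub>R (matrix_inv R *v (transpose (g x) *v grad v x))) \<Omega>" for k
    by (intro Ck_on_bounded_linear[OF bounded_linear_scaleR_right] Ck_on_bounded_linear[OF matrix_vector_mul_bounded_linear]
        Ck_on_bilinear[OF bounded_bilinear_matrix_vector_mult] Ck_on_bounded_linear[OF bounded_linear_transpose]
        Ck_on_data Ck_on_grad smooth_onD[OF policy_equation_smooth[OF v]] dom(2))
  then show ?thesis
    unfolding smooth_on_def by (intro allI Ck_on_cong[OF dom(2), where G = u']) (simp_all add: u')
qed

lemma improved_policy_descent:
  assumes x: "x \<in> \<Omega>"
  shows "bderiv v x (closed_loop u' x) =
    - h x - u' x \<bullet> (R *v u' x) - (u x - u' x) \<bullet> (R *v (u x - u' x))"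
proof -
  let ?p = "transpose (g x) *v grad v x"
  have diff: "v differentiable (at x)" using v_C1 x by simp
  have inv: "R *v (matrix_inv R *v p) = p" for p
    by (simp add: matrix_vector_mul_assoc invertible_matrix_inv_right[OF sym_pos_def_invertible[OF R_pos]])
  have "R *v u' x = - (1/2) *\<^sub>R (R *v (matrix_inv R *v ?p))"
    unfolding u'[OF x] by (rule matrix_vector_mult_scaleR)
  also have "\<dots> = - (1/2) *\<^sub>R ?p"
    by (simp only: inv)
  \<comment> \<open>The definition of \<open>u'\<close> read backwards: the gradient of
    \<open>v\<close> can be traded for \<open>R *v u' x\<close> in every control term.\<close>
  finally have Ru': "?p = - 2 *\<^sub>R (R *v u' x)" by simp
  have g: "bderiv v x (g x *v w) = - 2 * (w \<bullet> (R *v u' x))" for w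
  proof -
    have "bderiv v x (g x *v w) = (g x *v w) \<bullet> grad v x" by (rule inner_grad[OF diff, symmetric])
    also have "\<dots> = w \<bullet> ?p"
      by (metis dot_lmul_matrix inner_commute transpose_matrix_vector)
    finally show ?thesis unfolding Ru' by simp
  qed
  have "bderiv v x (closed_loop u' x) = bderiv v x (closed_loop u x) + bderiv v x (g x *v u' x) - bderiv v x (g x *v u x)"
    by (simp add: closed_loop_def blinfun.bilinear_simps)
  also have "\<dots> = - h x - u x \<bullet> (R *v u x) - 2 * (u' x \<bullet> (R *v u' x)) + 2 * (u x \<bullet> (R *v u' x))"
    by (simp add: v_eq[OF x] g running_cost_def)
  also have "\<dots> = - h x - u' x \<bullet> (R *v u' x) - (u x - u' x) \<bullet> (R *v (u x - u' x))"
    by (simp add: matrix_vector_mult_diff_distrib inner_diff_left inner_diff_right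
        sym_pos_def_inner_commute[OF R_pos, of "u' x" "u x"])
  finally show ?thesis .
qed

text \<open>The value has a minimum at \<open>0\<close>, so its gradient vanishes there.\<close>

lemma improved_policy_zero: "u' 0 = 0"
proof -
  have "blinfun_apply (bderiv v 0) = (\<lambda>h. 0)"
  proof (rule has_derivative_local_min[OF has_derivative_bderiv[OF v_C1 dom(3)]])
    show "\<forall>\<^sub>F y in at 0. v 0 \<le> v y"
      using eventually_at_in_open[OF dom(2,3)] by eventually_elim (simp add: v_zero v_nonneg)
  qed
  moreover have "v differentiable (at 0)" using v_C1 dom by simp
  ultimately have "grad v 0 = 0" by (simp add: grad_eq)
  then show ?thesis by (simp add: u'[OF dom(3)])
qed

text \<open>Existence comes from trapping in a sublevel set, uniqueness from smoothness of
  \<open>u'\<close>, and exponential stability from viewing the new closed loop as a perturbation of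
  the old one.\<close>

lemma improved_policy_admissible: "admissible f g u' (next_domain \<Omega> v)"
proof -
  let ?D = "next_domain \<Omega> v" and ?F = "closed_loop u'"
  obtain X where "stable_flow (closed_loop u) \<Omega> X" using stable_flow_exists by blast
  then interpret stable_flow "closed_loop u" \<Omega> X .
  have F_C1: "Ck_on 1 ?F \<Omega>" by (rule Ck_on_closed_loop[OF smooth_onD[OF smooth_improved_policy]])
  obtain l where l: "0 < l" "\<And>y. l * (norm y)\<^sup>2 \<le> y \<bullet> (R *v y)"
    by (rule sym_pos_def_coercive[OF R_pos]) (rule that)
  have h_pos: "0 \<le> h x" "x \<noteq> 0 \<Longrightarrow> 0 < h x" "h 0 = 0" for x
    using data by (auto simp: data_assumption_def intro: less_imp_le) (cases "x = 0", auto intro: less_imp_le)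
  have dec_h: "bderiv v x (?F x) \<le> - h x" if "x \<in> \<Omega>" for x
    using improved_policy_descent[OF that] quadratic_nonneg[of "u' x"] quadratic_nonneg[of "u x - u' x"] by simp
  have dec_u: "bderiv v x (?F x) \<le> - l * (norm (u x - u' x))\<^sup>2" if "x \<in> \<Omega>" for x
    using improved_policy_descent[OF that] quadratic_nonneg[of "u' x"] l(2)[of "u x - u' x"] h_pos(1)[of x] by simp
  have sol: "\<exists>\<phi>. \<phi> 0 = x \<and> (\<forall>t\<ge>0. \<phi> t \<in> ?D \<and> (\<phi> has_vector_derivative ?F (\<phi> t)) (at t within {0..})) \<and>
      ((\<lambda>t. norm (\<phi> t)) \<longlongrightarrow> 0) at_top" if x: "x \<in> ?D" for x
  proof -
    \<comment> \<open>Trapping is carried out at a single \<open>\<nu>\<close> depending on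
      \<open>x\<close>: closures of the individual sublevel sets lie in the domain, which is not
      clear for their union.\<close>
    obtain \<nu> where \<nu>: "\<nu> \<in> {0<..<1}" "x \<in> \<Omega>" "v x < critical_level \<Omega> v \<nu>"
      using x unfolding next_domain_def by blast
    let ?S = "{x\<in>\<Omega>. v x < critical_level \<Omega> v \<nu>}"
    have comp: "compact (closure ?S)"
      using bounded_dom by (intro compact_closure[THEN iffD2]) (auto elim: bounded_subset)
    have dec0: "bderiv v y (?F y) \<le> 0" if "y \<in> \<Omega>" for y
      using dec_h[OF that] h_pos(1)[of y] by simp
    obtain \<phi> where \<phi>: "\<phi> 0 = x"
      "\<And>t. 0 \<le> t \<Longrightarrow> \<phi> t \<in> ?S \<and> (\<phi> has_vector_derivative ?F (\<phi> t)) (at t within {0..})"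
      using trapped_solution[OF dom(2) F_C1 v_C1 refl comp critical_level(2)[OF \<nu>(1)] dec0, of x] \<nu> by blast
    have "((\<lambda>t. norm (\<phi> t)) \<longlongrightarrow> 0) at_top"
    proof (rule lyapunov_convergence[OF v_C1 v_zero v_nonneg v_sublevel_small _ h_pos(2,3) dec_h comp critical_level(2)[OF \<nu>(1)]])
      show "continuous_on \<Omega> h" using Ck_on_data(3)[of 0] by simp
      show "\<phi> t \<in> closure ?S \<and> (\<phi> has_vector_derivative ?F (\<phi> t)) (at t within {0..})" if "0 \<le> t" for t
        using \<phi>(2)[OF that] by (intro conjI subsetD[OF closure_subset]) (rule conjunct1, assumption, rule conjunct2)
    qed
    moreover have "\<phi> t \<in> ?D" if "0 \<le> t" for t
      unfolding next_domain_def by (rule UN_I[OF \<nu>(1)]) (rule conjunct1[OF \<phi>(2)[OF that]])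
    ultimately show ?thesis using \<phi> by (intro exI[of _ \<phi>]) simp
  qed
  then obtain Y where Y: "\<And>x. x \<in> ?D \<Longrightarrow> Y x 0 = x"
    "\<And>x t. x \<in> ?D \<Longrightarrow> 0 \<le> t \<Longrightarrow> Y x t \<in> ?D"
    "\<And>x t. x \<in> ?D \<Longrightarrow> 0 \<le> t \<Longrightarrow> (Y x has_vector_derivative ?F (Y x t)) (at t within {0..})"
    "\<And>x. x \<in> ?D \<Longrightarrow> ((\<lambda>t. norm (Y x t)) \<longlongrightarrow> 0) at_top"
    by metis
  have flow: "is_closed_loop_flow f g u' ?D Y"
    unfolding is_closed_loop_flow_def
  proof (intro ballI conjI allI impI)
    fix x assume x: "x \<in> ?D"
    show "solves_closed_loop f g u' ?D {0..} x (Y x)"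
      using Y(1-3)[OF x] by (auto simp: solves_closed_loop_def closed_loop_def)
    \<comment> \<open>A competing solution lives on a half-open interval; it is compared on
      \<open>{0..t}\<close> and inside \<open>\<Omega>\<close>, where the new closed loop is
      continuously differentiable.\<close>
    fix T t :: real and \<phi> assume \<phi>: "solves_closed_loop f g u' ?D {0..<T} x \<phi>" and t: "t \<in> {0..<T}"
    show "\<phi> t = Y x t"
    proof (rule C1_solution_unique[OF dom(2) F_C1])
      fix s assume s: "0 \<le> s" "s \<le> t"
      have "\<phi> s \<in> ?D" "(\<phi> has_vector_derivative ?F (\<phi> s)) (at s within {0..<T})"
        using \<phi> s t by (auto simp: solves_closed_loop_def closed_loop_def)
      then show "\<phi> s \<in> \<Omega> \<and> (\<phi> has_vector_derivative ?F (\<phi> s)) (at s within {0..t})"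
        using next_domain_subset t by (auto intro: has_vector_derivative_within_subset)
      show "Y x s \<in> \<Omega> \<and> (Y x has_vector_derivative ?F (Y x s)) (at s within {0..t})"
        using Y(2)[OF x s(1)] Y(3)[OF x s(1)] next_domain_subset
        by (auto intro: has_vector_derivative_within_subset)
    next
      show "\<phi> 0 = Y x 0" using \<phi> Y(1)[OF x] by (simp add: solves_closed_loop_def)
    qed (use t in auto)
  qed
  have exp: "\<exists>\<epsilon>>0. \<exists>C>0. \<exists>\<nu>>0. ball 0 \<epsilon> \<subseteq> ?D \<and>
      (\<forall>x\<in>ball 0 \<epsilon>. \<forall>t\<ge>0. norm (Y x t) \<le> C * exp (- \<nu> * t) * norm x)"
  proof -
    obtain \<rho> where \<rho>: "0 < \<rho>" "cball 0 \<rho> \<subseteq> \<Omega>" using dom open_contains_cball by blast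
    obtain k where k: "0 < k" "\<And>A y. norm (A *v y) \<le> norm (A :: real^'m^'n) * norm y * k"
      using bounded_bilinear.pos_bounded[OF bounded_bilinear_matrix_vector_mult] by metis
    have "continuous_on (cball 0 \<rho>) g"
      using Ck_on_imp_continuous_on[OF Ck_on_data(2)[of 0]] \<rho>(2) by (rule continuous_on_subset)
    then have "bounded (g ` cball 0 \<rho>)" by (intro compact_imp_bounded compact_continuous_image compact_cball)
    then obtain M where M: "0 < M" "\<And>y. y \<in> cball 0 \<rho> \<Longrightarrow> norm (g y) \<le> M" unfolding bounded_pos by blast
    have pert: "norm (?F y - closed_loop u y) \<le> (M * k) * norm (u y - u' y)" if y: "norm y \<le> \<rho>" for y
    proof -
      have "?F y - closed_loop u y = g y *v (u' y - u y)"
        by (simp add: closed_loop_def matrix_vector_mult_diff_distrib)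
      then have "norm (?F y - closed_loop u y) \<le> norm (g y) * norm (u' y - u y) * k" using k(2) by simp
      also have "\<dots> \<le> M * norm (u' y - u y) * k"
        using M(2)[of y] y k(1) by (intro mult_right_mono) auto
      finally show ?thesis by (simp add: norm_minus_commute mult_ac)
    qed
    obtain \<epsilon> C \<nu> where e: "0 < \<epsilon>" "0 < C" "0 < \<nu>" and
      st: "\<forall>\<phi>. (\<forall>t\<ge>0. \<phi> t \<in> \<Omega> \<and> (\<phi> has_vector_derivative ?F (\<phi> t)) (at t within {0..})) \<longrightarrow>
      \<phi> 0 \<in> ball 0 \<epsilon> \<longrightarrow> (\<forall>t\<ge>0. norm (\<phi> t) \<le> C * exp (- \<nu> * t) * norm (\<phi> 0))"
      using perturbed_exponential_stability[OF smooth_onD[OF policy_equation_smooth[OF v]] v_zero v_nonneg \<rho>(1),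
          of ?F "M * k" "\<lambda>y. norm (u y - u' y)" l] pert M(1) k(1) l(1) dec_u by auto
    \<comment> \<open>The stability estimate comes with a ball inside \<open>\<Omega>\<close>; it is
      shrunk to fit into the new domain.\<close>
    obtain e' where e': "0 < e'" "ball 0 e' \<subseteq> ?D"
      using is_domain_next_domain open_contains_ball unfolding is_domain_def by blast
    have "\<forall>x\<in>ball 0 (min \<epsilon> e'). \<forall>t\<ge>0. norm (Y x t) \<le> C * exp (- \<nu> * t) * norm x"
    proof (intro ballI allI impI)
      fix x :: "real^'n" and t :: real assume x: "x \<in> ball 0 (min \<epsilon> e')" and t: "0 \<le> t"
      then have xD: "x \<in> ?D" using e'(2) by auto
      show "norm (Y x t) \<le> C * exp (- \<nu> * t) * norm x"
        using st[rule_format, of "Y x" t] Y(1-3)[OF xD] next_domain_subset x t by auto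
    qed
    moreover have "ball 0 (min \<epsilon> e') \<subseteq> ?D" "0 < min \<epsilon> e'" using e(1) e' by auto
    ultimately show ?thesis using e(2,3) by blast
  qed
  have "continuous_on ?D u'"
    using Ck_on_imp_continuous_on[OF smooth_onD[OF smooth_improved_policy, of 0]] next_domain_subset
    by (rule continuous_on_subset)
  then show ?thesis
    unfolding admissible_def using is_domain_next_domain improved_policy_zero flow Y(4) exp by blast
qed

end

end

lemma policy_step_well_defined: "policy_step_well_defined f g h R u \<Omega>"
  unfolding policy_step_well_defined_def
proof (intro conjI allI impI ballI)
  show "invertible R" by (rule sym_pos_def_invertible[OF R_pos])
  show "\<exists>v. solves_policy_equation f g h R u \<Omega> v" using policy_equation_smooth_solution by blast
  show "v x = w x" if "solves_policy_equation f g h R u \<Omega> v" "solves_policy_equation f g h R u \<Omega> w" "x \<in> \<Omega>" for v w x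
    using that by (rule policy_equation_unique)
  show "admissible_levels \<Omega> v \<nu> \<noteq> {}" if "solves_policy_equation f g h R u \<Omega> v" "\<nu> \<in> {0<..<1}" for v \<nu>
    using that by (intro admissible_levels_nonempty) auto
  show "bdd_above (admissible_levels \<Omega> v \<nu>)" if "solves_policy_equation f g h R u \<Omega> v" for v \<nu>
    using that by (rule admissible_levels_bdd)
qed

lemma policy_step_preserves:
  assumes step: "policy_step f g h R u \<Omega> v u' \<Omega>'"
  shows "bounded \<Omega>'" "smooth_on u' \<Omega>'" "admissible f g u' \<Omega>'"
proof -
  have v: "solves_policy_equation f g h R u \<Omega> v" and \<Omega>': "\<Omega>' = next_domain \<Omega> v"
    and u': "\<And>x. x \<in> \<Omega> \<Longrightarrow> u' x = - (1 / 2) *\<^sub>R (matrix_inv R *v (transpose (g x) *v grad v x))"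
    using step by (simp_all add: policy_step_def)
  show "bounded \<Omega>'" unfolding \<Omega>' by (rule bounded_subset[OF bounded_dom next_domain_subset[OF v]])
  show "smooth_on u' \<Omega>'"
    unfolding smooth_on_def \<Omega>'
    using Ck_on_subset[OF smooth_onD[OF smooth_improved_policy[OF v u']] next_domain_subset[OF v]] by blast
  show "admissible f g u' \<Omega>'" using improved_policy_admissible[OF v u'] by (simp add: \<Omega>')
qed

end

text \<open>An infinite run comes from dependent choice. The claims about stage \<open>s\<close> are
  proved for arbitrary runs of that length, so that they do not depend on how controllers and values
  are continued outside their domains.\<close>

theorem theorem4p3:
  fixes f :: "real^'n \<Rightarrow> real^'n"
    and g :: "real^'n \<Rightarrow> real^'m^'n"
    and h :: "real^'n \<Rightarrow> real"
    and R :: "real^'m^'m"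
    and u\<^sub>0 :: "real^'n \<Rightarrow> real^'m"
    and \<Omega> :: "(real^'n) set"
  assumes "data_assumption f g h R"
    and "is_domain \<Omega>" and "bounded \<Omega>"
    and "smooth_on u\<^sub>0 \<Omega>"
    and "admissible f g u\<^sub>0 \<Omega>"
  shows "(\<exists>u D v. \<forall>n. policy_iteration f g h R u\<^sub>0 \<Omega> n u D v) \<and>
    (\<forall>s u D v. policy_iteration f g h R u\<^sub>0 \<Omega> s u D v \<longrightarrow>
      D s \<noteq> {} \<and>
      smooth_on (u s) (D s) \<and>
      admissible f g (u s) (D s) \<and>
      policy_step_well_defined f g h R (u s) (D s))"
proof (intro conjI allI impI)
  \<comment> \<open>Boundedness belongs to the invariant because the next step needs compact
    closures of sublevel sets.\<close>
  define good where "good = (\<lambda>u (D :: (real^'n) set). bounded D \<and> smooth_on u D \<and> admissible f g u D)"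
  have good0: "good u\<^sub>0 \<Omega>" using assms by (simp add: good_def)
  have good_step: "good u' D'" if "good u D" "policy_step f g h R u D v u' D'" for u D v u' D'
    using policy_step_preserves[OF assms(1) _ _ _ that(2)] that(1) by (simp add: good_def)
  have good_ex: "\<exists>v. solves_policy_equation f g h R u D v" if "good u D" for u D
    using policy_equation_smooth_solution[OF assms(1)] that by (auto simp: good_def)
  show "\<exists>u D v. \<forall>n. policy_iteration f g h R u\<^sub>0 \<Omega> n u D v"
  proof -
    \<comment> \<open>The value function is carried in the state because it is the only object that
      has to be chosen; the next controller and domain are computed from it.\<close>
    define P where "P = (\<lambda>(n :: nat) (u, D, v). good u D \<and> solves_policy_equation f g h R u D v \<and>
      (n = 0 \<longrightarrow> u = u\<^sub>0 \<and> D = \<Omega>))"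
    define Q where "Q = (\<lambda>(n :: nat) (u, D, v) (u', D', v' :: real^'n \<Rightarrow> real). policy_step f g h R u D v u' D')"
    have "\<exists>p. \<forall>n. P n (p n) \<and> Q n (p n) (p (Suc n))"
    proof (rule dependent_nat_choice)
      obtain v where "solves_policy_equation f g h R u\<^sub>0 \<Omega> v" using good_ex[OF good0] by blast
      then show "\<exists>p. P 0 p" using good0 by (intro exI[of _ "(u\<^sub>0, \<Omega>, v)"]) (simp add: P_def)
    next
      fix p n assume p: "P n p"
      obtain u D v where p_eq: "p = (u, D, v)" by (cases p)
      have good: "good u D" and v: "solves_policy_equation f g h R u D v" using p by (auto simp: P_def p_eq)
      define u' where "u' = (\<lambda>x. - (1 / 2) *\<^sub>R (matrix_inv R *v (transpose (g x) *v grad v x)))"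
      have step: "policy_step f g h R u D v u' (next_domain D v)"
        using v by (simp add: policy_step_def u'_def)
      from good_step[OF good step] have good': "good u' (next_domain D v)" .
      obtain v' where "solves_policy_equation f g h R u' (next_domain D v) v'" using good_ex[OF good'] by blast
      then show "\<exists>q. P (Suc n) q \<and> Q n p q"
        using good' step by (intro exI[of _ "(u', next_domain D v, v')"]) (simp add: P_def Q_def p_eq)
    qed
    then obtain p where p: "\<And>n. P n (p n)" "\<And>n. Q n (p n) (p (Suc n))" by blast
    have "policy_iteration f g h R u\<^sub>0 \<Omega> n (\<lambda>k. fst (p k)) (\<lambda>k. fst (snd (p k))) (\<lambda>k. snd (snd (p k)))" for n
      using p(1)[of 0] p(2) by (auto simp: policy_iteration_def P_def Q_def split_beta)
    then show ?thesis by blast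
  qed
  fix s u D v assume it: "policy_iteration f g h R u\<^sub>0 \<Omega> s u D v"
  have "good (u k) (D k)" if "k \<le> s" for k
    using that
  proof (induction k)
    case 0
    then show ?case using it good0 by (simp add: policy_iteration_def)
  next
    case (Suc k)
    then have "good (u k) (D k)" by simp
    moreover have "policy_step f g h R (u k) (D k) (v k) (u (Suc k)) (D (Suc k))"
      using it Suc.prems by (auto simp: policy_iteration_def)
    ultimately show ?case by (rule good_step)
  qed
  then have good: "good (u s) (D s)" by simp
  then show "smooth_on (u s) (D s)" "admissible f g (u s) (D s)" by (auto simp: good_def)
  then show "D s \<noteq> {}" unfolding admissible_def by blast
  show "policy_step_well_defined f g h R (u s) (D s)"
    using policy_step_well_defined[OF assms(1)] good by (auto simp: good_def)
qed

end
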